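(* Let $k\geq1$ be an integer and let $0<\lambda\leq e-1$. Then the unique simple invariant Gibbs measure $\tilde\mu$ for the hard-core model with activity $\lambda$ on the $(k+1)$-regular tree is extremal in the set of all Gibbs measures for the hard-core model with activity $\lambda$ on that tree. In particular, this holds for $\lambda=1$, for every $k$.
   Context: Let $\tilde{\mathbb{T}}^k$ be the $(k+1)$-regular tree (infinite tree in which every node has exactly $k+1$ neighbours). For $\phi\in\{0,1\}^{\tilde{\mathbb{T}}^k}$ let $I_\phi=\{u:\phi(u)=1\}$. A set of nodes is independent if no two of its members are neighbours. A probability measure $\nu$ on $\{0,1\}^{\tilde{\mathbb{T}}^k}$ is a Gibbs measure for the hard-core model with activity $\lambda>0$ if for every node $u$ and $\nu$-almost every $\phi_0$, $$\nu\big(\phi(u)=1\mid \phi(v)=\phi_0(v)\text{ for all }v\neq u\big)=\frac{\lambda}{1+\lambda}\,\mathbf{1}\{I_{\phi_0}\cup\{u\}\text{ is independent}\}.$$ For each $\lambda$ the set of Gibbs measures is convex; a Gibbs measure is extremal if it is not a nontrivial convex combination of two distinct Gibbs measures. A measure is simple if for every node $u$ the configurations on the $k+1$ connected components of $\tilde{\mathbb{T}}^k\setminus\{u\}$ are mutually independent given $\phi(u)$. It is invariant if it is preserved by every automorphism of $\tilde{\mathbb{T}}^k$. For each $\lambda>0$ there is exactly one simple invariant Gibbs measure $\tilde\mu$. It is given explicitly as follows: let $w>0$ be the unique positive solution of $\lambda=w(1+w)^k$; choose a root of $\tilde{\mathbb{T}}^k$ (so the root has $k+1$ children and every other node has $k$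 children); the root takes value $0$ with probability $(1+w)/(1+2w)$ and value $1$ with probability $w/(1+2w)$; recursively and independently, each child of a node with value $0$ takes value $0$ with probability $1/(1+w)$ and value $1$ with probability $w/(1+w)$, and each child of a node with value $1$ takes value $0$. Then $\tilde\mu$ is the law of the resulting configuration (it does not depend on the choice of root). *)

theory Defs
  imports "HOL-Probability.Probability"
begin

section \<open>Regular trees\<close>

text \<open>The nodes are all the elements of the type \<open>'v\<close>. In the last clause \<open>xs\<close> lists the
  nodes of a cycle. Since \<open>k + 1 > 0\<close>, the clause on degrees forces neighbourhoods to be finite.\<close>

definition regular_tree :: "nat \<Rightarrow> ('v \<Rightarrow> 'v \<Rightarrow> bool) \<Rightarrow> bool" where
  "regular_tree k adj \<longleftrightarrow>
     (\<forall>u v. adj u v \<longrightarrow> adj v u) \<and>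
     (\<forall>u. \<not> adj u u) \<and>
     (\<forall>u. card {v. adj u v} = k + 1) \<and>
     (\<forall>u v. adj\<^sup>*\<^sup>* u v) \<and>
     \<not> (\<exists>xs. length xs \<ge> 3 \<and> distinct xs \<and> successively adj xs \<and> adj (last xs) (hd xs))"

definition automorphism :: "('v \<Rightarrow> 'v \<Rightarrow> bool) \<Rightarrow> ('v \<Rightarrow> 'v) \<Rightarrow> bool" where
  "automorphism adj g \<longleftrightarrow> bij g \<and> (\<forall>u v. adj (g u) (g v) \<longleftrightarrow> adj u v)"

definition independent_set :: "('v \<Rightarrow> 'v \<Rightarrow> bool) \<Rightarrow> 'v set \<Rightarrow> bool" where
  "independent_set adj S \<longleftrightarrow> (\<forall>x\<in>S. \<forall>y\<in>S. \<not> adj x y)"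

definition components_without :: "('v \<Rightarrow> 'v \<Rightarrow> bool) \<Rightarrow> 'v \<Rightarrow> 'v set set" where
  "components_without adj u =
     (\<lambda>v. {w. (\<lambda>x y. adj x y \<and> x \<noteq> u \<and> y \<noteq> u)\<^sup>*\<^sup>* v w}) ` (- {u})"


section \<open>Measures on configurations\<close>

text \<open>A configuration in \<open>{0,1}\<close> to the power of the node set is a function \<open>'v \<Rightarrow> bool\<close>, where
  \<open>True\<close> stands for 1. The space of configurations on a set \<open>C\<close> of nodes carries the product
  sigma-algebra. Only its measurable sets matter: the measure that comes with \<open>conf_space C\<close>
  is never used.\<close>

definition conf_space :: "'v set \<Rightarrow> ('v \<Rightarrow> bool) measure" where
  "conf_space C = PiM C (\<lambda>_. count_space UNIV)"

definition occupied :: "('v \<Rightarrow> bool) \<Rightarrow> 'v set" where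
  "occupied \<phi> = {u. \<phi> u}"

definition conf_prob :: "('v \<Rightarrow> bool) measure \<Rightarrow> bool" where
  "conf_prob \<nu> \<longleftrightarrow> prob_space \<nu> \<and> sets \<nu> = sets (conf_space UNIV)"

text \<open>The sigma-algebra generated by the values \<open>\<phi> v\<close> with \<open>v \<noteq> u\<close>.\<close>

definition sigma_off :: "'v \<Rightarrow> ('v \<Rightarrow> bool) measure" where
  "sigma_off u = vimage_algebra UNIV (\<lambda>\<phi>. restrict \<phi> (- {u})) (conf_space (- {u}))"

definition gibbs :: "('v \<Rightarrow> 'v \<Rightarrow> bool) \<Rightarrow> real \<Rightarrow> ('v \<Rightarrow> bool) measure \<Rightarrow> bool" where
  "gibbs adj lam \<nu> \<longleftrightarrow> conf_prob \<nu> \<and>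
     (\<forall>u. AE \<phi>\<^sub>0 in \<nu>.
        real_cond_exp \<nu> (sigma_off u) (indicator {\<phi>. \<phi> u}) \<phi>\<^sub>0 =
        lam / (1 + lam) * (if independent_set adj (occupied \<phi>\<^sub>0 \<union> {u}) then 1 else 0))"

definition extremal_gibbs :: "('v \<Rightarrow> 'v \<Rightarrow> bool) \<Rightarrow> real \<Rightarrow> ('v \<Rightarrow> bool) measure \<Rightarrow> bool" where
  "extremal_gibbs adj lam \<nu> \<longleftrightarrow> gibbs adj lam \<nu> \<and>
     \<not> (\<exists>\<nu>\<^sub>1 \<nu>\<^sub>2 t. gibbs adj lam \<nu>\<^sub>1 \<and> gibbs adj lam \<nu>\<^sub>2 \<and> \<nu>\<^sub>1 \<noteq> \<nu>\<^sub>2 \<and> 0 < t \<and> t < 1 \<and>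
          (\<forall>A\<in>sets (conf_space UNIV).
             measure \<nu> A = t * measure \<nu>\<^sub>1 A + (1 - t) * measure \<nu>\<^sub>2 A))"

text \<open>Since \<open>\<phi> u\<close> takes only two values, independence given \<open>\<phi> u\<close> is independence under the
  conditional law \<open>uniform_measure \<nu> {\<phi>. \<phi> u = b}\<close> given each value \<open>b\<close> of positive probability.\<close>

definition simple_measure :: "('v \<Rightarrow> 'v \<Rightarrow> bool) \<Rightarrow> ('v \<Rightarrow> bool) measure \<Rightarrow> bool" where
  "simple_measure adj \<nu> \<longleftrightarrow>
     (\<forall>u b. measure \<nu> {\<phi>. \<phi> u = b} > 0 \<longrightarrow>
        prob_space.indep_vars (uniform_measure \<nu> {\<phi>. \<phi> u = b})
          conf_space (\<lambda>C \<phi>. restrict \<phi> C) (components_without adj u))"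

definition invariant_measure :: "('v \<Rightarrow> 'v \<Rightarrow> bool) \<Rightarrow> ('v \<Rightarrow> bool) measure \<Rightarrow> bool" where
  "invariant_measure adj \<nu> \<longleftrightarrow>
     (\<forall>g. automorphism adj g \<longrightarrow> distr \<nu> (conf_space UNIV) (\<lambda>\<phi>. \<phi> \<circ> g) = \<nu>)"

definition simple_invariant_gibbs :: "('v \<Rightarrow> 'v \<Rightarrow> bool) \<Rightarrow> real \<Rightarrow> ('v \<Rightarrow> bool) measure \<Rightarrow> bool" where
  "simple_invariant_gibbs adj lam \<nu> \<longleftrightarrow>
     gibbs adj lam \<nu> \<and> simple_measure adj \<nu> \<and> invariant_measure adj \<nu>"

end

theory Submission
  imports Defs
begin

text \<open>
Write \<open>lam = w (1 + w)^k\<close> and \<open>c = 1 / (1 + w)\<close>. The proof has two halves: a family of identities that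
pins a measure down, and a contraction argument showing that every Gibbs measure dominated by a multiple
of the simple invariant one satisfies these identities.

\<^bold>\<open>The identities.\<close> Call a measure an \<open>hc_chain\<close> if all sites have the same density, neighbours are
never both occupied, and a neighbour \<open>y\<close> of a vacant site \<open>x\<close> is vacant with probability \<open>c\<close> given any
finite pattern off the branch of \<open>y\<close>. Building a finite subtree leaf by leaf shows that \<open>c\<close> and the
density determine the measure (\<open>hc_chain_unique\<close>). A simple invariant Gibbs measure is an \<open>hc_chain\<close>:
its density is constant because the automorphism group is transitive, simplicity factorises over the
branches at \<open>x\<close>, and the Gibbs property yields the equation for \<open>w\<close>, which has one positive solution.
This gives uniqueness. For existence, the broadcast process from the explicit description is built from
independent bits. Reversibility makes it independent of the root
(\<open>hc_measure_root_adj\<close>), so that simplicity and the Gibbs property may each be read off at the root.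

\<^bold>\<open>Extremality.\<close> Let \<open>M n t x\<close> (\<open>message\<close>) be the probability that \<open>x\<close> is vacant given that its
neighbour \<open>t\<close> is vacant and given the configuration at depth \<open>n\<close> of the branch of \<open>x\<close> seen from \<open>t\<close>. It
satisfies \<open>M = 1 / (1 + lam P)\<close>, where \<open>P\<close> is the product of the messages one level further, and it has this
meaning under \<^emph>\<open>every\<close> Gibbs measure (\<open>message_gibbs\<close>). It therefore suffices that \<open>M n\<close> converges to the
constant \<open>c\<close> under the simple measure: convergence in probability passes to any Gibbs measure \<open>\<nu>\<close> with
\<open>q \<nu> \<le> \<mu>\<close>, and in the limit it says exactly that \<open>\<nu>\<close> is an \<open>hc_chain\<close>. Both parts of a convex
decomposition of \<open>\<mu>\<close> are dominated in this way, hence both equal \<open>\<mu>\<close>.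

For the convergence, let \<open>a n\<close> be \<open>1 + w\<close> times the expectation of \<open>M n t x\<close> given that \<open>t\<close> and \<open>x\<close> are vacant.
Always \<open>a n \<ge> 1\<close>, and \<open>a n - 1\<close> controls the variance of the message. With \<open>r = lam P\<close>, simplicity
gives \<open>E r = w\<close> and \<open>E r^2 \<le> w^2 (a n)^k\<close>; convexity of \<open>1 / (1 + r)\<close> under the law of \<open>r\<close> weighted by \<open>r\<close>
then bounds \<open>E (1 / (1 + r))\<close> by \<open>1 - w / (1 + w (a n)^k)\<close> (\<open>simple_info_bound\<close>). So \<open>a\<close> is
dominated by the iterates of \<open>h a = (1 + w) (1 - w / (1 + w a^k))\<close> started from \<open>1 + w\<close>. For \<open>lam \<le> e - 1\<close> one
has \<open>h a < a\<close> on \<open>(1, 1 + w]\<close> (\<open>info_bound_decreases\<close>), so that these iterates decrease to \<open>1\<close>.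
\<close>

section \<open>Branches of a regular tree\<close>

definition nbrs :: "('v \<Rightarrow> 'v \<Rightarrow> bool) \<Rightarrow> 'v \<Rightarrow> 'v set" where
  "nbrs adj x = {y. adj x y}"

text \<open>The component of \<open>v\<close> in the tree without \<open>u\<close>, for \<open>v \<noteq> u\<close>.\<close>

definition branch :: "('v \<Rightarrow> 'v \<Rightarrow> bool) \<Rightarrow> 'v \<Rightarrow> 'v \<Rightarrow> 'v set" where
  "branch adj u v = {w. (\<lambda>x y. adj x y \<and> x \<noteq> u \<and> y \<noteq> u)\<^sup>*\<^sup>* v w}"

definition dist_to :: "('v \<Rightarrow> 'v \<Rightarrow> bool) \<Rightarrow> 'v \<Rightarrow> 'v \<Rightarrow> nat" where
  "dist_to adj r v = (LEAST n. (adj ^^ n) v r)"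

text \<open>The neighbour of \<open>v\<close> in the direction of the root \<open>r\<close>; no meaning is attached to the case \<open>v = r\<close>.\<close>

definition parent :: "('v \<Rightarrow> 'v \<Rightarrow> bool) \<Rightarrow> 'v \<Rightarrow> 'v \<Rightarrow> 'v" where
  "parent adj r v = (THE y. adj v y \<and> r \<in> branch adj v y)"

lemma rtranclp_distinct_path:
  assumes "R\<^sup>*\<^sup>* a b"
  shows "\<exists>xs. xs \<noteq> [] \<and> hd xs = a \<and> last xs = b \<and> distinct xs \<and> successively R xs"
  using assms
proof (induction rule: converse_rtranclp_induct)
  case base
  show ?case by (rule exI[of _ "[b]"]) auto
next
  case (step a c)
  then obtain xs where xs: "xs \<noteq> []" "hd xs = c" "last xs = b" "distinct xs" "successively R xs" by blast
  show ?case
  proof (cases "a \<in> set xs")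
    case True
    then obtain ys zs where "xs = ys @ a # zs" by (meson split_list)
    then show ?thesis using xs
      by (intro exI[of _ "a # zs"]) (auto simp: successively_append_iff)
  next
    case False
    then show ?thesis using xs step(1)
      by (intro exI[of _ "a # xs"]) (cases xs; auto)
  qed
qed

locale reg_tree =
  fixes k :: nat and adj :: "'v \<Rightarrow> 'v \<Rightarrow> bool"
  assumes regular: "regular_tree k adj"
begin

abbreviation "nb \<equiv> nbrs adj"
abbreviation "br \<equiv> branch adj"
abbreviation "par \<equiv> parent adj"
abbreviation "dst \<equiv> dist_to adj"

lemma adj_sym: "adj u v \<Longrightarrow> adj v u"
  and adj_irrefl: "\<not> adj u u"
  and card_nb: "card (nb u) = k + 1"
  and adj_connected: "adj\<^sup>*\<^sup>* u v"
  and no_cycle: "\<lbrakk>length xs \<ge> 3; distinct xs; successively adj xs; adj (last xs) (hd xs)\<rbrakk> \<Longrightarrow> False"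
  using regular unfolding regular_tree_def nbrs_def by blast+

lemma finite_nb: "finite (nb u)"
  using card_nb[of u] by (metis Suc_eq_plus1 card.infinite nat.distinct(1))

lemma in_nb [simp]: "y \<in> nb x \<longleftrightarrow> adj x y"
  by (simp add: nbrs_def)

lemma adj_neq: "adj x y \<Longrightarrow> x \<noteq> y"
  using adj_irrefl by blast

lemma br_self: "v \<in> br u v"
  by (simp add: branch_def)

lemma br_not_self: assumes "u \<noteq> v" shows "u \<notin> br u v"
proof
  assume "u \<in> br u v"
  then have "(\<lambda>x y. adj x y \<and> x \<noteq> u \<and> y \<noteq> u)\<^sup>*\<^sup>* v u" by (simp add: branch_def)
  then show False using assms by (cases rule: rtranclp.cases) auto
qed

lemma br_step: "\<lbrakk>z \<in> br u v; adj z z'; z \<noteq> u; z' \<noteq> u\<rbrakk> \<Longrightarrow> z' \<in> br u v"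
  unfolding branch_def by (auto intro: rtranclp.rtrancl_into_rtrancl)

lemma br_cover: assumes "z \<noteq> x" shows "\<exists>y. adj x y \<and> z \<in> br x y"
proof -
  have "z = x \<or> (\<exists>y. adj x y \<and> z \<in> br x y)"
    using adj_connected[of x z]
  proof (induction rule: rtranclp_induct)
    case (step z z')
    then show ?case using br_self br_step by metis
  qed simp
  then show ?thesis using assms by blast
qed

lemma br_trans: "\<lbrakk>y \<in> br u x; z \<in> br u y\<rbrakk> \<Longrightarrow> z \<in> br u x"
  unfolding branch_def by (auto intro: rtranclp_trans)

lemma br_sym: assumes "y \<in> br u x" shows "x \<in> br u y"
proof -
  let ?R = "\<lambda>x y. adj x y \<and> x \<noteq> u \<and> y \<noteq> u"
  have "?R\<^sup>*\<^sup>* x y" using assms by (simp add: branch_def)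
  then have "?R\<^sup>*\<^sup>* y x"
    by (induction rule: rtranclp_induct) (auto intro: converse_rtranclp_into_rtranclp adj_sym)
  then show ?thesis by (simp add: branch_def)
qed

lemma br_eq: "y \<in> br u x \<Longrightarrow> br u y = br u x"
  using br_sym br_trans by blast

text \<open>A path off \<open>x\<close> between two distinct neighbours of \<open>x\<close> would close up to a cycle through \<open>x\<close>. This is
the one place where acyclicity is used directly.\<close>

lemma br_inj: assumes "adj x y" "adj x y'" "z \<in> br x y" "z \<in> br x y'" shows "y = y'"
proof (rule ccontr)
  assume ne: "y \<noteq> y'"
  let ?R = "\<lambda>a b. adj a b \<and> a \<noteq> x \<and> b \<noteq> x"
  have "y' \<in> br x y" using assms br_eq br_self by metis
  then have "?R\<^sup>*\<^sup>* y y'" by (simp add: branch_def)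
  from rtranclp_distinct_path[OF this] obtain xs where
    xs: "xs \<noteq> []" "hd xs = y" "last xs = y'" "distinct xs" "successively ?R xs" by blast
  obtain b ys where xsb: "xs = y # b # ys"
    using xs ne by (cases xs; cases "tl xs"; force)
  have "successively adj xs" using xs(5) by (rule successively_mono) auto
  moreover have "x \<notin> set xs"
  proof
    assume "x \<in> set xs"
    then obtain as bs where sp: "xs = as @ x # bs" by (meson split_list)
    show False
    proof (cases bs)
      case Nil
      then show ?thesis using sp xs(3) assms adj_neq by auto
    next
      case (Cons b' bs')
      then show ?thesis using sp xs(5) by (auto simp: successively_append_iff)
    qed
  qed
  ultimately have "distinct (x # xs)" "successively adj (x # xs)"
    using xs assms(1) by (auto simp: xsb)
  then show False using no_cycle[of "x # xs"] xs assms(2) adj_sym xsb by auto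
qed

lemma br_disjoint: "\<lbrakk>adj x y; adj x y'; y \<noteq> y'\<rbrakk> \<Longrightarrow> br x y \<inter> br x y' = {}"
  using br_inj by blast

lemma br_mono: assumes "adj t x" "adj x y" "y \<noteq> t" shows "br x y \<subseteq> br t x"
proof
  fix z assume "z \<in> br x y"
  then have "(\<lambda>a b. adj a b \<and> a \<noteq> x \<and> b \<noteq> x)\<^sup>*\<^sup>* y z" by (simp add: branch_def)
  then show "z \<in> br t x"
  proof (induction rule: rtranclp_induct)
    case base
    show ?case using br_step[OF br_self, of x y t] assms adj_neq by metis
  next
    case (step a b)
    have "b \<in> br x y" using step(1,2) by (auto simp: branch_def intro: rtranclp.rtrancl_into_rtrancl)
    then have "b \<noteq> t" using br_inj[of x y t b] br_self[of t x] assms adj_sym by blast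
    moreover have "a \<in> br x y" using step(1) by (auto simp: branch_def)
    then have "a \<noteq> t" using br_inj[of x y t a] br_self[of t x] assms adj_sym by blast
    ultimately show ?case using br_step[OF step(3)] step(2) by blast
  qed
qed

lemma br_either: assumes "adj u v" shows "z \<in> br u v \<or> z \<in> br v u"
proof (cases "z = u")
  case True
  then show ?thesis using br_self by blast
next
  case False
  then obtain y where y: "adj u y" "z \<in> br u y" using br_cover by blast
  then show ?thesis using br_mono[of v u y] assms adj_sym by (cases "y = v") auto
qed

lemma components_without_eq: "components_without adj u = br u ` nb u"
proof -
  have "components_without adj u = br u ` (- {u})"
    by (simp add: components_without_def branch_def)
  also have "\<dots> = br u ` nb u"
  proof
    show "br u ` (- {u}) \<subseteq> br u ` nb u" using br_cover br_eq by force
    show "br u ` nb u \<subseteq> br u ` (- {u})"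
    proof (rule image_mono)
      show "nb u \<subseteq> - {u}" by (auto dest: adj_neq)
    qed
  qed
  finally show ?thesis .
qed

lemma inj_on_br: "inj_on (br u) (nb u)"
  by (rule inj_onI) (metis br_inj br_self in_nb)

lemma countable_nodes: "countable (UNIV :: 'v set)"
proof -
  fix r :: 'v
  have "finite {z. (adj ^^ n) r z}" for n
  proof (induction n)
    case (Suc n)
    have "{z. (adj ^^ Suc n) r z} = (\<Union>y\<in>{z. (adj ^^ n) r z}. nb y)" by auto
    then show ?case using Suc finite_nb by auto
  qed simp
  then have "countable (\<Union>n. {z. (adj ^^ n) r z})" using countable_finite by blast
  moreover have "(\<Union>n. {z. (adj ^^ n) r z}) = UNIV" using adj_connected[of r] by (auto simp: rtranclp_power)
  ultimately show ?thesis by simp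
qed

section \<open>Rooted trees\<close>

lemma parentI: "\<lbrakk>adj v y; r \<in> br v y\<rbrakk> \<Longrightarrow> par r v = y"
  unfolding parent_def by (rule the_equality) (auto dest: br_inj)

lemma parent_props: assumes "v \<noteq> r" shows "adj v (par r v)" "r \<in> br v (par r v)"
  using br_cover[of r v] assms parentI by metis+

lemma dst_path: "(adj ^^ dst r v) v r"
proof -
  obtain n where "(adj ^^ n) v r" using adj_connected[of v r] by (auto simp: rtranclp_power)
  then show ?thesis unfolding dist_to_def by (rule LeastI)
qed

lemma dst_le: "(adj ^^ n) v r \<Longrightarrow> dst r v \<le> n"
  unfolding dist_to_def by (rule Least_le)

lemma dst_root [simp]: "dst r r = 0"
  using dst_le[of 0 r r] by simp

text \<open>A path from \<open>y\<close> to the root that is shorter than the distance of \<open>v\<close> cannot visit \<open>v\<close>. Applied to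
the second site of a shortest path from \<open>v\<close>, this identifies that site as the parent.\<close>

lemma short_path_avoids: "\<lbrakk>(adj ^^ n) y r; n < dst r v\<rbrakk> \<Longrightarrow> r \<in> br v y"
proof (induction n arbitrary: y)
  case 0
  then show ?case using br_self by simp
next
  case (Suc n)
  obtain z where z: "adj y z" "(adj ^^ n) z r" using Suc.prems(1) by (meson relpowp_Suc_D2)
  have "r \<in> br v z" using Suc z by simp
  moreover have "y \<noteq> v" using dst_le[OF Suc.prems(1)] Suc.prems(2) by auto
  moreover have "z \<noteq> v" using dst_le[OF z(2)] Suc.prems(2) by auto
  ultimately have "z \<in> br v y" using br_step[OF br_self] z(1) by metis
  then show ?case using \<open>r \<in> br v z\<close> br_trans by blast
qed

lemma dst_parent: assumes "v \<noteq> r" shows "dst r v = Suc (dst r (par r v))"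
proof -
  have "dst r v \<noteq> 0" using dst_path[of r v] assms by (metis relpowp_0_E)
  then obtain n where n: "dst r v = Suc n" by (cases "dst r v") auto
  then obtain y where y: "adj v y" "(adj ^^ n) y r" using dst_path[of r v] by (metis relpowp_Suc_D2)
  have "par r v = y" using parentI[OF y(1)] short_path_avoids[OF y(2)] n by simp
  moreover have "dst r y \<le> n" using dst_le y by blast
  moreover have "dst r v \<le> Suc (dst r y)"
    using dst_le[of "Suc (dst r y)" v r] dst_path[of r y] y(1) by (meson relpowp_Suc_I2)
  ultimately show ?thesis using n by simp
qed

lemma adj_iff_parent: "adj u v \<longleftrightarrow> (v \<noteq> r \<and> par r v = u) \<or> (u \<noteq> r \<and> par r u = v)"
proof
  assume a: "adj u v"
  then show "(v \<noteq> r \<and> par r v = u) \<or> (u \<noteq> r \<and> par r u = v)"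
    using br_either[OF a, of r] parentI adj_sym br_not_self adj_neq by metis
next
  assume "(v \<noteq> r \<and> par r v = u) \<or> (u \<noteq> r \<and> par r u = v)"
  then show "adj u v" using parent_props adj_sym by blast
qed

lemma parent_asym: "\<lbrakk>v \<noteq> r; par r v = u; u \<noteq> r\<rbrakk> \<Longrightarrow> par r u \<noteq> v"
  using dst_parent[of v r] dst_parent[of u r] by auto

lemma finite_ball: "finite {v. dst r v \<le> n}"
proof (induction n)
  case 0
  have "{v. dst r v \<le> 0} \<subseteq> {r}" using dst_parent by force
  then show ?case using finite_subset by blast
next
  case (Suc n)
  have "{v. dst r v \<le> Suc n} \<subseteq> insert r (\<Union>y\<in>{v. dst r v \<le> n}. nb y)"
  proof
    fix v assume v: "v \<in> {v. dst r v \<le> Suc n}"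
    show "v \<in> insert r (\<Union>y\<in>{v. dst r v \<le> n}. nb y)"
    proof (cases "v = r")
      case False
      then show ?thesis using v dst_parent[OF False] parent_props(1)[OF False] adj_sym by auto
    qed simp
  qed
  then show ?case using Suc finite_nb finite_subset by (metis finite_UN finite_insert)
qed

text \<open>The finite subtrees through \<open>r\<close>: on such a set the state of every site is determined by data within the set.\<close>

definition rooted :: "'v \<Rightarrow> 'v set \<Rightarrow> bool" where
  "rooted r T \<longleftrightarrow> finite T \<and> r \<in> T \<and> (\<forall>v\<in>T. v \<noteq> r \<longrightarrow> par r v \<in> T)"

lemma rooted_ball: "rooted r {v. dst r v \<le> n}"
  using finite_ball dst_parent by (auto simp: rooted_def)

lemma rooted_superset: assumes "finite J" shows "\<exists>T. rooted r T \<and> J \<subseteq> T"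
proof -
  have "\<forall>v\<in>J. dst r v \<le> Max (dst r ` J)" using assms by simp
  then obtain n where "\<forall>v\<in>J. dst r v \<le> n" by blast
  then show ?thesis using rooted_ball[of r n] by (intro exI[of _ "{v. dst r v \<le> n}"]) auto
qed

text \<open>A deepest site of a finite subtree is thus alone in its own branch; it is a leaf that can be split off.\<close>

lemma dst_less_in_branch:
  assumes "x \<noteq> r" "z \<in> br (par r x) x" "z \<noteq> x"
  shows "dst r x < dst r z"
  using assms(2,3)
proof (induction "dst r z" arbitrary: z rule: less_induct)
  case less
  let ?t = "par r x"
  have tx: "adj ?t x" using parent_props[OF assms(1)] adj_sym by blast
  have rx: "r \<notin> br ?t x"
  proof
    assume "r \<in> br ?t x"
    then have "par r ?t = x" "?t \<noteq> r" using parentI[OF tx] br_not_self adj_neq[OF tx] by metis+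
    then show False using parent_asym[OF assms(1)] by blast
  qed
  then have zr: "z \<noteq> r" using less.prems by blast
  have "z \<noteq> ?t" using less.prems br_not_self adj_neq[OF tx] by metis
  have "par r z \<noteq> ?t"
    using less.prems tx br_inj[of ?t z x z] parent_props(1)[OF zr] adj_sym br_self by metis
  then have "par r z \<in> br ?t x"
    using br_step[OF less.prems(1)] parent_props(1)[OF zr] \<open>z \<noteq> ?t\<close> by blast
  then show ?case using less.hyps[of "par r z"] dst_parent[OF zr] by (cases "par r z = x") auto
qed

lemma rooted_remove_deepest:
  assumes T: "rooted r T" "T \<noteq> {r}"
  obtains x where "x \<in> T" "x \<noteq> r" "rooted r (T - {x})" "(T - {x}) \<inter> br (par r x) x = {}"
proof -
  have fin: "finite T" "r \<in> T" using T by (auto simp: rooted_def)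
  define m where "m = Max (dst r ` T)"
  have "m \<in> dst r ` T" using fin unfolding m_def by (intro Max_in) auto
  then obtain x where x: "x \<in> T" "dst r x = m" by auto
  have le: "dst r z \<le> dst r x" if "z \<in> T" for z using that fin x by (simp add: m_def)
  have xr: "x \<noteq> r"
  proof
    assume "x = r"
    then have "\<forall>z\<in>T. z = r" using le dst_parent by force
    then show False using T fin by blast
  qed
  have "rooted r (T - {x})" using T(1) xr le dst_parent unfolding rooted_def
    by (metis Diff_iff finite_Diff insert_iff Suc_n_not_le_n empty_iff)
  moreover have "(T - {x}) \<inter> br (par r x) x = {}" using dst_less_in_branch[OF xr] le by force
  ultimately show ?thesis using that x xr by blast
qed

section \<open>An automorphism that moves the root\<close>

definition children :: "'v \<Rightarrow> 'v \<Rightarrow> 'v set" where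
  "children r x = {y. y \<noteq> r \<and> par r y = x}"

lemma children_eq: "children r x = (if x = r then nb x else nb x - {par r x})"
proof -
  have "y \<noteq> r \<and> par r y = x \<longleftrightarrow> adj x y \<and> (x \<noteq> r \<longrightarrow> y \<noteq> par r x)" for y
    using adj_iff_parent[of x y r] parent_asym[of y r x] by metis
  then have "children r x = {y. adj x y \<and> (x \<noteq> r \<longrightarrow> y \<noteq> par r x)}" by (simp only: children_def)
  then show ?thesis by (simp add: nbrs_def set_eq_iff)
qed

lemma finite_children: "finite (children r x)"
  using finite_nb by (simp add: children_eq)

lemma card_children: "card (children r x) = (if x = r then k + 1 else k)"
  using card_nb[of x] finite_nb[of x] parent_props(1)[of x r] by (auto simp: children_eq)

text \<open>Rooted at \<open>r\<close> and at \<open>r'\<close> the tree has equal numbers of children at each level, so the roots can be matched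
and then, level by level, the children of matched sites.\<close>

definition child_bij :: "'v \<Rightarrow> 'v \<Rightarrow> 'v \<Rightarrow> 'v \<Rightarrow> 'v \<Rightarrow> 'v" where
  "child_bij r r' x y = (SOME f. bij_betw f (children r x) (children r' y))"

lemma child_bij: "x = r \<longleftrightarrow> y = r' \<Longrightarrow> bij_betw (child_bij r r' x y) (children r x) (children r' y)"
  unfolding child_bij_def
  using finite_same_card_bij[OF finite_children finite_children, of r x r' y] card_children
  by (intro someI_ex[of "\<lambda>f. bij_betw f (children r x) (children r' y)"]) auto

text \<open>The number is meant to be the distance from \<open>v\<close> to \<open>r\<close>, the length of the recursion.\<close>

primrec root_shift_aux :: "'v \<Rightarrow> 'v \<Rightarrow> nat \<Rightarrow> 'v \<Rightarrow> 'v" where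
  "root_shift_aux r r' 0 v = r'"
| "root_shift_aux r r' (Suc n) v =
     child_bij r r' (par r v) (root_shift_aux r r' n (par r v)) v"

definition root_shift :: "'v \<Rightarrow> 'v \<Rightarrow> 'v \<Rightarrow> 'v" where
  "root_shift r r' v = root_shift_aux r r' (dst r v) v"

lemma root_shift_root: "root_shift r r' r = r'"
  by (simp add: root_shift_def)

lemma root_shift_parent:
  "v \<noteq> r \<Longrightarrow> root_shift r r' v = child_bij r r' (par r v) (root_shift r r' (par r v)) v"
  by (simp add: root_shift_def dst_parent)

lemma root_shift_eq_root: "root_shift r r' v = r' \<longleftrightarrow> v = r"
  and root_shift_child: "v \<noteq> r \<Longrightarrow> root_shift r r' v \<in> children r' (root_shift r r' (par r v))"
proof -
  have *: "(root_shift r r' v = r' \<longleftrightarrow> v = r) \<and>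
     (v \<noteq> r \<longrightarrow> root_shift r r' v \<in> children r' (root_shift r r' (par r v)))" for v
  proof (induction "dst r v" arbitrary: v rule: less_induct)
    case less
    show ?case
    proof (cases "v = r")
      case True
      then show ?thesis by (simp add: root_shift_root)
    next
      case False
      have "par r v = r \<longleftrightarrow> root_shift r r' (par r v) = r'"
        using less[of "par r v"] dst_parent[OF False] by auto
      then have "root_shift r r' v \<in> children r' (root_shift r r' (par r v))"
        using child_bij[of "par r v" r "root_shift r r' (par r v)" r'] False
        by (auto simp: root_shift_parent[OF False] children_def bij_betw_def)
      then show ?thesis using False by (auto simp: children_def)
    qed
  qed
  show "root_shift r r' v = r' \<longleftrightarrow> v = r"
    and "v \<noteq> r \<Longrightarrow> root_shift r r' v \<in> children r' (root_shift r r' (par r v))" using *[of v] by blast+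
qed

lemma root_shift_child_bij:
  "bij_betw (child_bij r r' x (root_shift r r' x)) (children r x) (children r' (root_shift r r' x))"
  using child_bij root_shift_eq_root by metis

lemma root_shift_inj: "root_shift r r' u = root_shift r r' v \<Longrightarrow> u = v"
proof (induction "dst r u" arbitrary: u v rule: less_induct)
  case less
  show ?case
  proof (cases "u = r")
    case True
    then show ?thesis using less.prems root_shift_eq_root root_shift_root by metis
  next
    case False
    then have vr: "v \<noteq> r" using less.prems root_shift_eq_root by metis
    have "root_shift r r' (par r u) = root_shift r r' (par r v)"
      using root_shift_child[OF False, of r'] root_shift_child[OF vr, of r'] less.prems by (auto simp: children_def)
    then have p: "par r u = par r v" using less.hyps dst_parent[OF False] by auto
    have "u \<in> children r (par r v)" "v \<in> children r (par r v)" using False vr p by (auto simp: children_def)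
    then show ?thesis
      using less.prems root_shift_parent[OF False, of r'] root_shift_parent[OF vr, of r'] p
        root_shift_child_bij[of r r' "par r v"] unfolding bij_betw_def inj_on_def by metis
  qed
qed

lemma root_shift_surj: "\<exists>v. root_shift r r' v = z"
proof (induction "dst r' z" arbitrary: z rule: less_induct)
  case less
  show ?case
  proof (cases "z = r'")
    case True
    then show ?thesis using root_shift_root by blast
  next
    case False
    have "dst r' (par r' z) < dst r' z" using dst_parent[OF False] by simp
    then obtain x where x: "root_shift r r' x = par r' z" using less by blast
    then have "z \<in> children r' (root_shift r r' x)" using False by (simp add: children_def)
    then have "z \<in> child_bij r r' x (root_shift r r' x) ` children r x"
      using root_shift_child_bij[of r r' x] by (simp add: bij_betw_def)
    then obtain v where v: "v \<in> children r x" "child_bij r r' x (root_shift r r' x) v = z" by auto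
    have "v \<noteq> r" "par r v = x" using v(1) by (simp_all add: children_def)
    then have "root_shift r r' v = z" using root_shift_parent[of v r r'] v(2) by simp
    then show ?thesis ..
  qed
qed

lemma root_shift_automorphism: "automorphism adj (root_shift r r')"
proof -
  let ?g = "root_shift r r'"
  have "inj ?g" using root_shift_inj by (auto simp: inj_def)
  moreover have "surj ?g" using root_shift_surj[of r r'] by (metis surj_def)
  ultimately have bij: "bij ?g" by (simp add: bij_def)
  have par_iff: "?g v \<noteq> r' \<and> par r' (?g v) = ?g u \<longleftrightarrow> v \<noteq> r \<and> par r v = u" for u v
  proof (cases "v = r")
    case True
    then show ?thesis by (simp add: root_shift_root)
  next
    case False
    have "par r' (?g v) = ?g (par r v)" "?g v \<noteq> r'"
      using root_shift_child[OF False, of r'] by (simp_all add: children_def)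
    then show ?thesis using False root_shift_inj[of r r' "par r v" u] by metis
  qed
  have "adj (?g u) (?g v) \<longleftrightarrow> adj u v" for u v
    using par_iff[of v u] par_iff[of u v] adj_iff_parent[of "?g u" "?g v" r'] adj_iff_parent[of u v r] by blast
  then show ?thesis unfolding automorphism_def using bij by blast
qed

lemma automorphism_parent:
  assumes g: "automorphism adj g" and "v \<noteq> r"
  shows "par (g r) (g v) = g (par r v)"
proof (rule parentI)
  show "adj (g v) (g (par r v))" using g parent_props[OF assms(2)] by (auto simp: automorphism_def)
  have inj: "inj g" using g by (auto simp: automorphism_def bij_def)
  have "(\<lambda>x y. adj x y \<and> x \<noteq> g v \<and> y \<noteq> g v)\<^sup>*\<^sup>* (g t) (g s)"
    if "(\<lambda>x y. adj x y \<and> x \<noteq> v \<and> y \<noteq> v)\<^sup>*\<^sup>* t s" for t s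
    using that
  proof (induction rule: rtranclp_induct)
    case (step y z)
    then have "adj (g y) (g z) \<and> g y \<noteq> g v \<and> g z \<noteq> g v"
      using g inj by (simp add: automorphism_def inj_eq)
    then show ?case using rtranclp.rtrancl_into_rtrancl[OF step.IH] by simp
  qed simp
  then show "g r \<in> br (g v) (g (par r v))" using parent_props[OF assms(2)] by (simp add: branch_def)
qed

end

section \<open>Laws of configurations and the single-site Gibbs property\<close>

definition atom :: "'v set \<Rightarrow> ('v \<Rightarrow> bool) \<Rightarrow> ('v \<Rightarrow> bool) set" where
  "atom T \<sigma> = {\<phi>. \<forall>v\<in>T. \<phi> v = \<sigma> v}"

definition depends_on :: "'v set \<Rightarrow> (('v \<Rightarrow> bool) \<Rightarrow> 'b) \<Rightarrow> bool" where
  "depends_on C f \<longleftrightarrow> (\<forall>\<phi> \<psi>. (\<forall>v\<in>C. \<phi> v = \<psi> v) \<longrightarrow> f \<phi> = f \<psi>)"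

lemma depends_onD: "depends_on C f \<Longrightarrow> (\<And>v. v \<in> C \<Longrightarrow> \<phi> v = \<psi> v) \<Longrightarrow> f \<phi> = f \<psi>"
  by (auto simp: depends_on_def)

lemma depends_on_mono: "depends_on C f \<Longrightarrow> C \<subseteq> D \<Longrightarrow> depends_on D f"
  unfolding depends_on_def by blast

lemma depends_mult: "depends_on C f \<Longrightarrow> depends_on C g \<Longrightarrow> depends_on C (\<lambda>\<phi>. f \<phi> * g \<phi> :: real)"
  unfolding depends_on_def by metis

lemma depends_prod: "(\<And>y. y \<in> Y \<Longrightarrow> depends_on C (f y)) \<Longrightarrow> depends_on C (\<lambda>\<phi>. \<Prod>y\<in>Y. f y \<phi> :: real)"
  unfolding depends_on_def by (blast intro: prod.cong)

lemma space_conf_space: "space (conf_space C) = PiE C (\<lambda>_. UNIV)"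
  by (simp add: conf_space_def space_PiM)

lemma space_conf_UNIV [simp]: "space (conf_space UNIV) = UNIV"
  by (simp add: space_conf_space PiE_UNIV_domain)

lemma measurable_conf_coord: "v \<in> C \<Longrightarrow> (\<lambda>\<phi>. \<phi> v) \<in> measurable (conf_space C) (count_space UNIV)"
  unfolding conf_space_def by (rule measurable_component_singleton)

lemma measurable_conf_coord_UNIV [measurable]: "(\<lambda>\<phi>. \<phi> v) \<in> measurable (conf_space UNIV) (count_space UNIV)"
  by (rule measurable_conf_coord) simp

lemma measurable_conf_spaceI:
  "(\<And>v. v \<in> C \<Longrightarrow> (\<lambda>x. f x v) \<in> measurable M (count_space UNIV)) \<Longrightarrow>
   (\<And>x. x \<in> space M \<Longrightarrow> f x \<in> extensional C) \<Longrightarrow> f \<in> measurable M (conf_space C)"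
  unfolding conf_space_def by (rule measurable_PiM_single') (auto simp: PiE_def)

lemma measurable_restrict_conf: "(\<lambda>\<phi>. restrict \<phi> C) \<in> measurable (conf_space UNIV) (conf_space C)"
  by (rule measurable_conf_spaceI) auto

lemma measurable_extend_conf:
  "(\<lambda>\<beta> v. if v \<in> C then \<beta> v else d v) \<in> measurable (conf_space C) (conf_space UNIV)"
proof (rule measurable_conf_spaceI)
  fix v :: 'a
  show "(\<lambda>\<beta>. if v \<in> C then \<beta> v else d v) \<in> measurable (conf_space C) (count_space UNIV)"
    by (cases "v \<in> C") (auto intro: measurable_conf_coord)
qed auto

text \<open>A function of the coordinates in \<open>C\<close> factors through the restriction to \<open>C\<close>; the values \<open>d\<close> are arbitrary fillers.\<close>

lemma depends_on_factor:
  assumes "depends_on C f"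
  shows "f \<phi> = f (\<lambda>v. if v \<in> C then restrict \<phi> C v else d v)"
  by (rule depends_onD[OF assms]) auto

lemma measurable_of_bool [measurable]:
  assumes [measurable]: "Measurable.pred M P" shows "(\<lambda>x. of_bool (P x) :: real) \<in> borel_measurable M"
  unfolding of_bool_def by measurable

lemma integral_of_bool:
  assumes "Measurable.pred M P"
  shows "(\<integral>x. of_bool (P x) \<partial>M) = measure M {x\<in>space M. P x}"
proof -
  have "(\<integral>x. of_bool (P x) \<partial>M) = (\<integral>x. indicator {x\<in>space M. P x} x \<partial>M :: real)"
    by (rule Bochner_Integration.integral_cong) (auto simp: indicator_def)
  moreover have "{x\<in>space M. P x} \<inter> space M = {x\<in>space M. P x}" by auto
  ultimately show ?thesis by simp
qed

lemma conf_prob_space: "conf_prob \<nu> \<Longrightarrow> space \<nu> = UNIV"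
  using sets_eq_imp_space_eq[of \<nu> "conf_space UNIV"] by (simp add: conf_prob_def)

lemma conf_prob_sets: "conf_prob \<nu> \<Longrightarrow> sets \<nu> = sets (conf_space UNIV)"
  by (simp add: conf_prob_def)

lemma conf_prob_measurable: "conf_prob \<nu> \<Longrightarrow> measurable \<nu> N = measurable (conf_space UNIV) N"
  by (rule measurable_cong_sets) (auto simp: conf_prob_def)

lemma conf_prob_prob_space: "conf_prob \<nu> \<Longrightarrow> prob_space \<nu>"
  by (simp add: conf_prob_def)

lemma pred_atom: "finite T \<Longrightarrow> Measurable.pred (conf_space UNIV) (\<lambda>\<phi>. \<phi> \<in> atom T \<sigma>)"
  unfolding atom_def mem_Collect_eq by measurable

lemma sets_atom: assumes "finite T" shows "atom T \<sigma> \<in> sets (conf_space UNIV)"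
  using pred_atom[OF assms, of \<sigma>] by (simp add: pred_def)

lemma bounded_integrable:
  fixes f :: "('v \<Rightarrow> bool) \<Rightarrow> real"
  assumes "conf_prob \<nu>" "f \<in> borel_measurable (conf_space UNIV)" "\<And>\<phi>. \<bar>f \<phi>\<bar> \<le> B"
  shows "integrable \<nu> f"
proof -
  interpret prob_space \<nu> using assms(1) by (rule conf_prob_prob_space)
  show ?thesis
    by (rule integrable_const_bound[of _ B]) (use assms in \<open>auto simp: conf_prob_measurable\<close>)
qed

text \<open>Every cylinder event is a finite disjoint union of atoms over a larger finite set, and cylinders generate.\<close>

lemma conf_prob_eqI:
  fixes \<nu> \<nu>' :: "('v \<Rightarrow> bool) measure"
  assumes \<nu>: "conf_prob \<nu>" "conf_prob \<nu>'"
    and T: "\<And>J. finite J \<Longrightarrow> \<exists>T. finite T \<and> J \<subseteq> T \<and> (\<forall>\<sigma>. measure \<nu> (atom T \<sigma>) = measure \<nu>' (atom T \<sigma>))"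
  shows "\<nu> = \<nu>'"
proof (rule measure_eqI_PiM_infinite)
  interpret N: prob_space \<nu> using \<nu>(1) by (rule conf_prob_prob_space)
  interpret N': prob_space \<nu>' using \<nu>(2) by (rule conf_prob_prob_space)
  show "sets \<nu> = PiM UNIV (\<lambda>_. count_space UNIV)" "sets \<nu>' = PiM UNIV (\<lambda>_. count_space UNIV)"
    using \<nu> by (simp_all add: conf_prob_def conf_space_def)
  show "finite_measure \<nu>" by unfold_locales
  fix A :: "'v \<Rightarrow> bool set" and J :: "'v set"
  assume J: "finite J"
  let ?E = "prod_emb UNIV (\<lambda>_. count_space UNIV) J (Pi\<^sub>E J A)"
  obtain T where T: "finite T" "J \<subseteq> T" "\<And>\<sigma>. measure \<nu> (atom T \<sigma>) = measure \<nu>' (atom T \<sigma>)"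
    using T[OF J] by blast
  define S where "S = {\<sigma> \<in> PiE T (\<lambda>_. UNIV). \<forall>v\<in>J. \<sigma> v \<in> A v}"
  have "finite S" unfolding S_def using finite_PiE[OF T(1), of "\<lambda>_. UNIV :: bool set"] by simp
  have E: "?E = (\<Union>\<sigma>\<in>S. atom T \<sigma>)"
  proof (intro set_eqI iffI)
    fix \<phi> assume "\<phi> \<in> ?E"
    then have "restrict \<phi> T \<in> S" "\<phi> \<in> atom T (restrict \<phi> T)"
      using T(2) by (auto simp: S_def prod_emb_def atom_def)
    then show "\<phi> \<in> (\<Union>\<sigma>\<in>S. atom T \<sigma>)" by blast
  next
    fix \<phi> assume "\<phi> \<in> (\<Union>\<sigma>\<in>S. atom T \<sigma>)"
    then show "\<phi> \<in> ?E" using T(2) by (auto simp: S_def prod_emb_def atom_def subset_iff)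
  qed
  have disj: "disjoint_family_on (atom T) S"
  proof -
    have "\<sigma> = \<sigma>'" if "\<sigma> \<in> S" "\<sigma>' \<in> S" "\<phi> \<in> atom T \<sigma>" "\<phi> \<in> atom T \<sigma>'" for \<sigma> \<sigma>' \<phi>
      by (rule PiE_ext[of _ T "\<lambda>_. UNIV"]) (use that in \<open>auto simp: S_def atom_def\<close>)
    then show ?thesis by (auto simp: disjoint_family_on_def)
  qed
  have sub: "atom T ` S \<subseteq> sets \<nu>" "atom T ` S \<subseteq> sets \<nu>'"
    using \<nu> sets_atom[OF T(1)] by (auto simp: conf_prob_sets)
  have "measure \<nu> ?E = (\<Sum>\<sigma>\<in>S. measure \<nu> (atom T \<sigma>))"
    unfolding E using N.finite_measure_finite_Union[OF \<open>finite S\<close> sub(1) disj] .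
  also have "\<dots> = measure \<nu>' ?E"
    unfolding E using N'.finite_measure_finite_Union[OF \<open>finite S\<close> sub(2) disj] T(3) by simp
  finally show "emeasure \<nu> ?E = emeasure \<nu>' ?E"
    by (simp add: N.emeasure_eq_measure N'.emeasure_eq_measure)
qed

lemma sigma_off_factor:
  assumes "f \<in> measurable (conf_space UNIV) N" "depends_on (- {u}) f"
  shows "f \<in> measurable (sigma_off u) N"
proof -
  let ?e = "\<lambda>\<beta> v. if v \<in> - {u} then \<beta> v else False"
  have "(\<lambda>\<phi>. restrict \<phi> (- {u})) \<in> measurable (sigma_off u) (conf_space (- {u}))"
    unfolding sigma_off_def by (rule measurable_vimage_algebra1) (auto simp: space_conf_space)
  from measurable_compose[OF measurable_compose[OF this measurable_extend_conf[of "- {u}" "\<lambda>_. False"]] assms(1)]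
  show ?thesis using depends_on_factor[OF assms(2), of _ "\<lambda>_. False"] by (simp add: cong: measurable_cong_simp)
qed

lemma space_sigma_off [simp]: "space (sigma_off u) = UNIV"
  by (simp add: sigma_off_def)

lemma subalgebra_sigma_off: assumes "conf_prob \<nu>" shows "subalgebra \<nu> (sigma_off u)"
proof -
  have "sets (sigma_off u) \<subseteq> sets (conf_space UNIV)"
    unfolding sigma_off_def by (rule sets_image_in_sets) (auto simp: measurable_restrict_conf)
  then show ?thesis using assms by (simp add: subalgebra_def conf_prob_space conf_prob_sets)
qed

lemma sigma_off_depends:
  assumes "A \<in> sets (sigma_off u)" shows "depends_on (- {u}) (\<lambda>\<phi>. \<phi> \<in> A)"
proof -
  obtain A' where A: "A = (\<lambda>\<phi>. restrict \<phi> (- {u})) -` A'"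
    using assms unfolding sigma_off_def
    by (subst (asm) sets_vimage_algebra2) (auto simp: space_conf_space)
  have "restrict \<phi> (- {u}) = restrict \<psi> (- {u})" if "\<forall>v\<in>- {u}. \<phi> v = \<psi> v" for \<phi> \<psi> :: "'a \<Rightarrow> bool"
    using that by (auto simp: restrict_def)
  then show ?thesis unfolding A depends_on_def vimage_eq by metis
qed

lemma finite_measure_subalgebra_sigma_off:
  assumes "conf_prob \<nu>" shows "finite_measure_subalgebra \<nu> (sigma_off u)"
proof -
  interpret prob_space \<nu> using assms by (rule conf_prob_prob_space)
  show ?thesis by unfold_locales (rule subalgebra_sigma_off[OF assms])
qed

lemma pred_countable_ball:
  assumes "countable X" "\<And>i. i \<in> X \<Longrightarrow> Measurable.pred M (P i)"
  shows "Measurable.pred M (\<lambda>x. \<forall>i\<in>X. P i x)"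
proof (cases "X = {}")
  case False
  then have "{x\<in>space M. \<forall>i\<in>X. P i x} = (\<Inter>i\<in>X. {x\<in>space M. P i x})" by auto
  also have "\<dots> \<in> sets M"
    using assms False by (intro sets.countable_INT') (auto simp: pred_def)
  finally show ?thesis by (simp add: pred_def)
qed simp

definition free_site :: "('v \<Rightarrow> 'v \<Rightarrow> bool) \<Rightarrow> 'v \<Rightarrow> ('v \<Rightarrow> bool) \<Rightarrow> bool" where
  "free_site adj u \<phi> \<longleftrightarrow> independent_set adj (occupied \<phi> \<union> {u})"

context reg_tree begin

lemma pred_free_site: "Measurable.pred (conf_space UNIV) (free_site adj u)"
proof -
  have "free_site adj u =
    (\<lambda>\<phi>. \<forall>x\<in>UNIV. \<forall>y\<in>UNIV. adj x y \<longrightarrow> \<not> ((\<phi> x \<or> x = u) \<and> (\<phi> y \<or> y = u)))"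
    by (auto simp: free_site_def independent_set_def occupied_def fun_eq_iff)
  also have "Measurable.pred (conf_space UNIV) \<dots>"
    by (intro pred_countable_ball countable_nodes) measurable
  finally show ?thesis .
qed

lemma depends_free_site: "depends_on (- {u}) (free_site adj u)"
proof -
  have "occupied \<phi> \<union> {u} = occupied \<psi> \<union> {u}" if "\<forall>v\<in>- {u}. \<phi> v = \<psi> v" for \<phi> \<psi> :: "'v \<Rightarrow> bool"
    using that by (auto simp: occupied_def)
  then show ?thesis unfolding depends_on_def free_site_def by metis
qed

lemma pred_vacant_nbrs: "Measurable.pred (conf_space UNIV) (\<lambda>\<phi>. \<forall>v\<in>nb u. \<not> \<phi> v)"
  by (intro pred_intros_finite finite_nb) measurable

text \<open>The defining property of the conditional expectation, tested against a function \<open>f\<close> of the other sites.\<close>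

lemma gibbs_cond:
  assumes g: "gibbs adj lam \<nu>"
    and f: "f \<in> borel_measurable (conf_space UNIV)" "\<And>\<phi>. \<bar>f \<phi>\<bar> \<le> B" "depends_on (- {u}) f"
  shows "(\<integral>\<phi>. f \<phi> * of_bool (\<phi> u) \<partial>\<nu>) =
    lam / (1 + lam) * (\<integral>\<phi>. f \<phi> * of_bool (free_site adj u \<phi>) \<partial>\<nu>)"
proof -
  have cp: "conf_prob \<nu>" using g by (simp add: gibbs_def)
  interpret finite_measure_subalgebra \<nu> "sigma_off u"
    using cp by (rule finite_measure_subalgebra_sigma_off)
  let ?I = "indicator {\<phi>. \<phi> u} :: ('v \<Rightarrow> bool) \<Rightarrow> real"
  have I: "?I = (\<lambda>\<phi>. of_bool (\<phi> u))" by (simp add: indicator_def fun_eq_iff)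
  have mI: "?I \<in> borel_measurable (conf_space UNIV)" unfolding I by measurable
  have int: "integrable \<nu> (\<lambda>\<phi>. f \<phi> * ?I \<phi>)"
    by (rule bounded_integrable[OF cp, of _ B])
       (use f mI in \<open>auto simp: indicator_def intro: order_trans[OF abs_ge_zero f(2)] intro!: borel_measurable_times\<close>)
  have "(\<integral>\<phi>. f \<phi> * of_bool (\<phi> u) \<partial>\<nu>) = (\<integral>\<phi>. f \<phi> * real_cond_exp \<nu> (sigma_off u) ?I \<phi> \<partial>\<nu>)"
    using real_cond_exp_intg(2)[OF int sigma_off_factor[OF f(1,3)]] mI cp
    by (simp add: conf_prob_measurable) (simp add: I)
  also have "\<dots> = (\<integral>\<phi>. lam / (1 + lam) * (f \<phi> * of_bool (free_site adj u \<phi>)) \<partial>\<nu>)"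
  proof (rule integral_cong_AE)
    show "(\<lambda>\<phi>. f \<phi> * real_cond_exp \<nu> (sigma_off u) ?I \<phi>) \<in> borel_measurable \<nu>"
      using f(1) by (intro borel_measurable_times borel_measurable_cond_exp2) (simp add: conf_prob_measurable[OF cp])
    show "(\<lambda>\<phi>. lam / (1 + lam) * (f \<phi> * of_bool (free_site adj u \<phi>))) \<in> borel_measurable \<nu>"
      unfolding conf_prob_measurable[OF cp] using f(1) pred_free_site[of u] by measurable
    show "AE \<phi> in \<nu>. f \<phi> * real_cond_exp \<nu> (sigma_off u) ?I \<phi> =
       lam / (1 + lam) * (f \<phi> * of_bool (free_site adj u \<phi>))"
      using g[unfolded gibbs_def free_site_def[symmetric], THEN conjunct2, rule_format, of u]
      by eventually_elim simp
  qed
  finally show ?thesis by simp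
qed

text \<open>The Gibbs property at \<open>x\<close>, tested on the event that \<open>y\<close> is occupied, on which \<open>x\<close> is never free.\<close>

lemma gibbs_edge: assumes g: "gibbs adj lam \<nu>" and a: "adj x y"
  shows "AE \<phi> in \<nu>. \<not> (\<phi> x \<and> \<phi> y)"
proof -
  have cp: "conf_prob \<nu>" using g by (simp add: gibbs_def)
  interpret prob_space \<nu> using cp by (rule conf_prob_prob_space)
  have "(\<integral>\<phi>. of_bool (\<phi> y) * of_bool (\<phi> x) \<partial>\<nu>) =
     lam / (1 + lam) * (\<integral>\<phi>. of_bool (\<phi> y) * of_bool (free_site adj x \<phi>) \<partial>\<nu> :: real)"
    by (rule gibbs_cond[OF g, of _ 1]) (use adj_neq[OF a] in \<open>auto simp: depends_on_def\<close>)
  also have "(\<lambda>\<phi>. of_bool (\<phi> y) * of_bool (free_site adj x \<phi>) :: real) = (\<lambda>_. 0)"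
    using a by (force simp: free_site_def independent_set_def occupied_def)
  finally have "(\<integral>\<phi>. of_bool (\<phi> x \<and> \<phi> y) \<partial>\<nu> :: real) = 0" by (simp add: of_bool_conj mult.commute)
  then have "measure \<nu> {\<phi>. \<phi> x \<and> \<phi> y} = 0"
    by (subst (asm) integral_of_bool) (auto simp: conf_prob_measurable[OF cp] conf_prob_space[OF cp])
  moreover have "{\<phi> \<in> space (conf_space UNIV). \<phi> x \<and> \<phi> y} \<in> sets (conf_space UNIV)" by measurable
  ultimately show ?thesis
    by (subst AE_iff_measurable[where N = "{\<phi>. \<phi> x \<and> \<phi> y}"])
      (auto simp: emeasure_eq_measure conf_prob_space[OF cp] conf_prob_sets[OF cp])
qed

text \<open>The definition of a Gibbs measure asks for independence of the whole configuration. Almost surely this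
reduces to a condition on the neighbours of the site, since edges are almost surely not doubly occupied.\<close>

lemma AE_independent:
  assumes cp: "conf_prob \<nu>" and e: "\<And>x y. adj x y \<Longrightarrow> AE \<phi> in \<nu>. \<not> (\<phi> x \<and> \<phi> y)"
  shows "AE \<phi> in \<nu>. \<forall>u. free_site adj u \<phi> \<longleftrightarrow> (\<forall>v\<in>nb u. \<not> \<phi> v)"
proof -
  have "AE \<phi> in \<nu>. \<forall>x\<in>UNIV. \<forall>y\<in>UNIV. adj x y \<longrightarrow> \<not> (\<phi> x \<and> \<phi> y)"
    using e by (subst AE_ball_countable[OF countable_nodes]; intro ballI)
      (subst AE_ball_countable[OF countable_nodes]; auto)
  then show ?thesis
  proof eventually_elim
    case (elim \<phi>)
    then show ?case
      using adj_irrefl adj_sym unfolding free_site_def independent_set_def occupied_def nbrs_def by blast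
  qed
qed

text \<open>The single-site property without conditional expectations: given that the neighbours leave the site free,
occupied is \<open>lam\<close> times as likely as vacant.\<close>

lemma gibbs_site:
  assumes g: "gibbs adj lam \<nu>" and lam: "lam > 0"
    and f: "f \<in> borel_measurable (conf_space UNIV)" "\<And>\<phi>. \<bar>f \<phi>\<bar> \<le> B" "depends_on (- {u}) f"
  shows "(\<integral>\<phi>. f \<phi> * of_bool (\<phi> u) \<partial>\<nu>) =
    lam * (\<integral>\<phi>. f \<phi> * of_bool (\<not> \<phi> u \<and> (\<forall>v\<in>nb u. \<not> \<phi> v)) \<partial>\<nu>)"
proof -
  have cp: "conf_prob \<nu>" using g by (simp add: gibbs_def)
  have B: "0 \<le> B" using order_trans[OF abs_ge_zero f(2)] .
  note [measurable] = f(1) pred_vacant_nbrs pred_free_site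
  let ?V = "\<lambda>\<phi>. \<forall>v\<in>nb u. \<not> \<phi> v"
  have int: "integrable \<nu> (\<lambda>\<phi>. f \<phi> * of_bool (P \<phi>))" if [measurable]: "Measurable.pred (conf_space UNIV) P" for P
    by (rule bounded_integrable[OF cp, of _ B]) (use f(2) B in auto)
  have ind: "AE \<phi> in \<nu>. \<forall>u. free_site adj u \<phi> \<longleftrightarrow> (\<forall>v\<in>nb u. \<not> \<phi> v)"
    using AE_independent[OF cp gibbs_edge[OF g]] .
  have "(\<integral>\<phi>. f \<phi> * of_bool (free_site adj u \<phi>) \<partial>\<nu>) = (\<integral>\<phi>. f \<phi> * of_bool (?V \<phi>) \<partial>\<nu>)"
    by (rule integral_cong_AE) (use ind in \<open>auto simp: conf_prob_measurable[OF cp]\<close>)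
  then have 1: "(\<integral>\<phi>. f \<phi> * of_bool (\<phi> u) \<partial>\<nu>) = lam / (1 + lam) * (\<integral>\<phi>. f \<phi> * of_bool (?V \<phi>) \<partial>\<nu>)"
    using gibbs_cond[OF g f] by simp
  have "AE \<phi> in \<nu>. \<forall>v\<in>nb u. \<not> (\<phi> u \<and> \<phi> v)"
    using gibbs_edge[OF g] by (intro AE_ball_countable' countable_finite finite_nb) auto
  then have "(\<integral>\<phi>. f \<phi> * of_bool (?V \<phi>) \<partial>\<nu>) =
      (\<integral>\<phi>. f \<phi> * of_bool (\<phi> u) + f \<phi> * of_bool (\<not> \<phi> u \<and> ?V \<phi>) \<partial>\<nu>)"
    by (intro integral_cong_AE) (auto simp: conf_prob_measurable[OF cp])
  also have "\<dots> = (\<integral>\<phi>. f \<phi> * of_bool (\<phi> u) \<partial>\<nu>) + (\<integral>\<phi>. f \<phi> * of_bool (\<not> \<phi> u \<and> ?V \<phi>) \<partial>\<nu>)"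
    by (intro Bochner_Integration.integral_add int) measurable
  finally have 2: "(\<integral>\<phi>. f \<phi> * of_bool (?V \<phi>) \<partial>\<nu>) = \<dots>" .
  have "a = lam * b" if "a = lam / (1 + lam) * (a + b)" for a b :: real
    using that lam by (simp add: field_simps)
  then show ?thesis using 1 unfolding 2 .
qed

text \<open>The converse of \<open>gibbs_site\<close>, for indicator functions: the identity characterises the conditional expectation.\<close>

lemma gibbsI:
  assumes cp: "conf_prob \<nu>" and lam: "lam > 0"
    and e: "\<And>x y. adj x y \<Longrightarrow> AE \<phi> in \<nu>. \<not> (\<phi> x \<and> \<phi> y)"
    and s: "\<And>u A. A \<in> sets (sigma_off u) \<Longrightarrow>
      measure \<nu> (A \<inter> {\<phi>. \<phi> u}) = lam * measure \<nu> (A \<inter> {\<phi>. \<not> \<phi> u \<and> (\<forall>v\<in>nb u. \<not> \<phi> v)})"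
  shows "gibbs adj lam \<nu>"
  unfolding gibbs_def free_site_def[symmetric]
proof (intro conjI cp allI)
  fix u
  interpret finite_measure_subalgebra \<nu> "sigma_off u"
    using cp by (rule finite_measure_subalgebra_sigma_off)
  interpret prob_space \<nu> using cp by (rule conf_prob_prob_space)
  let ?V = "\<lambda>\<phi>. \<forall>v\<in>nb u. \<not> \<phi> v"
  let ?F = "\<lambda>\<phi>. free_site adj u \<phi>"
  note [measurable] = pred_vacant_nbrs pred_free_site
  have ind: "AE \<phi> in \<nu>. ?F \<phi> \<longleftrightarrow> ?V \<phi>" using AE_independent[OF cp e] by auto
  have ev: "{\<phi>. P \<phi>} \<in> sets \<nu>" if "Measurable.pred (conf_space UNIV) P" for P
    using that by (simp add: pred_def conf_prob_sets[OF cp])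
  show "AE \<phi> in \<nu>. real_cond_exp \<nu> (sigma_off u) (indicator {\<phi>. \<phi> u}) \<phi> =
        lam / (1 + lam) * (if ?F \<phi> then 1 else 0)"
  proof (rule real_cond_exp_charact)
    have mu: "{\<phi>. \<phi> u} \<in> sets \<nu>" by (rule ev) measurable
    show "integrable \<nu> (indicator {\<phi>. \<phi> u} :: _ \<Rightarrow> real)"
      using mu by (auto simp: emeasure_eq_measure intro!: integrable_real_indicator)
    show "integrable \<nu> (\<lambda>\<phi>. lam / (1 + lam) * (if ?F \<phi> then 1 else 0))"
      by (rule bounded_integrable[OF cp, of _ "lam / (1 + lam)"]) (use lam in auto)
    have "Measurable.pred (sigma_off u) ?F" using pred_free_site depends_free_site by (rule sigma_off_factor)
    then show "(\<lambda>\<phi>. lam / (1 + lam) * (if ?F \<phi> then 1 else 0)) \<in> borel_measurable (sigma_off u)"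
      by measurable
    fix A assume A: "A \<in> sets (sigma_off u)"
    then have A': "A \<in> sets \<nu>" using subalgebra_sigma_off[OF cp, of u] by (auto simp: subalgebra_def)
    have mV: "{\<phi>. \<not> \<phi> u \<and> ?V \<phi>} \<in> sets \<nu>" "{\<phi>. ?V \<phi>} \<in> sets \<nu>" "{\<phi>. ?F \<phi>} \<in> sets \<nu>" by (rule ev, measurable)+
    have "(\<integral>\<phi>\<in>A. (indicator {\<phi>. \<phi> u} \<phi> :: real) \<partial>\<nu>) = measure \<nu> (A \<inter> {\<phi>. \<phi> u})"
    proof -
      have "(\<integral>\<phi>\<in>A. (indicator {\<phi>. \<phi> u} \<phi> :: real) \<partial>\<nu>) = (\<integral>\<phi>. indicator (A \<inter> {\<phi>. \<phi> u}) \<phi> \<partial>\<nu> :: real)"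
        unfolding set_lebesgue_integral_def by (intro Bochner_Integration.integral_cong) (auto simp: indicator_def)
      then show ?thesis using A' mu by (simp add: conf_prob_space[OF cp])
    qed
    moreover have "(\<integral>\<phi>\<in>A. (lam / (1 + lam) * (if ?F \<phi> then 1 else 0)) \<partial>\<nu>) = lam / (1 + lam) * measure \<nu> (A \<inter> {\<phi>. ?F \<phi>})"
    proof -
      have "(\<integral>\<phi>\<in>A. (lam / (1 + lam) * (if ?F \<phi> then 1 else 0)) \<partial>\<nu>) = (\<integral>\<phi>. lam / (1 + lam) * indicator (A \<inter> {\<phi>. ?F \<phi>}) \<phi> \<partial>\<nu>)"
        unfolding set_lebesgue_integral_def by (intro Bochner_Integration.integral_cong) (auto simp: indicator_def)
      then show ?thesis using A' mV by (simp add: conf_prob_space[OF cp])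
    qed
    moreover have "measure \<nu> (A \<inter> {\<phi>. ?F \<phi>}) = measure \<nu> (A \<inter> {\<phi>. \<phi> u}) + measure \<nu> (A \<inter> {\<phi>. \<not> \<phi> u \<and> ?V \<phi>})"
    proof -
      have "AE \<phi> in \<nu>. \<forall>v\<in>nb u. \<not> (\<phi> u \<and> \<phi> v)"
        using e by (intro AE_ball_countable' countable_finite finite_nb) auto
      then have "AE \<phi> in \<nu>. \<phi> \<in> A \<inter> {\<phi>. ?F \<phi>} \<longleftrightarrow> \<phi> \<in> (A \<inter> {\<phi>. \<phi> u}) \<union> (A \<inter> {\<phi>. \<not> \<phi> u \<and> ?V \<phi>})"
        using ind by eventually_elim auto
      then have "measure \<nu> (A \<inter> {\<phi>. ?F \<phi>}) = measure \<nu> ((A \<inter> {\<phi>. \<phi> u}) \<union> (A \<inter> {\<phi>. \<not> \<phi> u \<and> ?V \<phi>}))"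
        by (rule measure_eq_AE) (use A' mV mu in auto)
      also have "\<dots> = measure \<nu> (A \<inter> {\<phi>. \<phi> u}) + measure \<nu> (A \<inter> {\<phi>. \<not> \<phi> u \<and> ?V \<phi>})"
        by (rule finite_measure_Union) (use A' mV mu in auto)
      finally show ?thesis .
    qed
    ultimately show "(\<integral>\<phi>\<in>A. (indicator {\<phi>. \<phi> u} \<phi> :: real) \<partial>\<nu>) = (\<integral>\<phi>\<in>A. (lam / (1 + lam) * (if ?F \<phi> then 1 else 0)) \<partial>\<nu>)"
      using s[OF A] lam by (simp add: field_simps)
  qed
qed

end

section \<open>Measures determined by their one-step probabilities\<close>

text \<open>A weak form of the Markov property of the explicit measure, with \<open>c\<close> the probability that a neighbour of a vacant site is
vacant and \<open>p\<close> the density. The pattern on \<open>T\<close> may extend into all branches at \<open>x\<close> except that of \<open>y\<close>.\<close>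

definition hc_chain :: "('v \<Rightarrow> 'v \<Rightarrow> bool) \<Rightarrow> real \<Rightarrow> real \<Rightarrow> ('v \<Rightarrow> bool) measure \<Rightarrow> bool" where
  "hc_chain adj c p \<nu> \<longleftrightarrow> conf_prob \<nu> \<and> (\<forall>x. measure \<nu> {\<phi>. \<phi> x} = p) \<and>
     (\<forall>x y. adj x y \<longrightarrow> (AE \<phi> in \<nu>. \<not> (\<phi> x \<and> \<phi> y))) \<and>
     (\<forall>x y T \<sigma>. adj x y \<longrightarrow> finite T \<longrightarrow> x \<in> T \<longrightarrow> T \<inter> branch adj x y = {} \<longrightarrow> \<not> \<sigma> x \<longrightarrow>
        measure \<nu> (atom T \<sigma> \<inter> {\<phi>. \<not> \<phi> y}) = c * measure \<nu> (atom T \<sigma>))"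

text \<open>The transition matrix of the broadcast process, from the state \<open>a\<close> of a parent to the state \<open>b\<close> of a child.\<close>

definition hc_step :: "real \<Rightarrow> bool \<Rightarrow> bool \<Rightarrow> real" where
  "hc_step c a b = (if a then (if b then 0 else 1) else (if b then 1 - c else c))"

lemma conf_event: assumes "conf_prob \<nu>" "Measurable.pred (conf_space UNIV) P" shows "{\<phi>. P \<phi>} \<in> sets \<nu>"
  using assms(2) by (simp add: pred_def conf_prob_sets[OF assms(1)])

lemma conf_prob_compl:
  assumes "conf_prob \<nu>" "Measurable.pred (conf_space UNIV) P"
  shows "measure \<nu> {\<phi>. \<not> P \<phi>} = 1 - measure \<nu> {\<phi>. P \<phi>}"
proof -
  interpret prob_space \<nu> using assms(1) by (rule conf_prob_prob_space)
  have "{\<phi>. \<not> P \<phi>} = space \<nu> - {\<phi>. P \<phi>}" using conf_prob_space[OF assms(1)] by auto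
  then show ?thesis using prob_compl[OF conf_event[OF assms]] by simp
qed

lemma integral_event:
  assumes "conf_prob \<nu>" "Measurable.pred (conf_space UNIV) P"
  shows "(\<integral>\<phi>. of_bool (P \<phi>) \<partial>\<nu>) = measure \<nu> {\<phi>. P \<phi>}"
  using integral_of_bool[of P \<nu>] assms by (simp add: conf_prob_measurable conf_prob_space)

lemma prod_of_bool: "finite A \<Longrightarrow> (\<Prod>y\<in>A. of_bool (P y)) = (of_bool (\<forall>y\<in>A. P y) :: real)"
  by (induction A rule: finite_induct) auto

lemma hc_chain_step:
  assumes h: "hc_chain adj c p \<nu>" and a: "adj x y" and T: "finite T" "x \<in> T" "T \<inter> branch adj x y = {}"
  shows "measure \<nu> (atom (insert y T) \<sigma>) = hc_step c (\<sigma> x) (\<sigma> y) * measure \<nu> (atom T \<sigma>)"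
proof -
  have cp: "conf_prob \<nu>" using h by (simp add: hc_chain_def)
  interpret prob_space \<nu> using cp by (rule conf_prob_prob_space)
  have mT: "atom T \<sigma> \<in> sets \<nu>" using sets_atom[OF T(1)] by (simp add: conf_prob_sets[OF cp])
  have my: "{\<phi>. \<phi> y} \<in> sets \<nu>" "{\<phi>. \<not> \<phi> y} \<in> sets \<nu>" by (rule conf_event[OF cp], measurable)+
  have split: "measure \<nu> (atom T \<sigma>) = measure \<nu> (atom T \<sigma> \<inter> {\<phi>. \<phi> y}) + measure \<nu> (atom T \<sigma> \<inter> {\<phi>. \<not> \<phi> y})"
    by (subst finite_measure_Union[symmetric]) (use mT my in \<open>auto intro!: arg_cong[where f="measure \<nu>"]\<close>)
  have ins: "atom (insert y T) \<sigma> = atom T \<sigma> \<inter> {\<phi>. \<phi> y = \<sigma> y}" by (auto simp: atom_def)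
  show ?thesis
  proof (cases "\<sigma> x")
    case True
    have "AE \<phi> in \<nu>. \<not> (\<phi> x \<and> \<phi> y)" using h a by (auto simp: hc_chain_def)
    then have "AE \<phi> in \<nu>. \<phi> \<in> atom T \<sigma> \<inter> {\<phi>. \<phi> y} \<longleftrightarrow> \<phi> \<in> {}"
      by eventually_elim (use True T(2) in \<open>auto simp: atom_def\<close>)
    then have "measure \<nu> (atom T \<sigma> \<inter> {\<phi>. \<phi> y}) = measure \<nu> {}"
      by (rule measure_eq_AE) (use mT my in auto)
    then show ?thesis using True split ins by (cases "\<sigma> y") (auto simp: hc_step_def)
  next
    case False
    then have "measure \<nu> (atom T \<sigma> \<inter> {\<phi>. \<not> \<phi> y}) = c * measure \<nu> (atom T \<sigma>)"
      using h a T unfolding hc_chain_def by blast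
    then show ?thesis using False split ins by (cases "\<sigma> y") (auto simp: hc_step_def algebra_simps)
  qed
qed

lemma atom_singleton_measure:
  assumes "conf_prob \<nu>"
  shows "measure \<nu> (atom {r} \<sigma>) = (if \<sigma> r then measure \<nu> {\<phi>. \<phi> r} else 1 - measure \<nu> {\<phi>. \<phi> r})"
  using conf_prob_compl[OF assms, of "\<lambda>\<phi>. \<phi> r"] by (simp add: atom_def)

text \<open>A finite subtree is built up from a root by adding leaves, and each new leaf multiplies the probability of
a pattern by a factor that depends on \<open>c\<close> only.\<close>

lemma (in reg_tree) hc_chain_unique:
  assumes h: "hc_chain adj c p \<nu>" "hc_chain adj c p \<nu>'"
  shows "\<nu> = \<nu>'"
proof -
  fix r :: 'v
  have cp: "conf_prob \<nu>" "conf_prob \<nu>'" using h by (auto simp: hc_chain_def)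
  have eq: "measure \<nu> (atom T \<sigma>) = measure \<nu>' (atom T \<sigma>)" if "rooted r T" for T \<sigma>
    using that
  proof (induction "card T" arbitrary: T rule: less_induct)
    case less
    show ?case
    proof (cases "T = {r}")
      case True
      then show ?thesis using h cp by (simp add: atom_singleton_measure hc_chain_def)
    next
      case False
      then obtain x where x: "x \<in> T" "x \<noteq> r" "rooted r (T - {x})" "(T - {x}) \<inter> br (par r x) x = {}"
        using rooted_remove_deepest[OF less.prems] by blast
      have fin: "finite T" using less.prems by (simp add: rooted_def)
      have t: "adj (par r x) x" "par r x \<in> T - {x}"
        using less.prems x(1,2) parent_props(1)[OF x(2)] adj_sym adj_neq by (auto simp: rooted_def)
      have "T = insert x (T - {x})" using x by blast
      moreover have "measure \<nu> (atom (T - {x}) \<sigma>) = measure \<nu>' (atom (T - {x}) \<sigma>)"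
        using less.hyps[OF card_Diff1_less[OF fin x(1)] x(3)] .
      ultimately show ?thesis
        using hc_chain_step[OF h(1) t(1) _ t(2) x(4)] hc_chain_step[OF h(2) t(1) _ t(2) x(4)] fin by (metis finite_Diff)
    qed
  qed
  show ?thesis
  proof (rule conf_prob_eqI[OF cp])
    fix J :: "'v set" assume "finite J"
    then obtain T where "rooted r T" "J \<subseteq> T" using rooted_superset by blast
    then show "\<exists>T. finite T \<and> J \<subseteq> T \<and> (\<forall>\<sigma>. measure \<nu> (atom T \<sigma>) = measure \<nu>' (atom T \<sigma>))"
      using eq by (auto simp: rooted_def)
  qed
qed

lemma integral_uniform_measure_event:
  fixes f :: "('v \<Rightarrow> bool) \<Rightarrow> real"
  assumes cp: "conf_prob \<nu>" and S: "Measurable.pred (conf_space UNIV) S" and pos: "measure \<nu> {\<phi>. S \<phi>} > 0"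
    and f: "f \<in> borel_measurable (conf_space UNIV)"
  shows "(\<integral>\<phi>. f \<phi> \<partial>uniform_measure \<nu> {\<phi>. S \<phi>}) = (\<integral>\<phi>. f \<phi> * of_bool (S \<phi>) \<partial>\<nu>) / measure \<nu> {\<phi>. S \<phi>}"
proof -
  interpret prob_space \<nu> using cp by (rule conf_prob_prob_space)
  have "1 / ennreal (measure \<nu> {\<phi>. S \<phi>}) = ennreal (1 / measure \<nu> {\<phi>. S \<phi>})"
    using divide_ennreal[of 1 "measure \<nu> {\<phi>. S \<phi>}"] pos by simp
  then have d: "uniform_measure \<nu> {\<phi>. S \<phi>} = density \<nu> (\<lambda>\<phi>. ennreal (of_bool (S \<phi>) / measure \<nu> {\<phi>. S \<phi>}))"
    unfolding uniform_measure_def using pos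
    by (intro arg_cong[where f = "density \<nu>"] ext) (auto simp: emeasure_eq_measure indicator_def)
  show ?thesis unfolding d
    using f S pos by (subst integral_real_density) (auto simp: conf_prob_measurable[OF cp] mult.commute)
qed

context reg_tree begin

text \<open>Simplicity as a product formula for expectations. Dividing by the probability of \<open>\<phi> x = b\<close>
turns the integrals into conditional expectations.\<close>

lemma simple_product:
  assumes cp: "conf_prob \<nu>" and s: "simple_measure adj \<nu>" and pos: "measure \<nu> {\<phi>. \<phi> x = b} > 0"
    and f: "\<And>y. adj x y \<Longrightarrow> f y \<in> borel_measurable (conf_space UNIV)"
      "\<And>y \<phi>. adj x y \<Longrightarrow> \<bar>f y \<phi>\<bar> \<le> 1" "\<And>y. adj x y \<Longrightarrow> depends_on (br x y) (f y)"
  shows "(\<integral>\<phi>. (\<Prod>y\<in>nb x. f y \<phi>) * of_bool (\<phi> x = b) \<partial>\<nu>) / measure \<nu> {\<phi>. \<phi> x = b} =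
    (\<Prod>y\<in>nb x. (\<integral>\<phi>. f y \<phi> * of_bool (\<phi> x = b) \<partial>\<nu>) / measure \<nu> {\<phi>. \<phi> x = b})"
proof -
  let ?U = "uniform_measure \<nu> {\<phi>. \<phi> x = b}"
  interpret N: prob_space \<nu> using cp by (rule conf_prob_prob_space)
  interpret U: prob_space ?U
    using pos by (intro prob_space_uniform_measure) (auto simp: N.emeasure_eq_measure)
  have setsU: "sets ?U = sets (conf_space UNIV)" by (simp add: conf_prob_sets[OF cp])
  have cpU: "conf_prob ?U" using U.prob_space_axioms setsU by (simp add: conf_prob_def)
  \<comment> \<open>simplicity is indexed by components; each is the branch of one neighbour\<close>
  define nbr where "nbr C = the_inv_into (nb x) (br x) C" for C
  have nbr: "nbr (br x y) = y" if "y \<in> nb x" for y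
    unfolding nbr_def using inj_on_br that by (rule the_inv_into_f_f)
  have ind: "U.indep_vars conf_space (\<lambda>C \<phi>. restrict \<phi> C) (br x ` nb x)"
    using s pos unfolding simple_measure_def components_without_eq by blast
  have "U.indep_vars (\<lambda>_. borel) (\<lambda>C \<phi>. f (nbr C) (\<lambda>v. if v \<in> C then restrict \<phi> C v else False)) (br x ` nb x)"
    by (rule U.indep_vars_compose2[OF ind], rule measurable_compose[OF measurable_extend_conf])
       (auto simp: nbr intro: f)
  then have ind': "U.indep_vars (\<lambda>_. borel) (\<lambda>C. f (nbr C)) (br x ` nb x)"
  proof (subst U.indep_vars_cong[OF refl _ refl])
    fix C assume "C \<in> br x ` nb x"
    then obtain y where y: "y \<in> nb x" "C = br x y" by blast
    have "depends_on C (f (nbr C))" using f(3)[of y] y by (simp add: nbr)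
    from depends_on_factor[OF this, of _ "\<lambda>_. False"]
    show "f (nbr C) = (\<lambda>\<phi>. f (nbr C) (\<lambda>v. if v \<in> C then restrict \<phi> C v else False))" by (rule ext)
  qed
  have "(\<integral>\<phi>. (\<Prod>y\<in>nb x. f y \<phi>) \<partial>?U) = (\<integral>\<phi>. (\<Prod>C\<in>br x ` nb x. f (nbr C) \<phi>) \<partial>?U)"
    by (intro Bochner_Integration.integral_cong refl, subst prod.reindex[OF inj_on_br]) (simp add: nbr del: in_nb)
  also have "\<dots> = (\<Prod>C\<in>br x ` nb x. \<integral>\<phi>. f (nbr C) \<phi> \<partial>?U)"
    using finite_nb by (intro U.indep_vars_lebesgue_integral ind')
      (auto intro!: bounded_integrable[OF cpU, of _ 1] f simp: nbr)
  also have "\<dots> = (\<Prod>y\<in>nb x. \<integral>\<phi>. f y \<phi> \<partial>?U)"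
    by (subst prod.reindex[OF inj_on_br]) (simp add: nbr del: in_nb)
  finally have eq: "(\<integral>\<phi>. (\<Prod>y\<in>nb x. f y \<phi>) \<partial>?U) = (\<Prod>y\<in>nb x. \<integral>\<phi>. f y \<phi> \<partial>?U)" .
  have m: "Measurable.pred (conf_space UNIV) (\<lambda>\<phi>. \<phi> x = b)" by measurable
  have "(\<integral>\<phi>. (\<Prod>y\<in>nb x. f y \<phi>) \<partial>?U) =
      (\<integral>\<phi>. (\<Prod>y\<in>nb x. f y \<phi>) * of_bool (\<phi> x = b) \<partial>\<nu>) / measure \<nu> {\<phi>. \<phi> x = b}"
    by (rule integral_uniform_measure_event[OF cp m pos]) (auto intro!: borel_measurable_prod f)
  moreover have "(\<integral>\<phi>. f y \<phi> \<partial>?U) = (\<integral>\<phi>. f y \<phi> * of_bool (\<phi> x = b) \<partial>\<nu>) / measure \<nu> {\<phi>. \<phi> x = b}"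
    if "y \<in> nb x" for y
    using that by (intro integral_uniform_measure_event[OF cp m pos] f) simp
  ultimately show ?thesis using eq by simp
qed

lemma simple_product_event:
  assumes cp: "conf_prob \<nu>" and s: "simple_measure adj \<nu>" and pos: "measure \<nu> {\<phi>. \<phi> x = b} > 0"
    and P: "\<And>y. adj x y \<Longrightarrow> Measurable.pred (conf_space UNIV) (P y)" "\<And>y. adj x y \<Longrightarrow> depends_on (br x y) (P y)"
  shows "measure \<nu> {\<phi>. \<phi> x = b \<and> (\<forall>y\<in>nb x. P y \<phi>)} / measure \<nu> {\<phi>. \<phi> x = b} =
    (\<Prod>y\<in>nb x. measure \<nu> {\<phi>. \<phi> x = b \<and> P y \<phi>} / measure \<nu> {\<phi>. \<phi> x = b})"
proof -
  have m: "Measurable.pred (conf_space UNIV) (\<lambda>\<phi>. \<phi> x = b)" by measurable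
  have 1: "(\<integral>\<phi>. (\<Prod>y\<in>nb x. of_bool (P y \<phi>)) * of_bool (\<phi> x = b) \<partial>\<nu>) = measure \<nu> {\<phi>. \<phi> x = b \<and> (\<forall>y\<in>nb x. P y \<phi>)}"
    using integral_event[OF cp, of "\<lambda>\<phi>. \<phi> x = b \<and> (\<forall>y\<in>nb x. P y \<phi>)"] P(1) m
    by (simp add: prod_of_bool[OF finite_nb] of_bool_conj[symmetric] conj_commute pred_intros_finite finite_nb)
  have 2: "(\<integral>\<phi>. of_bool (P y \<phi>) * of_bool (\<phi> x = b) \<partial>\<nu>) = measure \<nu> {\<phi>. \<phi> x = b \<and> P y \<phi>}" if "y \<in> nb x" for y
    using integral_event[OF cp, of "\<lambda>\<phi>. \<phi> x = b \<and> P y \<phi>"] P(1)[of y] m that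
    by (simp add: of_bool_conj[symmetric] conj_commute)
  have 3: "depends_on (br x y) (\<lambda>\<phi>. of_bool (P y \<phi>) :: real)" if "adj x y" for y
    using P(2)[OF that] unfolding depends_on_def by (intro allI impI arg_cong[where f = of_bool]) blast
  show ?thesis
    using simple_product[OF cp s pos, of "\<lambda>y \<phi>. of_bool (P y \<phi>)"] P(1) 1 3
    by (simp add: 2 del: in_nb)
qed

text \<open>Given that \<open>x\<close> is vacant, the pattern splits into independent parts, one for each branch at \<open>x\<close>, and the
state of \<open>y\<close> concerns a branch that carries no part of the pattern.\<close>

lemma simple_hc_chain:
  assumes cp: "conf_prob \<nu>" and s: "simple_measure adj \<nu>"
    and e: "\<And>x y. adj x y \<Longrightarrow> AE \<phi> in \<nu>. \<not> (\<phi> x \<and> \<phi> y)"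
    and p: "\<And>x. measure \<nu> {\<phi>. \<phi> x} = p" "p < 1"
  shows "hc_chain adj ((1 - 2 * p) / (1 - p)) p \<nu>"
    and "adj x y \<Longrightarrow> measure \<nu> {\<phi>. \<not> \<phi> x \<and> \<not> \<phi> y} = 1 - 2 * p"
proof -
  interpret prob_space \<nu> using cp by (rule conf_prob_prob_space)
  have vac: "measure \<nu> {\<phi>. \<phi> x = False} = 1 - p" for x
    using conf_prob_compl[OF cp, of "\<lambda>\<phi>. \<phi> x"] p by simp
  show pair: "measure \<nu> {\<phi>. \<not> \<phi> x \<and> \<not> \<phi> y} = 1 - 2 * p" if a: "adj x y" for x y
  proof -
    have m: "{\<phi>. \<phi> x} \<in> sets \<nu>" "{\<phi>. \<phi> y} \<in> sets \<nu>" "{\<phi>. \<phi> x \<or> \<phi> y} \<in> sets \<nu>" by (rule conf_event[OF cp], measurable)+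
    have "measure \<nu> ({\<phi>. \<phi> x} \<union> {\<phi>. \<phi> y}) = measure \<nu> {\<phi>. \<phi> x} + measure \<nu> {\<phi>. \<phi> y}"
      using e[OF a] m by (intro measure_Un_AE) (auto intro: fmeasurableI simp: emeasure_eq_measure)
    moreover have "{\<phi>. \<phi> x} \<union> {\<phi>. \<phi> y} = {\<phi>. \<phi> x \<or> \<phi> y}" by auto
    moreover have "measure \<nu> {\<phi>. \<not> (\<phi> x \<or> \<phi> y)} = 1 - measure \<nu> {\<phi>. \<phi> x \<or> \<phi> y}"
      by (rule conf_prob_compl[OF cp]) measurable
    ultimately show ?thesis using p by simp
  qed
  have "measure \<nu> (atom T \<sigma> \<inter> {\<phi>. \<not> \<phi> y}) = (1 - 2 * p) / (1 - p) * measure \<nu> (atom T \<sigma>)"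
    if a: "adj x y" and T: "finite T" "x \<in> T" "T \<inter> br x y = {}" and \<sigma>: "\<not> \<sigma> x" for x y T \<sigma>
  proof -
    have pos: "measure \<nu> {\<phi>. \<phi> x = False} > 0" using vac p by simp
    define P where "P z \<phi> \<longleftrightarrow> (\<forall>v\<in>T \<inter> br x z. \<phi> v = \<sigma> v)" for z \<phi>
    have mP: "Measurable.pred (conf_space UNIV) (P z)" "depends_on (br x z) (P z)" for z
    proof -
      show "Measurable.pred (conf_space UNIV) (P z)"
        unfolding P_def using T(1) by (intro pred_intros_finite) auto
      show "depends_on (br x z) (P z)" by (auto simp: depends_on_def P_def)
    qed
    have at: "atom T \<sigma> = {\<phi>. \<phi> x = False \<and> (\<forall>z\<in>nb x. P z \<phi>)}"
    proof (intro set_eqI iffI)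
      fix \<phi> assume r: "\<phi> \<in> {\<phi>. \<phi> x = False \<and> (\<forall>z\<in>nb x. P z \<phi>)}"
      have "\<phi> v = \<sigma> v" if v: "v \<in> T" for v
      proof (cases "v = x")
        case False
        then obtain z where "adj x z" "v \<in> br x z" using br_cover by blast
        then show ?thesis using r v by (auto simp: P_def)
      qed (use r \<sigma> in auto)
      then show "\<phi> \<in> atom T \<sigma>" by (simp add: atom_def)
    qed (use T \<sigma> in \<open>auto simp: atom_def P_def\<close>)
    have Py: "P y \<phi>" for \<phi> using T by (simp add: P_def)
    let ?P = "\<lambda>z \<phi>. P z \<phi> \<and> (z = y \<longrightarrow> \<not> \<phi> y)"
    have at': "atom T \<sigma> \<inter> {\<phi>. \<not> \<phi> y} = {\<phi>. \<phi> x = False \<and> (\<forall>z\<in>nb x. ?P z \<phi>)}"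
      unfolding at using a by auto
    have "measure \<nu> (atom T \<sigma> \<inter> {\<phi>. \<not> \<phi> y}) / measure \<nu> {\<phi>. \<phi> x = False} =
        (\<Prod>z\<in>nb x. measure \<nu> {\<phi>. \<phi> x = False \<and> ?P z \<phi>} / measure \<nu> {\<phi>. \<phi> x = False})"
      unfolding at'
    proof (rule simple_product_event[OF cp s pos])
      fix z assume "adj x z"
      show "Measurable.pred (conf_space UNIV) (?P z)" using mP(1)[of z] by measurable
      show "depends_on (br x z) (?P z)" using mP(2)[of z] br_self[of z x] unfolding depends_on_def by metis
    qed
    also have "\<dots> = (measure \<nu> {\<phi>. \<phi> x = False \<and> ?P y \<phi>} / measure \<nu> {\<phi>. \<phi> x = False}) *
        (\<Prod>z\<in>nb x - {y}. measure \<nu> {\<phi>. \<phi> x = False \<and> ?P z \<phi>} / measure \<nu> {\<phi>. \<phi> x = False})"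
      using finite_nb a by (intro prod.remove) auto
    also have "measure \<nu> {\<phi>. \<phi> x = False \<and> ?P y \<phi>} = 1 - 2 * p" using pair[OF a] Py by simp
    also have "(\<Prod>z\<in>nb x - {y}. measure \<nu> {\<phi>. \<phi> x = False \<and> ?P z \<phi>} / measure \<nu> {\<phi>. \<phi> x = False}) =
        (\<Prod>z\<in>nb x - {y}. measure \<nu> {\<phi>. \<phi> x = False \<and> P z \<phi>} / measure \<nu> {\<phi>. \<phi> x = False})"
      by (intro prod.cong) auto
    also have "\<dots> = (measure \<nu> {\<phi>. \<phi> x = False \<and> P y \<phi>} / measure \<nu> {\<phi>. \<phi> x = False}) * \<dots>"
      using pos Py by simp
    also have "\<dots> = (\<Prod>z\<in>nb x. measure \<nu> {\<phi>. \<phi> x = False \<and> P z \<phi>} / measure \<nu> {\<phi>. \<phi> x = False})"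
      using finite_nb a by (intro prod.remove[symmetric]) auto
    also have "\<dots> = measure \<nu> (atom T \<sigma>) / measure \<nu> {\<phi>. \<phi> x = False}"
      unfolding at by (rule simple_product_event[OF cp s pos, symmetric]) (use mP in auto)
    finally show ?thesis using p(2) unfolding vac by (simp add: divide_simps)
  qed
  then show "hc_chain adj ((1 - 2 * p) / (1 - p)) p \<nu>"
    unfolding hc_chain_def using cp e p by blast
qed

text \<open>The automorphism group acts transitively on the sites, by \<open>root_shift_automorphism\<close>.\<close>

lemma invariant_marginal:
  assumes cp: "conf_prob \<nu>" and i: "invariant_measure adj \<nu>"
  shows "measure \<nu> {\<phi>. \<phi> x} = measure \<nu> {\<phi>. \<phi> y}"
proof -
  obtain g where g: "automorphism adj g" "g x = y" using root_shift_automorphism root_shift_root by blast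
  have m: "(\<lambda>\<phi>. \<phi> \<circ> g) \<in> measurable \<nu> (conf_space UNIV)"
    unfolding conf_prob_measurable[OF cp] by (rule measurable_conf_spaceI) (auto simp: o_def)
  have "measure \<nu> {\<phi>. \<phi> x} = measure (distr \<nu> (conf_space UNIV) (\<lambda>\<phi>. \<phi> \<circ> g)) {\<phi>. \<phi> x}"
    using i g unfolding invariant_measure_def by simp
  also have "\<dots> = measure \<nu> ((\<lambda>\<phi>. \<phi> \<circ> g) -` {\<phi>. \<phi> x} \<inter> space \<nu>)"
    using conf_event[OF cp, of "\<lambda>\<phi>. \<phi> x"] by (intro measure_distr m) (simp add: conf_prob_sets[OF cp])
  also have "(\<lambda>\<phi>. \<phi> \<circ> g) -` {\<phi>. \<phi> x} \<inter> space \<nu> = {\<phi>. \<phi> y}" using g by (auto simp: conf_prob_space[OF cp])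
  finally show ?thesis .
qed

lemma activity_inj:
  assumes "0 < w" "0 < w'" "w * (1 + w) ^ k = w' * (1 + w') ^ k" shows "w = (w' :: real)"
proof -
  have mono: "a * (1 + a) ^ k < b * (1 + b) ^ k" if "0 < a" "a < b" for a b :: real
  proof -
    have "a * (1 + a) ^ k < b * (1 + a) ^ k" using that by simp
    also have "\<dots> \<le> b * (1 + b) ^ k" using that by (intro mult_left_mono power_mono) auto
    finally show ?thesis .
  qed
  show ?thesis using mono[of w w'] mono[of w' w] assms by (cases w w' rule: linorder_cases) auto
qed

text \<open>The Gibbs property compares occupied with vacant at a site, and simplicity splits the neighbours of the
vacant site. With \<open>q\<close> the probability that a neighbour is vacant this reads \<open>p = lam (1 - p) q^(k + 1)\<close>; in
terms of \<open>w' = p / (1 - 2 p)\<close> it is the defining equation of \<open>w\<close>.\<close>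

lemma simple_gibbs_density:
  assumes lam: "lam > 0" and g: "gibbs adj lam \<nu>" and s: "simple_measure adj \<nu>"
    and p: "\<And>x. measure \<nu> {\<phi>. \<phi> x} = p"
    and w: "w > 0" "w * (1 + w) ^ k = lam"
  shows "p = w / (1 + 2 * w)"
proof -
  fix x :: 'v
  have cp: "conf_prob \<nu>" using g by (simp add: gibbs_def)
  interpret prob_space \<nu> using cp by (rule conf_prob_prob_space)
  have e: "\<And>x y. adj x y \<Longrightarrow> AE \<phi> in \<nu>. \<not> (\<phi> x \<and> \<phi> y)" using gibbs_edge[OF g] .
  note [measurable] = pred_vacant_nbrs
  let ?V = "\<lambda>\<phi>. \<forall>v\<in>nb x. \<not> \<phi> v"
  have site: "p = lam * measure \<nu> {\<phi>. \<phi> x = False \<and> ?V \<phi>}"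
    using gibbs_site[OF g lam, of "\<lambda>_. 1" 1 x] p[of x] integral_event[OF cp, of "\<lambda>\<phi>. \<phi> x"]
      integral_event[OF cp, of "\<lambda>\<phi>. \<not> \<phi> x \<and> ?V \<phi>"] by (simp add: depends_on_def)
  have vac: "measure \<nu> {\<phi>. \<phi> x = False} = 1 - p" for x
    using conf_prob_compl[OF cp, of "\<lambda>\<phi>. \<phi> x"] p by simp
  have p1: "p < 1"
  proof -
    have "measure \<nu> {\<phi>. \<phi> x = False \<and> ?V \<phi>} \<le> measure \<nu> {\<phi>. \<phi> x = False}"
      by (rule finite_measure_mono) (auto intro: conf_event[OF cp])
    then have "p \<le> lam * (1 - p)" using site vac[of x] mult_left_mono[of _ "1 - p" lam] lam by simp
    moreover have "p \<le> 1" using p by (metis prob_le_1)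
    ultimately show ?thesis using lam by (cases "p = 1") auto
  qed
  have pos: "measure \<nu> {\<phi>. \<phi> x = False} > 0" using vac p1 by simp
  define q where "q = (1 - 2 * p) / (1 - p)"
  have "measure \<nu> {\<phi>. \<phi> x = False \<and> (\<forall>y\<in>nb x. \<not> \<phi> y)} / measure \<nu> {\<phi>. \<phi> x = False} =
      (\<Prod>y\<in>nb x. measure \<nu> {\<phi>. \<phi> x = False \<and> \<not> \<phi> y} / measure \<nu> {\<phi>. \<phi> x = False})"
    by (rule simple_product_event[OF cp s pos]) (use br_self in \<open>auto simp: depends_on_def\<close>)
  also have "\<dots> = (\<Prod>y\<in>nb x. q)"
    using simple_hc_chain(2)[OF cp s e p p1] vac by (intro prod.cong) (auto simp: q_def)
  also have "\<dots> = q ^ (k + 1)" using card_nb by simp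
  finally have "measure \<nu> {\<phi>. \<phi> x = False \<and> ?V \<phi>} = (1 - p) * q ^ (k + 1)"
    using p1 unfolding vac[of x] by (simp add: field_simps)
  then have main: "p = lam * (1 - p) * q ^ (k + 1)" using site by simp
  have p0: "p \<ge> 0" using p by (metis measure_nonneg)
  have q0: "q \<ge> 0"
  proof -
    have "nb x \<noteq> {}" using card_nb[of x] by (metis Suc_eq_plus1 card.empty nat.distinct(1))
    then obtain y where "y \<in> nb x" by blast
    then have "1 - 2 * p \<ge> 0" using simple_hc_chain(2)[OF cp s e p p1, of x y] by (metis in_nb measure_nonneg)
    then show ?thesis using p1 by (simp add: q_def)
  qed
  have "q \<noteq> 0"
  proof
    assume "q = 0"
    then have "p = 0" using main by simp
    then show False using \<open>q = 0\<close> by (simp add: q_def)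
  qed
  then have q: "q > 0" using q0 by simp
  have p_pos: "p > 0" using main lam q p1 by (metis mult_pos_pos zero_less_power diff_gt_0_iff_gt)
  have d: "1 - 2 * p > 0" using q p1 by (simp add: q_def zero_less_divide_iff)
  define w' where "w' = p / (1 - 2 * p)"
  have q': "q = 1 / (1 + w')" using d p1 by (simp add: q_def w'_def field_simps)
  have w'0: "w' > 0" using p_pos d by (simp add: w'_def)
  have "w' * (1 + w') ^ k = lam"
  proof -
    have "p / (1 - p) = w' * q" using d unfolding q_def w'_def by simp
    moreover have "p / (1 - p) = lam * q ^ (k + 1)" using main p1 by (simp add: field_simps)
    ultimately have "w' = lam * q ^ k" using q by simp
    then show ?thesis using w'0 by (simp add: q' field_simps power_divide)
  qed
  then have "w' = w" using activity_inj[OF w'0 w(1)] w(2) by simp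
  then have "p = w * (1 - 2 * p)" using d by (simp add: w'_def field_simps)
  then show ?thesis using w by (simp add: field_simps)
qed

lemma simple_gibbs_hc_chain:
  assumes lam: "lam > 0" and g: "gibbs adj lam \<nu>" and s: "simple_measure adj \<nu>" and i: "invariant_measure adj \<nu>"
    and w: "w > 0" "w * (1 + w) ^ k = lam"
  shows "hc_chain adj (1 / (1 + w)) (w / (1 + 2 * w)) \<nu>"
proof -
  fix r :: 'v
  have cp: "conf_prob \<nu>" using g by (simp add: gibbs_def)
  define p where "p = measure \<nu> {\<phi>. \<phi> r}"
  have p: "\<And>x. measure \<nu> {\<phi>. \<phi> x} = p" unfolding p_def using invariant_marginal[OF cp i] .
  have pw: "p = w / (1 + 2 * w)" using simple_gibbs_density[OF lam g s p w] .
  have "p < 1" using w(1) by (simp add: pw field_simps)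
  have "hc_chain adj ((1 - 2 * p) / (1 - p)) p \<nu>" using simple_hc_chain(1)[OF cp s gibbs_edge[OF g] p \<open>p < 1\<close>] .
  also have "(1 - 2 * p) / (1 - p) = 1 / (1 + w)" using w(1) unfolding pw by (simp add: field_simps)
  finally show ?thesis by (simp add: pw)
qed

end

section \<open>The broadcast process\<close>

context reg_tree begin

text \<open>Each site carries a bit, and it is occupied if its bit is set and its parent is vacant. With independent
bits this produces the explicit measure; for a child of an occupied site the bit is simply ignored. As above, the
number is the distance to the root.\<close>

primrec broadcast_aux :: "'v \<Rightarrow> nat \<Rightarrow> ('v \<Rightarrow> bool) \<Rightarrow> 'v \<Rightarrow> bool" where
  "broadcast_aux r 0 B v = B v"
| "broadcast_aux r (Suc n) B v = (B v \<and> \<not> broadcast_aux r n B (par r v))"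

definition broadcast :: "'v \<Rightarrow> ('v \<Rightarrow> bool) \<Rightarrow> 'v \<Rightarrow> bool" where
  "broadcast r B v = broadcast_aux r (dst r v) B v"

lemma broadcast_root: "broadcast r B r = B r"
  by (simp add: broadcast_def)

lemma broadcast_parent: "v \<noteq> r \<Longrightarrow> broadcast r B v \<longleftrightarrow> B v \<and> \<not> broadcast r B (par r v)"
  by (simp add: broadcast_def dst_parent)

lemma pred_broadcast:
  "(\<And>v. Measurable.pred M (\<lambda>x. B x v)) \<Longrightarrow> Measurable.pred M (\<lambda>x. broadcast r (B x) v)"
proof (induction "dst r v" arbitrary: v rule: less_induct)
  case less
  note [measurable] = less.prems
  show ?case
  proof (cases "v = r")
    case False
    have [measurable]: "Measurable.pred M (\<lambda>x. broadcast r (B x) (par r v))"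
      using less dst_parent[OF False] by auto
    show ?thesis unfolding broadcast_parent[OF False] by measurable
  qed (simp add: broadcast_root)
qed

lemma measurable_broadcast: "broadcast r \<in> measurable (conf_space UNIV) (conf_space UNIV)"
  by (rule measurable_conf_spaceI) (auto intro: pred_broadcast)

definition bit_law :: "real \<Rightarrow> 'v \<Rightarrow> 'v \<Rightarrow> bool pmf" where
  "bit_law w r v = bernoulli_pmf (if v = r then w / (1 + 2 * w) else w / (1 + w))"

definition bits :: "real \<Rightarrow> 'v \<Rightarrow> ('v \<Rightarrow> bool) measure" where
  "bits w r = PiM UNIV (\<lambda>v. measure_pmf (bit_law w r v))"

definition hc_measure :: "real \<Rightarrow> 'v \<Rightarrow> ('v \<Rightarrow> bool) measure" where
  "hc_measure w r = distr (bits w r) (conf_space UNIV) (broadcast r)"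

lemma prob_space_bits: "prob_space (bits w r)"
  unfolding bits_def by (intro prob_space_PiM) (rule measure_pmf.prob_space_axioms)

lemma sets_bits: "sets (bits w r) = sets (conf_space UNIV)"
  unfolding bits_def conf_space_def by (rule sets_PiM_cong) simp_all

lemma conf_prob_bits: "conf_prob (bits w r)"
  by (simp add: conf_prob_def prob_space_bits sets_bits)

lemma conf_prob_hc_measure: "conf_prob (hc_measure w r)"
proof -
  have "broadcast r \<in> measurable (bits w r) (conf_space UNIV)"
    using measurable_broadcast by (simp add: conf_prob_measurable[OF conf_prob_bits])
  then show ?thesis
    unfolding conf_prob_def hc_measure_def by (simp add: prob_space.prob_space_distr[OF prob_space_bits])
qed

lemma hc_measure_event:
  assumes "A \<in> sets (conf_space UNIV)"
  shows "measure (hc_measure w r) A = measure (bits w r) {B. broadcast r B \<in> A}"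
  unfolding hc_measure_def using assms measurable_broadcast
  by (subst measure_distr) (auto simp: conf_prob_measurable[OF conf_prob_bits] conf_prob_space[OF conf_prob_bits] vimage_def)

lemma bits_box:
  assumes "finite T"
  shows "measure (bits w r) {B. \<forall>v\<in>T. B v \<in> S v} = (\<Prod>v\<in>T. measure (measure_pmf (bit_law w r v)) (S v))"
proof -
  interpret product_prob_space "\<lambda>v. measure_pmf (bit_law w r v)" UNIV by unfold_locales
  have "{B. \<forall>v\<in>T. B v \<in> S v} = prod_emb UNIV (\<lambda>v. measure_pmf (bit_law w r v)) T (Pi\<^sub>E T S)"
    by (auto simp: prod_emb_def PiE_UNIV_domain)
  then show ?thesis unfolding bits_def using measure_PiM_emb[of T S] assms by simp
qed

text \<open>Once the pattern on a subtree is prescribed, each site constrains its own bit alone, so the event is a box.\<close>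

lemma broadcast_atom:
  assumes T: "rooted r T"
  shows "broadcast r B \<in> atom T \<sigma> \<longleftrightarrow> (\<forall>v\<in>T. (B v \<and> (v = r \<or> \<not> \<sigma> (par r v))) = \<sigma> v)"
proof
  assume a: "broadcast r B \<in> atom T \<sigma>"
  show "\<forall>v\<in>T. (B v \<and> (v = r \<or> \<not> \<sigma> (par r v))) = \<sigma> v"
  proof
    fix v assume v: "v \<in> T"
    show "(B v \<and> (v = r \<or> \<not> \<sigma> (par r v))) = \<sigma> v"
    proof (cases "v = r")
      case True
      then show ?thesis using a v broadcast_root by (auto simp: atom_def)
    next
      case False
      then have "broadcast r B (par r v) = \<sigma> (par r v)" "broadcast r B v = \<sigma> v"
        using a T v by (auto simp: atom_def rooted_def)
      then show ?thesis using broadcast_parent[OF False, of B] False by auto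
    qed
  qed
next
  assume a: "\<forall>v\<in>T. (B v \<and> (v = r \<or> \<not> \<sigma> (par r v))) = \<sigma> v"
  have "broadcast r B v = \<sigma> v" if "v \<in> T" for v
    using that
  proof (induction "dst r v" arbitrary: v rule: less_induct)
    case less
    show ?case
    proof (cases "v = r")
      case True
      then show ?thesis using a less.prems broadcast_root by auto
    next
      case False
      then have "par r v \<in> T" using T less.prems by (auto simp: rooted_def)
      then have "broadcast r B (par r v) = \<sigma> (par r v)" using less.hyps dst_parent[OF False] by auto
      then show ?thesis using broadcast_parent[OF False, of B] a less.prems False by auto
    qed
  qed
  then show "broadcast r B \<in> atom T \<sigma>" by (simp add: atom_def)
qed

definition root_law :: "real \<Rightarrow> bool \<Rightarrow> real" where
  "root_law w b = (if b then w / (1 + 2 * w) else (1 + w) / (1 + 2 * w))"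

lemma hc_measure_atom:
  assumes w: "w > 0" and T: "rooted r T"
  shows "measure (hc_measure w r) (atom T \<sigma>) =
    root_law w (\<sigma> r) * (\<Prod>v\<in>T - {r}. hc_step (1 / (1 + w)) (\<sigma> (par r v)) (\<sigma> v))"
proof -
  have fin: "finite T" "r \<in> T" using T by (auto simp: rooted_def)
  let ?S = "\<lambda>v. {b. (b \<and> (v = r \<or> \<not> \<sigma> (par r v))) = \<sigma> v}"
  have "measure (hc_measure w r) (atom T \<sigma>) = measure (bits w r) {B. \<forall>v\<in>T. B v \<in> ?S v}"
    using hc_measure_event[OF sets_atom[OF fin(1)]] broadcast_atom[OF T] by simp
  also have "\<dots> = (\<Prod>v\<in>T. measure (measure_pmf (bit_law w r v)) (?S v))" by (rule bits_box[OF fin(1)])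
  also have "\<dots> = measure (measure_pmf (bit_law w r r)) (?S r) * (\<Prod>v\<in>T - {r}. measure (measure_pmf (bit_law w r v)) (?S v))"
    by (rule prod.remove[OF fin])
  also have "measure (measure_pmf (bit_law w r r)) (?S r) = root_law w (\<sigma> r)"
  proof -
    have "?S r = {\<sigma> r}" by auto
    then show ?thesis using w by (cases "\<sigma> r") (auto simp: measure_pmf_single bit_law_def root_law_def field_simps)
  qed
  also have "(\<Prod>v\<in>T - {r}. measure (measure_pmf (bit_law w r v)) (?S v)) =
      (\<Prod>v\<in>T - {r}. hc_step (1 / (1 + w)) (\<sigma> (par r v)) (\<sigma> v))"
  proof (rule prod.cong[OF refl])
    fix v assume v: "v \<in> T - {r}"
    show "measure (measure_pmf (bit_law w r v)) (?S v) = hc_step (1 / (1 + w)) (\<sigma> (par r v)) (\<sigma> v)"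
    proof (cases "\<sigma> (par r v)")
      case True
      then have "?S v = (if \<sigma> v then {} else UNIV)" using v by auto
      then show ?thesis using True by (simp add: hc_step_def)
    next
      case False
      then have "?S v = {\<sigma> v}" by auto
      then show ?thesis using w v False
        by (cases "\<sigma> v") (auto simp: measure_pmf_single bit_law_def hc_step_def field_simps)
    qed
  qed
  finally show ?thesis .
qed

text \<open>Moving the root along an edge changes only one factor of the product formula for atoms, and
by reversibility of the two-state chain with initial law \<open>root_law\<close> the product is unchanged.\<close>

lemma hc_measure_root_adj:
  assumes w: "w > 0" and a: "adj r r'"
  shows "hc_measure w r = hc_measure w r'"
proof (rule conf_prob_eqI[OF conf_prob_hc_measure conf_prob_hc_measure])
  have r: "r' \<noteq> r" using a adj_neq by blast
  have pr: "par r r' = r" "par r' r = r'"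
    using parentI[OF a, of r'] parentI[OF adj_sym[OF a], of r] br_self by blast+
  have same: "par r v = par r' v" if "v \<noteq> r" "v \<noteq> r'" for v
  proof -
    have "adj v (par r v)" "r \<in> br v (par r v)" using parent_props[OF that(1)] by blast+
    then show ?thesis using parentI[of v "par r v" r'] br_step[OF _ a] that by metis
  qed
  fix J :: "'v set" assume "finite J"
  then obtain T where T: "rooted r T" "insert r' J \<subseteq> T" using rooted_superset[of "insert r' J" r] by blast
  then have T': "rooted r' T" unfolding rooted_def by (metis insert_subset pr(2) same)
  have fin: "finite T" "r \<in> T" "r' \<in> T" using T by (auto simp: rooted_def)
  have "measure (hc_measure w r) (atom T \<sigma>) = measure (hc_measure w r') (atom T \<sigma>)" for \<sigma>
  proof -
    let ?h = "hc_step (1 / (1 + w))"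
    let ?D = "T - {r, r'}"
    have "(\<Prod>v\<in>T - {r}. ?h (\<sigma> (par r v)) (\<sigma> v)) = ?h (\<sigma> r) (\<sigma> r') * (\<Prod>v\<in>?D. ?h (\<sigma> (par r v)) (\<sigma> v))"
      using fin r by (subst prod.remove[of _ r']) (auto simp: pr insert_commute Diff_insert2[symmetric] intro!: arg_cong2[where f="(*)"] prod.cong)
    moreover have "(\<Prod>v\<in>T - {r'}. ?h (\<sigma> (par r' v)) (\<sigma> v)) = ?h (\<sigma> r') (\<sigma> r) * (\<Prod>v\<in>?D. ?h (\<sigma> (par r' v)) (\<sigma> v))"
      using fin r by (subst prod.remove[of _ r]) (auto simp: pr Diff_insert2[symmetric] intro!: arg_cong2[where f="(*)"] prod.cong)
    moreover have "(\<Prod>v\<in>?D. ?h (\<sigma> (par r v)) (\<sigma> v)) = (\<Prod>v\<in>?D. ?h (\<sigma> (par r' v)) (\<sigma> v))"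
      by (rule prod.cong) (auto simp: same)
    moreover have "root_law w (\<sigma> r) * ?h (\<sigma> r) (\<sigma> r') = root_law w (\<sigma> r') * ?h (\<sigma> r') (\<sigma> r)"
    proof -
      have "1 - 1 / (1 + w) = w / (1 + w)" using w by (simp add: field_simps)
      then show ?thesis using w by (cases "\<sigma> r"; cases "\<sigma> r'") (auto simp: root_law_def hc_step_def)
    qed
    ultimately show ?thesis
      unfolding hc_measure_atom[OF w T(1)] hc_measure_atom[OF w T'] by (simp add: mult.assoc[symmetric])
  qed
  then show "\<exists>T. finite T \<and> J \<subseteq> T \<and> (\<forall>\<sigma>. measure (hc_measure w r) (atom T \<sigma>) = measure (hc_measure w r') (atom T \<sigma>))"
    using fin T by blast
qed

lemma hc_measure_root: assumes w: "w > 0" shows "hc_measure w r = hc_measure w r'"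
  using adj_connected[of r r'] by (induction rule: rtranclp_induct) (auto dest: hc_measure_root_adj[OF w])

text \<open>An automorphism carries the process rooted at one site to the process rooted at its image, and the law does not
depend on the root.\<close>

lemma hc_measure_invariant:
  assumes w: "w > 0" shows "invariant_measure adj (hc_measure w r)"
  unfolding invariant_measure_def
proof (intro allI impI)
  fix g assume g: "automorphism adj g"
  have bij: "bij g" and inj: "inj g" using g by (auto simp: automorphism_def bij_def)
  let ?f = "\<lambda>\<phi>. \<phi> \<circ> g"
  have cp: "conf_prob (hc_measure w s)" for s by (rule conf_prob_hc_measure)
  have m: "?f \<in> measurable (conf_space UNIV) (conf_space UNIV)"
    by (rule measurable_conf_spaceI) (auto simp: o_def)
  then have m': "?f \<in> measurable (hc_measure w r) (conf_space UNIV)" by (simp add: conf_prob_measurable[OF cp])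
  have cp': "conf_prob (distr (hc_measure w r) (conf_space UNIV) ?f)"
    unfolding conf_prob_def by (simp add: prob_space.prob_space_distr[OF conf_prob_prob_space[OF cp] m'])
  show "distr (hc_measure w r) (conf_space UNIV) ?f = hc_measure w r"
  proof (rule conf_prob_eqI[OF cp' cp])
    fix J :: "'v set" assume "finite J"
    then obtain T where T: "rooted r T" "J \<subseteq> T" using rooted_superset by blast
    have fin: "finite T" "r \<in> T" using T by (auto simp: rooted_def)
    have gT: "rooted (g r) (g ` T)"
      using T automorphism_parent[OF g] unfolding rooted_def by (auto simp: inj_eq[OF inj])
    have "measure (distr (hc_measure w r) (conf_space UNIV) ?f) (atom T \<sigma>) = measure (hc_measure w r) (atom T \<sigma>)" for \<sigma>
    proof -
      let ?s = "\<sigma> \<circ> inv g"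
      let ?h = "hc_step (1 / (1 + w))"
      have sg: "?s (g v) = \<sigma> v" for v by (simp add: inv_f_f[OF inj])
      have "measure (distr (hc_measure w r) (conf_space UNIV) ?f) (atom T \<sigma>) =
          measure (hc_measure w r) (?f -` atom T \<sigma> \<inter> space (hc_measure w r))"
        by (rule measure_distr[OF m' sets_atom[OF fin(1)]])
      also have "?f -` atom T \<sigma> \<inter> space (hc_measure w r) = atom (g ` T) ?s"
        by (auto simp: conf_prob_space[OF cp] atom_def inv_f_f[OF inj])
      also have "measure (hc_measure w r) (atom (g ` T) ?s) = measure (hc_measure w (g r)) (atom (g ` T) ?s)"
        using hc_measure_root[OF w] by metis
      also have "\<dots> = root_law w (?s (g r)) * (\<Prod>v\<in>g ` T - {g r}. ?h (?s (par (g r) v)) (?s v))"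
        by (rule hc_measure_atom[OF w gT])
      also have "g ` T - {g r} = g ` (T - {r})" by (auto simp: inj_eq[OF inj])
      also have "(\<Prod>v\<in>g ` (T - {r}). ?h (?s (par (g r) v)) (?s v)) = (\<Prod>v\<in>T - {r}. ?h (\<sigma> (par r v)) (\<sigma> v))"
        by (subst prod.reindex[OF inj_on_subset[OF inj subset_UNIV]])
           (auto intro!: prod.cong simp: automorphism_parent[OF g] inv_f_f[OF inj])
      finally show ?thesis unfolding hc_measure_atom[OF w T(1)] by (simp only: sg)
    qed
    then show "\<exists>T. finite T \<and> J \<subseteq> T \<and>
      (\<forall>\<sigma>. measure (distr (hc_measure w r) (conf_space UNIV) ?f) (atom T \<sigma>) = measure (hc_measure w r) (atom T \<sigma>))"
      using fin T by blast
  qed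
qed

lemma bits_indep:
  assumes "disjoint_family_on K L"
  shows "prob_space.indep_vars (bits w r) (\<lambda>j. conf_space (K j)) (\<lambda>j B. restrict B (K j)) L"
proof -
  interpret prob_space "bits w r" by (rule prob_space_bits)
  have "indep_vars (\<lambda>v. measure_pmf (bit_law w r v)) (\<lambda>v B. B v) UNIV"
  proof (subst indep_vars_iff_distr_eq_PiM)
    have c: "distr (bits w r) (measure_pmf (bit_law w r v)) (\<lambda>B. B v) = measure_pmf (bit_law w r v)" for v
      unfolding bits_def by (rule distr_PiM_component) (auto intro: measure_pmf.prob_space_axioms)
    show "random_variable (measure_pmf (bit_law w r i)) (\<lambda>B. B i)" for i
      unfolding bits_def by (rule measurable_component_singleton) simp
    have "distr (bits w r) (PiM UNIV (\<lambda>v. measure_pmf (bit_law w r v))) (\<lambda>x. x) = bits w r"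
      by (rule distr_id2) (simp add: bits_def)
    then show "distr (bits w r) (PiM UNIV (\<lambda>v. measure_pmf (bit_law w r v))) (\<lambda>x. \<lambda>i\<in>UNIV. x i) =
        PiM UNIV (\<lambda>v. distr (bits w r) (measure_pmf (bit_law w r v)) (\<lambda>B. B v))"
      unfolding c by (simp add: bits_def restrict_UNIV)
  qed auto
  then have "indep_vars (\<lambda>_. count_space UNIV) (\<lambda>v B. B v) UNIV"
    unfolding indep_vars_def2 by (simp add: measurable_pmf_measure2)
  from indep_vars_restrict[OF this _ assms] show ?thesis
    by (simp add: conf_space_def)
qed

lemma bits_indep_events:
  assumes L: "finite L" "disjoint_family_on K L"
    and P: "\<And>j. j \<in> L \<Longrightarrow> Measurable.pred (conf_space UNIV) (P j)" "\<And>j. j \<in> L \<Longrightarrow> depends_on (K j) (P j)"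
  shows "measure (bits w r) {B. \<forall>j\<in>L. P j B} = (\<Prod>j\<in>L. measure (bits w r) {B. P j B})"
proof (cases "L = {}")
  case True
  interpret prob_space "bits w r" by (rule prob_space_bits)
  show ?thesis using True prob_space by (simp add: conf_prob_space[OF conf_prob_bits])
next
  case False
  interpret prob_space "bits w r" by (rule prob_space_bits)
  let ?e = "\<lambda>j (\<beta> :: 'v \<Rightarrow> bool) v. if v \<in> K j then \<beta> v else False"
  let ?A = "\<lambda>j. {\<beta> \<in> space (conf_space (K j)). P j (?e j \<beta>)}"
  have eq: "(\<lambda>B. restrict B (K j)) -` ?A j \<inter> space (bits w r) = {B. P j B}" if "j \<in> L" for j
    using depends_on_factor[OF P(2)[OF that], of _ "\<lambda>_. False"]
    by (auto simp: conf_prob_space[OF conf_prob_bits] space_conf_space)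
  have "prob (\<Inter>j\<in>L. (\<lambda>B. restrict B (K j)) -` ?A j \<inter> space (bits w r)) =
      (\<Prod>j\<in>L. prob ((\<lambda>B. restrict B (K j)) -` ?A j \<inter> space (bits w r)))"
  proof (rule indep_varsD_finite[OF bits_indep[OF L(2)] False L(1)])
    fix j assume j: "j \<in> L"
    have "Measurable.pred (conf_space (K j)) (\<lambda>\<beta>. P j (?e j \<beta>))"
      by (rule measurable_compose[OF measurable_extend_conf P(1)[OF j]])
    then show "?A j \<in> sets (conf_space (K j))" by (simp add: pred_def)
  qed
  moreover have "(\<Inter>j\<in>L. (\<lambda>B. restrict B (K j)) -` ?A j \<inter> space (bits w r)) = {B. \<forall>j\<in>L. P j B}"
    using eq False by auto
  moreover have "(\<Prod>j\<in>L. prob ((\<lambda>B. restrict B (K j)) -` ?A j \<inter> space (bits w r))) = (\<Prod>j\<in>L. prob {B. P j B})"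
    using eq by (intro prod.cong) auto
  ultimately show ?thesis by simp
qed

text \<open>The dynamics inside a branch at the root sees the outside only through the state of the root.\<close>

lemma broadcast_branch:
  assumes "adj u y" "v \<in> br u y"
  shows "broadcast u B v = broadcast u (\<lambda>v. if v \<in> br u y then B v else B u) v"
  using assms(2)
proof (induction "dst u v" arbitrary: v rule: less_induct)
  case less
  have uC: "u \<notin> br u y" using br_not_self adj_neq[OF assms(1)] by blast
  then have vu: "v \<noteq> u" using less.prems by blast
  show ?case
  proof (cases "par u v = u")
    case True
    then show ?thesis using uC less.prems by (simp add: broadcast_parent[OF vu] broadcast_root)
  next
    case False
    then have "par u v \<in> br u y" using br_step[OF less.prems] parent_props(1)[OF vu] vu by blast
    then show ?thesis using less dst_parent[OF vu] by (simp add: broadcast_parent[OF vu])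
  qed
qed

text \<open>By root independence, \<open>u\<close> may be taken as the root. Given its state, the configuration on each branch
is a function of the bits of that branch.\<close>

lemma hc_measure_simple: assumes w: "w > 0" shows "simple_measure adj (hc_measure w r)"
  unfolding simple_measure_def components_without_eq
proof (intro allI impI)
  fix u :: 'v and b :: bool
  let ?\<nu> = "hc_measure w u" and ?B = "bits w u" and ?comps = "br u ` nb u"
  let ?S = "{\<phi>. \<phi> u = b}"
  assume "0 < measure (hc_measure w r) ?S"
  then have pos: "measure ?\<nu> ?S > 0" using hc_measure_root[OF w] by metis
  have cp: "conf_prob ?\<nu>" by (rule conf_prob_hc_measure)
  interpret N: prob_space ?\<nu> using cp by (rule conf_prob_prob_space)
  interpret B: prob_space ?B by (rule prob_space_bits)
  let ?U = "uniform_measure ?\<nu> ?S"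
  interpret U: prob_space ?U
    using pos by (intro prob_space_uniform_measure) (auto simp: N.emeasure_eq_measure)
  have setsU: "sets ?U = sets (conf_space UNIV)" by (simp add: conf_prob_sets[OF cp])
  have cpU: "conf_prob ?U" using U.prob_space_axioms setsU by (simp add: conf_prob_def)
  have mS: "?S \<in> sets (conf_space UNIV)"
    using conf_event[OF cp, of "\<lambda>\<phi>. \<phi> u = b"] by (simp add: conf_prob_sets[OF cp])
  define Q where "Q C X B \<longleftrightarrow> restrict (broadcast u (\<lambda>v. if v \<in> C then B v else b)) C \<in> X" for C X B
  have mQ: "Measurable.pred (conf_space UNIV) (Q C X)" if "X \<in> sets (conf_space C)" for C X
  proof -
    have 1: "(\<lambda>B v. if v \<in> C then B v else b) \<in> measurable (conf_space UNIV) (conf_space UNIV)"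
      by (rule measurable_conf_spaceI) (auto)
    have 2: "Measurable.pred (conf_space C) (\<lambda>\<beta>. \<beta> \<in> X)" using that by measurable
    show ?thesis unfolding Q_def
      by (rule measurable_compose[OF measurable_compose[OF measurable_compose[OF 1 measurable_broadcast] measurable_restrict_conf] 2])
  qed
  have dQ: "depends_on C (Q C X)" for C X
  proof -
    have eq: "(\<lambda>v. if v \<in> C then \<phi> v else b) = (\<lambda>v. if v \<in> C then \<psi> v else b)" if "\<forall>v\<in>C. \<phi> v = \<psi> v" for \<phi> \<psi> :: "'v \<Rightarrow> bool"
      using that by auto
    show ?thesis unfolding depends_on_def Q_def by (intro allI impI) (simp only: eq)
  qed
  have uC: "u \<notin> C" if "C \<in> ?comps" for C using that br_not_self adj_neq by force
  have joint: "measure ?\<nu> (?S \<inter> {\<phi>. \<forall>C\<in>J. restrict \<phi> C \<in> X C}) =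
      measure ?B {B. B u = b} * (\<Prod>C\<in>J. measure ?B {B. Q C (X C) B})"
    if J: "finite J" "J \<subseteq> ?comps" and X: "\<And>C. C \<in> J \<Longrightarrow> X C \<in> sets (conf_space C)" for J X
  proof -
    have "Measurable.pred (conf_space UNIV) (\<lambda>\<phi>. \<phi> u = b \<and> (\<forall>C\<in>J. restrict \<phi> C \<in> X C))"
    proof (intro pred_intros_logic(3) pred_intros_finite(3) J(1))
      show "Measurable.pred (conf_space UNIV) (\<lambda>\<phi>. \<phi> u = b)" by measurable
      fix C assume "C \<in> J"
      then have "Measurable.pred (conf_space C) (\<lambda>\<beta>. \<beta> \<in> X C)" using X by measurable
      then show "Measurable.pred (conf_space UNIV) (\<lambda>\<phi>. restrict \<phi> C \<in> X C)"
        by (rule measurable_compose[OF measurable_restrict_conf])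
    qed
    then have m: "{\<phi>. \<phi> u = b \<and> (\<forall>C\<in>J. restrict \<phi> C \<in> X C)} \<in> sets (conf_space UNIV)" by (simp add: pred_def)
    have ev: "broadcast u B u = b \<and> (\<forall>C\<in>J. restrict (broadcast u B) C \<in> X C) \<longleftrightarrow>
        (\<forall>C\<in>insert {u} J. (if C = {u} then B u = b else Q C (X C) B))" for B
    proof -
      have "restrict (broadcast u B) C = restrict (broadcast u (\<lambda>v. if v \<in> C then B v else b)) C"
        if bu: "B u = b" and CJ: "C \<in> J" for C
      proof -
        obtain y where y: "adj u y" "C = br u y" using CJ J(2) by auto
        have "broadcast u B v = broadcast u (\<lambda>v. if v \<in> C then B v else b) v" if "v \<in> C" for v
          using broadcast_branch[OF y(1), of v B] that unfolding y(2) bu .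
        then show ?thesis by (simp add: restrict_def fun_eq_iff)
      qed
      then have Q': "restrict (broadcast u B) C \<in> X C \<longleftrightarrow> Q C (X C) B" if "B u = b" "C \<in> J" for C
        using that by (simp only: Q_def)
      have nC: "C \<noteq> {u}" if "C \<in> J" for C using that J(2) uC by blast
      show ?thesis by (cases "B u = b") (simp_all add: Q' nC broadcast_root)
    qed
    have uJ: "{u} \<notin> J" using J(2) uC by blast
    have "measure ?\<nu> (?S \<inter> {\<phi>. \<forall>C\<in>J. restrict \<phi> C \<in> X C}) =
        measure ?B {B. \<forall>C\<in>insert {u} J. (if C = {u} then B u = b else Q C (X C) B)}"
      using hc_measure_event[OF m, of w u] ev by (simp add: Int_def)
    also have "\<dots> = (\<Prod>C\<in>insert {u} J. measure ?B {B. if C = {u} then B u = b else Q C (X C) B})"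
    proof (rule bits_indep_events)
      show "finite (insert {u} J)" using J by simp
      show "disjoint_family_on (\<lambda>C. C) (insert {u} J)"
        unfolding disjoint_family_on_def
      proof (intro ballI impI)
        have JJ: "C \<inter> D = {}" if CD: "C \<in> J" "D \<in> J" "C \<noteq> D" for C D
        proof -
          obtain y where y: "adj u y" "C = br u y" using CD(1) J(2) by auto
          obtain z where z: "adj u z" "D = br u z" using CD(2) J(2) by auto
          show ?thesis using br_disjoint[OF y(1) z(1)] CD(3) y(2) z(2) by auto
        qed
        have uJ': "u \<notin> C" if "C \<in> J" for C using that J(2) uC by blast
        fix C D assume "C \<in> insert {u} J" "D \<in> insert {u} J" "C \<noteq> D"
        then show "C \<inter> D = {}" using JJ[of C D] uJ'[of C] uJ'[of D] by auto
      qed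
      fix C assume C: "C \<in> insert {u} J"
      have "Measurable.pred (conf_space UNIV) (\<lambda>B. if C = {u} then B u = b else Q C (X C) B) \<and>
        depends_on C (\<lambda>B. if C = {u} then B u = b else Q C (X C) B)"
      proof (cases "C = {u}")
        case False
        then have "C \<in> J" using C by simp
        then show ?thesis unfolding if_not_P[OF False] using mQ[OF X] dQ by blast
      qed (simp add: depends_on_def)
      then show "Measurable.pred (conf_space UNIV) (\<lambda>B. if C = {u} then B u = b else Q C (X C) B)"
        and "depends_on C (\<lambda>B. if C = {u} then B u = b else Q C (X C) B)"
        by blast+
    qed
    also have "\<dots> = measure ?B {B. B u = b} * (\<Prod>C\<in>J. measure ?B {B. Q C (X C) B})"
    proof (subst prod.insert[OF J(1) uJ], intro arg_cong2[where f = "(*)"] prod.cong refl)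
      fix C assume "C \<in> J"
      then have "C \<noteq> {u}" using uJ by blast
      then show "measure ?B {B. if C = {u} then B u = b else Q C (X C) B} = measure ?B {B. Q C (X C) B}" by simp
    qed simp
    finally show ?thesis .
  qed
  have S: "measure ?\<nu> ?S = measure ?B {B. B u = b}" using joint[of "{}"] by simp
  have U: "measure ?U {\<phi>. \<forall>C\<in>J. restrict \<phi> C \<in> X C} = (\<Prod>C\<in>J. measure ?B {B. Q C (X C) B})"
    if J: "finite J" "J \<subseteq> ?comps" and X: "\<And>C. C \<in> J \<Longrightarrow> X C \<in> sets (conf_space C)" for J X
  proof -
    have m: "{\<phi>. \<forall>C\<in>J. restrict \<phi> C \<in> X C} \<in> sets ?\<nu>"
    proof (rule conf_event[OF cp], intro pred_intros_finite(3) J(1))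
      fix C assume "C \<in> J"
      then have "Measurable.pred (conf_space C) (\<lambda>\<beta>. \<beta> \<in> X C)" using X by measurable
      then show "Measurable.pred (conf_space UNIV) (\<lambda>\<phi>. restrict \<phi> C \<in> X C)"
        by (rule measurable_compose[OF measurable_restrict_conf])
    qed
    have "measure ?U {\<phi>. \<forall>C\<in>J. restrict \<phi> C \<in> X C} =
        measure ?\<nu> (?S \<inter> {\<phi>. \<forall>C\<in>J. restrict \<phi> C \<in> X C}) / measure ?\<nu> ?S"
      using pos m mS by (intro measure_uniform_measure) (auto simp: N.emeasure_eq_measure conf_prob_sets[OF cp])
    then show ?thesis using joint[OF J X] pos S by simp
  qed
  have "U.indep_vars conf_space (\<lambda>C \<phi>. restrict \<phi> C) ?comps"
    unfolding U.indep_vars_def2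
  proof (intro conjI ballI U.indep_setsI)
    have rv: "(\<lambda>\<phi>. restrict \<phi> C) \<in> measurable ?U (conf_space C)" for C
      using measurable_restrict_conf by (simp only: conf_prob_measurable[OF cpU])
    show "(\<lambda>\<phi>. restrict \<phi> C) \<in> measurable ?U (conf_space C)" for C by (rule rv)
    show "{(\<lambda>\<phi>. restrict \<phi> C) -` A \<inter> space ?U |A. A \<in> sets (conf_space C)} \<subseteq> sets ?U" for C
      using measurable_sets[OF rv] by blast
    fix A J assume J: "J \<noteq> {}" "J \<subseteq> ?comps" "finite J"
      and A: "\<forall>C\<in>J. A C \<in> {(\<lambda>\<phi>. restrict \<phi> C) -` A \<inter> space ?U |A. A \<in> sets (conf_space C)}"
    have "\<forall>C\<in>J. \<exists>X. X \<in> sets (conf_space C) \<and> A C = {\<phi>. restrict \<phi> C \<in> X}"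
    proof
      fix C assume "C \<in> J"
      then obtain X where "X \<in> sets (conf_space C)" "A C = (\<lambda>\<phi>. restrict \<phi> C) -` X \<inter> space ?U" using A by blast
      then show "\<exists>X. X \<in> sets (conf_space C) \<and> A C = {\<phi>. restrict \<phi> C \<in> X}"
        by (intro exI[of _ X]) (simp add: conf_prob_space[OF cp] vimage_def)
    qed
    then obtain X where X: "\<And>C. C \<in> J \<Longrightarrow> X C \<in> sets (conf_space C)" "\<And>C. C \<in> J \<Longrightarrow> A C = {\<phi>. restrict \<phi> C \<in> X C}"
      by metis
    have "(\<Inter>C\<in>J. A C) = {\<phi>. \<forall>C\<in>J. restrict \<phi> C \<in> X C}" using X(2) by auto
    then have "U.prob (\<Inter>C\<in>J. A C) = (\<Prod>C\<in>J. measure ?B {B. Q C (X C) B})" using U[OF J(3,2) X(1)] by simp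
    also have "\<dots> = (\<Prod>C\<in>J. U.prob (A C))"
    proof (rule prod.cong[OF refl])
      fix C assume C: "C \<in> J"
      then have "{C} \<subseteq> ?comps" using J(2) by blast
      then show "measure ?B {B. Q C (X C) B} = U.prob (A C)" using U[of "{C}" X] X C by simp
    qed
    finally show "U.prob (\<Inter>C\<in>J. A C) = (\<Prod>C\<in>J. U.prob (A C))" .
  qed
  then show "prob_space.indep_vars (uniform_measure (hc_measure w r) ?S) conf_space (\<lambda>C \<phi>. restrict \<phi> C) ?comps"
    using hc_measure_root[OF w, of r u] by simp
qed

lemma bits_marginal:
  assumes "w > 0"
  shows "measure (bits w r) {B. B r} = w / (1 + 2 * w)" "measure (bits w r) {B. \<not> B r} = (1 + w) / (1 + 2 * w)"
    "finite T \<Longrightarrow> r \<notin> T \<Longrightarrow> measure (bits w r) {B. \<forall>v\<in>T. \<not> B v} = (1 / (1 + w)) ^ card T"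
proof -
  have b: "measure (measure_pmf (bit_law w r v)) {True} = (if v = r then w / (1 + 2 * w) else w / (1 + w))"
    "measure (measure_pmf (bit_law w r v)) {False} = (if v = r then (1 + w) / (1 + 2 * w) else 1 / (1 + w))" for v
  proof -
    have "1 - w / (1 + 2 * w) = (1 + w) / (1 + 2 * w)" "1 - w / (1 + w) = 1 / (1 + w)"
      "0 \<le> w / (1 + 2 * w)" "w / (1 + 2 * w) \<le> 1" "0 \<le> w / (1 + w)" "w / (1 + w) \<le> 1"
      using assms by (auto simp: divide_simps)
    then show "measure (measure_pmf (bit_law w r v)) {True} = (if v = r then w / (1 + 2 * w) else w / (1 + w))"
      "measure (measure_pmf (bit_law w r v)) {False} = (if v = r then (1 + w) / (1 + 2 * w) else 1 / (1 + w))"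
      by (auto simp: measure_pmf_single bit_law_def)
  qed
  show "measure (bits w r) {B. B r} = w / (1 + 2 * w)" using bits_box[of "{r}" w r "\<lambda>_. {True}"] b by simp
  show "measure (bits w r) {B. \<not> B r} = (1 + w) / (1 + 2 * w)" using bits_box[of "{r}" w r "\<lambda>_. {False}"] b by simp
  assume T: "finite T" "r \<notin> T"
  have "measure (bits w r) {B. \<forall>v\<in>T. \<not> B v} = (\<Prod>v\<in>T. measure (measure_pmf (bit_law w r v)) {False})"
    using bits_box[OF T(1), of w r "\<lambda>_. {False}"] by simp
  also have "\<dots> = (\<Prod>v\<in>T. 1 / (1 + w))" using T(2) by (intro prod.cong) (auto simp: b)
  finally show "measure (bits w r) {B. \<forall>v\<in>T. \<not> B v} = (1 / (1 + w)) ^ card T" by simp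
qed

lemma hc_measure_edge:
  assumes w: "w > 0" and a: "adj x y" shows "AE \<phi> in hc_measure w r. \<not> (\<phi> x \<and> \<phi> y)"
proof -
  have cp: "conf_prob (hc_measure w x)" by (rule conf_prob_hc_measure)
  interpret prob_space "hc_measure w x" using cp by (rule conf_prob_prob_space)
  have py: "y \<noteq> x" "par x y = x" using adj_neq[OF a] parentI[OF adj_sym[OF a] br_self] by auto
  have e: "{\<phi>. \<phi> x \<and> \<phi> y} \<in> sets (hc_measure w x)" by (rule conf_event[OF cp]) measurable
  then have "measure (hc_measure w x) {\<phi>. \<phi> x \<and> \<phi> y} = measure (bits w x) {B. broadcast x B x \<and> broadcast x B y}"
    using hc_measure_event[of "{\<phi>. \<phi> x \<and> \<phi> y}" w x] by (simp add: conf_prob_sets[OF cp])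
  also have "{B. broadcast x B x \<and> broadcast x B y} = {}" using py broadcast_parent[OF py(1)] by auto
  finally have "AE \<phi> in hc_measure w x. \<not> (\<phi> x \<and> \<phi> y)"
    using e by (subst AE_iff_measurable[where N = "{\<phi>. \<phi> x \<and> \<phi> y}"]) (auto simp: emeasure_eq_measure conf_prob_space[OF cp])
  then show ?thesis by (subst hc_measure_root[OF w, of r x])
qed

text \<open>Take \<open>u\<close> as the root. If it is occupied, the bits of its neighbours are ignored; if it and its neighbours are
vacant, these bits are unset. In both cases the configuration off \<open>u\<close> is the same function \<open>Z\<close> of the
remaining bits, so the two probabilities differ only by the weights of the bits at \<open>u\<close> and its neighbours.\<close>

lemma hc_measure_gibbs:
  assumes w: "w > 0" "w * (1 + w) ^ k = lam"
  shows "gibbs adj lam (hc_measure w r)"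
proof (rule gibbsI[OF conf_prob_hc_measure _ hc_measure_edge[OF w(1)]])
  show lam: "lam > 0" using w by (metis add_pos_pos mult_pos_pos zero_less_one zero_less_power)
  fix u :: 'v and A assume A: "A \<in> sets (sigma_off u)"
  let ?\<nu> = "hc_measure w u" and ?B = "bits w u"
  have cp: "conf_prob ?\<nu>" by (rule conf_prob_hc_measure)
  have A': "A \<in> sets (conf_space UNIV)"
    using A subalgebra_sigma_off[OF cp, of u] by (auto simp: subalgebra_def conf_prob_sets[OF cp])
  have dA: "\<phi> \<in> A \<longleftrightarrow> \<psi> \<in> A" if "\<And>v. v \<noteq> u \<Longrightarrow> \<phi> v = \<psi> v" for \<phi> \<psi>
    using depends_onD[OF sigma_off_depends[OF A], of \<phi> \<psi>] that by simp
  let ?V = "\<lambda>\<phi>. \<forall>v\<in>nb u. \<not> \<phi> v"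
  define R where "R = - insert u (nb u)"
  define Z where "Z B = broadcast u (\<lambda>v. if v \<in> R then B v else v = u)" for B
  have nbp: "par u v = u \<and> v \<noteq> u" if "adj u v" for v
    using adj_neq[OF that] parentI[OF adj_sym[OF that] br_self] by auto
  have Z: "broadcast u B v = Z B v" if "v \<noteq> u" "B u \<or> ?V B" for B v
    using that(1)
  proof (induction "dst u v" arbitrary: v rule: less_induct)
    case less
    show ?case
    proof (cases "adj u v")
      case True
      then show ?thesis using nbp that(2) by (auto simp: Z_def broadcast_parent broadcast_root R_def)
    next
      case False
      then have "par u v \<noteq> u" using parent_props(1)[OF less.prems] adj_sym by metis
      then have "broadcast u B (par u v) = Z B (par u v)" using less.hyps dst_parent[OF less.prems] by simp
      then show ?thesis using less.prems False by (simp add: Z_def broadcast_parent[OF less.prems] R_def)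
    qed
  qed
  have VB: "?V (broadcast u B) \<longleftrightarrow> ?V B" if "\<not> B u" for B
    using nbp that broadcast_parent[of _ u B] by (auto simp: broadcast_root)
  have mZ: "Measurable.pred (conf_space UNIV) (\<lambda>B. Z B \<in> A)"
  proof -
    have 1: "(\<lambda>B v. if v \<in> R then B v else v = u) \<in> measurable (conf_space UNIV) (conf_space UNIV)"
      by (rule measurable_conf_spaceI) auto
    have 2: "Measurable.pred (conf_space UNIV) (\<lambda>\<phi>. \<phi> \<in> A)" using A' by measurable
    show ?thesis unfolding Z_def by (rule measurable_compose[OF measurable_compose[OF 1 measurable_broadcast] 2])
  qed
  have dZ: "depends_on R (\<lambda>B. Z B \<in> A)"
  proof -
    have eq: "(\<lambda>v. if v \<in> R then \<phi> v else v = u) = (\<lambda>v. if v \<in> R then \<psi> v else v = u)" if "\<forall>v\<in>R. \<phi> v = \<psi> v" for \<phi> \<psi> :: "'v \<Rightarrow> bool"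
      using that by auto
    show ?thesis unfolding depends_on_def Z_def by (intro allI impI) (simp only: eq)
  qed
  define K :: "nat \<Rightarrow> 'v set" where "K j = (if j = 0 then {u} else if j = 1 then nb u else R)" for j
  have disj: "disjoint_family_on K L" if "L \<subseteq> {0, 1, 2}" for L
    using that adj_irrefl[of u] by (auto simp: disjoint_family_on_def K_def R_def)
  note [measurable] = mZ pred_vacant_nbrs
  have "{\<phi>. \<phi> \<in> A \<and> \<phi> u} \<in> sets (conf_space UNIV)" "{\<phi>. \<phi> \<in> A \<and> \<not> \<phi> u \<and> ?V \<phi>} \<in> sets (conf_space UNIV)"
  proof -
    have [measurable]: "Measurable.pred (conf_space UNIV) (\<lambda>\<phi>. \<phi> \<in> A)" using A' by measurable
    have "Measurable.pred (conf_space UNIV) (\<lambda>\<phi>. \<phi> \<in> A \<and> \<phi> u)" by measurable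
    then show "{\<phi>. \<phi> \<in> A \<and> \<phi> u} \<in> sets (conf_space UNIV)" by (simp add: pred_def)
    have "Measurable.pred (conf_space UNIV) (\<lambda>\<phi>. \<phi> \<in> A \<and> \<not> \<phi> u \<and> ?V \<phi>)" by measurable
    then show "{\<phi>. \<phi> \<in> A \<and> \<not> \<phi> u \<and> ?V \<phi>} \<in> sets (conf_space UNIV)" by (simp add: pred_def)
  qed
  note ev = this[THEN hc_measure_event]
  have "measure ?\<nu> (A \<inter> {\<phi>. \<phi> u}) = measure ?B {B. \<forall>j\<in>{0, 2::nat}. (if j = 0 then B u else Z B \<in> A)}"
  proof -
    have "broadcast u B \<in> A \<and> broadcast u B u \<longleftrightarrow> B u \<and> Z B \<in> A" for B
      using dA[of "broadcast u B" "Z B"] Z[of _ B] by (auto simp: broadcast_root)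
    then show ?thesis using ev(1)[of w u] by (simp add: Int_def)
  qed
  also have "\<dots> = (\<Prod>j\<in>{0, 2::nat}. measure ?B {B. if j = 0 then B u else Z B \<in> A})"
  proof (rule bits_indep_events[OF _ disj])
    fix j :: nat assume "j \<in> {0, 2}"
    then show "Measurable.pred (conf_space UNIV) (\<lambda>B. if j = 0 then B u else Z B \<in> A)"
      "depends_on (K j) (\<lambda>B. if j = 0 then B u else Z B \<in> A)"
      using dZ by (auto simp: K_def depends_on_def)
  qed auto
  also have "\<dots> = w / (1 + 2 * w) * measure ?B {B. Z B \<in> A}" using bits_marginal(1)[OF w(1)] by simp
  finally have 1: "measure ?\<nu> (A \<inter> {\<phi>. \<phi> u}) = w / (1 + 2 * w) * measure ?B {B. Z B \<in> A}" .
  have "measure ?\<nu> (A \<inter> {\<phi>. \<not> \<phi> u \<and> ?V \<phi>}) =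
      measure ?B {B. \<forall>j\<in>{0, 1, 2::nat}. (if j = 0 then \<not> B u else if j = 1 then ?V B else Z B \<in> A)}"
  proof -
    have "broadcast u B \<in> A \<and> \<not> broadcast u B u \<and> ?V (broadcast u B) \<longleftrightarrow> \<not> B u \<and> ?V B \<and> Z B \<in> A" for B
      using dA[of "broadcast u B" "Z B"] Z[of _ B] VB[of B] by (auto simp: broadcast_root)
    then show ?thesis using ev(2)[of w u] by (simp add: Int_def)
  qed
  also have "\<dots> = (\<Prod>j\<in>{0, 1, 2::nat}. measure ?B {B. if j = 0 then \<not> B u else if j = 1 then ?V B else Z B \<in> A})"
  proof (rule bits_indep_events[OF _ disj])
    fix j :: nat assume "j \<in> {0, 1, 2}"
    then show "Measurable.pred (conf_space UNIV) (\<lambda>B. if j = 0 then \<not> B u else if j = 1 then ?V B else Z B \<in> A)"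
      "depends_on (K j) (\<lambda>B. if j = 0 then \<not> B u else if j = 1 then ?V B else Z B \<in> A)"
      using dZ by (auto simp: K_def depends_on_def)
  qed auto
  also have "\<dots> = (1 + w) / (1 + 2 * w) * (1 / (1 + w)) ^ (k + 1) * measure ?B {B. Z B \<in> A}"
    using bits_marginal(2)[OF w(1)] bits_marginal(3)[OF w(1) finite_nb[of u], of u] adj_irrefl card_nb[of u] by simp
  finally have 2: "measure ?\<nu> (A \<inter> {\<phi>. \<not> \<phi> u \<and> ?V \<phi>}) =
      (1 + w) / (1 + 2 * w) * (1 / (1 + w)) ^ (k + 1) * measure ?B {B. Z B \<in> A}" .
  have "w = lam * (1 + w) * (1 / (1 + w)) ^ (k + 1)"
  proof -
    have "(1 + w) * (1 / (1 + w)) ^ (k + 1) = 1 / (1 + w) ^ k" using w(1) by (simp add: power_divide)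
    then show ?thesis using w by (simp add: w(2)[symmetric] mult.assoc)
  qed
  from arg_cong[OF this, of "\<lambda>z. z / (1 + 2 * w)"]
  have "w / (1 + 2 * w) = lam * ((1 + w) / (1 + 2 * w) * (1 / (1 + w)) ^ (k + 1))"
    by (simp only: times_divide_eq_left times_divide_eq_right mult.assoc)
  then have "measure ?\<nu> (A \<inter> {\<phi>. \<phi> u}) = lam * measure ?\<nu> (A \<inter> {\<phi>. \<not> \<phi> u \<and> ?V \<phi>})"
    unfolding 1 2 by (simp add: mult.assoc)
  then show "measure (hc_measure w r) (A \<inter> {\<phi>. \<phi> u}) = lam * measure (hc_measure w r) (A \<inter> {\<phi>. \<not> \<phi> u \<and> ?V \<phi>})"
    using hc_measure_root[OF w(1), of r u] by simp
qed

lemma hc_measure_simple_invariant_gibbs: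
  assumes "w > 0" "w * (1 + w) ^ k = lam"
  shows "simple_invariant_gibbs adj lam (hc_measure w r)"
  using hc_measure_gibbs hc_measure_simple hc_measure_invariant assms
  by (simp add: simple_invariant_gibbs_def)

end

section \<open>The contraction inequality\<close>

lemma prod_le_1_abs: "(\<And>y. y \<in> Y \<Longrightarrow> \<bar>f y\<bar> \<le> 1) \<Longrightarrow> \<bar>\<Prod>y\<in>Y. f y :: real\<bar> \<le> 1"
  unfolding abs_prod by (rule prod_le_1) auto

lemma abs_mult_le: "\<bar>a\<bar> \<le> B \<Longrightarrow> \<bar>b\<bar> \<le> 1 \<Longrightarrow> \<bar>a * b :: real\<bar> \<le> B"
  unfolding abs_mult using mult_mono[of "\<bar>a\<bar>" B "\<bar>b\<bar>" 1] by force

lemma activity_exists: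
  assumes "lam > 0" shows "\<exists>w::real. 0 < w \<and> w * (1 + w) ^ k = lam"
proof -
  have "\<exists>w\<ge>0. w \<le> lam \<and> w * (1 + w) ^ k = lam"
  proof (rule IVT')
    have "lam * 1 \<le> lam * (1 + lam) ^ k" using assms by (intro mult_left_mono one_le_power) auto
    then show "lam \<le> lam * (1 + lam) ^ k" by simp
  qed (use assms in \<open>auto intro!: continuous_intros\<close>)
  then obtain w where w: "w \<ge> 0" "w * (1 + w) ^ k = lam" by blast
  then have "w \<noteq> 0" using assms by auto
  then show ?thesis using w by (intro exI[of _ w]) auto
qed

lemma ln_le_four_fifths: assumes "0 < x" "x \<le> exp 1 - 1" shows "ln x \<le> (4 / 5 :: real)"
proof -
  have "ln x \<le> x - 1" using assms by (intro ln_le_minus_one)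
  then show ?thesis using assms e_less_272 by linarith
qed

text \<open>The difference \<open>H s\<close> of the two sides vanishes at \<open>w\<close>. It is concave on \<open>[w, 1]\<close> and nonnegative at \<open>1\<close>,
which covers that interval, and it is increasing on \<open>[1, lam]\<close>. The bound on \<open>lam\<close> enters only through \<open>ln lam \<le> 4 / 5\<close>.\<close>

lemma log_inequality:
  fixes w s lam :: real
  assumes w: "0 < w" "w < 1" and s: "w \<le> s" "s \<le> lam" and lam: "lam \<le> exp 1 - 1"
  shows "(1 + w) * ln (lam / w) * (s - w) \<le> ln (s / w) * (1 + s)"
proof -
  have lam0: "lam > 0" using w s by linarith
  define L where "L = ln lam - ln w"
  have L: "ln (lam / w) = L" using lam0 w by (simp add: L_def ln_div)
  define H where "H x = (ln x - ln w) * (1 + x) - (1 + w) * L * (x - w)" for x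
  define H' where "H' x = (1 + x) / x + (ln x - ln w) - (1 + w) * L" for x
  have dH: "(H has_real_derivative H' x) (at x)" if "x > 0" for x
    unfolding H_def H'_def using that by (auto intro!: derivative_eq_intros simp: field_simps)
  have dH': "(H' has_real_derivative (1 / x - 1 / x\<^sup>2)) (at x)" if "x > 0" for x
    unfolding H'_def using that by (auto intro!: derivative_eq_intros simp: field_simps power2_eq_square)
  have lnlam: "ln lam \<le> 4 / 5" using ln_le_four_fifths[OF lam0 lam] .
  have lnw: "ln w \<le> w - 1" using w by (intro ln_le_minus_one)
  have Hw: "H w = 0" by (simp add: H_def)
  have H1: "H 1 \<ge> 0"
  proof -
    have "H 1 = - ln w * (1 + w\<^sup>2) - (1 - w\<^sup>2) * ln lam"
      by (simp add: H_def L_def algebra_simps power2_eq_square)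
    moreover have "- ln w * (1 + w\<^sup>2) \<ge> (1 - w) * (1 + w\<^sup>2)" using lnw by (intro mult_right_mono) auto
    moreover have "(1 - w\<^sup>2) * ln lam \<le> (1 - w\<^sup>2) * (4 / 5)"
      using lnlam w by (intro mult_left_mono) (auto simp: power_le_one)
    moreover have "(1 - w) * (1 + w\<^sup>2) \<ge> (1 - w\<^sup>2) * (4 / 5)"
    proof -
      \<comment> \<open>completing the square in \<open>1 + w^2 - (1 + w) 4 / 5\<close>\<close>
      have "0 \<le> (w - 2 / 5)\<^sup>2 + 1 / 25" by simp
      then have "0 \<le> 1 + w\<^sup>2 - (1 + w) * (4 / 5)" by (simp add: power2_eq_square algebra_simps)
      then have "0 \<le> (1 - w) * (1 + w\<^sup>2 - (1 + w) * (4 / 5))" using w by (intro mult_nonneg_nonneg) auto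
      then show ?thesis by (simp add: power2_eq_square algebra_simps)
    qed
    ultimately show ?thesis by linarith
  qed
  have small: "H x \<ge> 0" if x: "w \<le> x" "x \<le> 1" for x
  proof -
    have cv: "convex_on {w..1} (\<lambda>x. - H x)"
    proof (rule f''_ge0_imp_convex)
      show "((\<lambda>x. - H x) has_real_derivative - H' x) (at x)" if "x \<in> {w..1}" for x
        using dH[of x] that w by (auto intro: DERIV_minus)
      show "((\<lambda>x. - H' x) has_real_derivative - (1 / x - 1 / x\<^sup>2)) (at x)" if "x \<in> {w..1}" for x
        using dH'[of x] that w by (intro DERIV_minus) auto
      show "0 \<le> - (1 / x - 1 / x\<^sup>2)" if "x \<in> {w..1}" for x
        using that w by (auto simp: field_simps power2_eq_square)
    qed simp
    \<comment> \<open>the weight of \<open>1\<close> when \<open>x\<close> is written as a convex combination of \<open>w\<close> and \<open>1\<close>\<close>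
    define u where "u = (x - w) / (1 - w)"
    have u: "0 \<le> u" "u \<le> 1" using x w by (auto simp: u_def divide_simps)
    have "u * (1 - w) = x - w" using w by (simp add: u_def)
    then have xu: "x = (1 - u) * w + u * 1" by (simp add: algebra_simps)
    have "- H ((1 - u) *\<^sub>R w + u *\<^sub>R 1) \<le> (1 - u) * - H w + u * - H 1"
      using u w by (intro convex_onD[OF cv]) auto
    then have "- H x \<le> u * - H 1" using xu Hw by simp
    moreover have "u * H 1 \<ge> 0" using u H1 by simp
    ultimately show ?thesis by linarith
  qed
  have "H s \<ge> 0"
  proof (cases "s \<le> 1")
    case True
    then show ?thesis using small s by blast
  next
    case False
    have "H 1 \<le> H s"
    proof (rule DERIV_nonneg_imp_nondecreasing[of 1 s H])
      show "1 \<le> s" using False by simp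
      fix x assume x: "1 \<le> x" "x \<le> s"
      have "H' x \<ge> 0"
      proof -
        have "ln (1 / x) \<le> 1 / x - 1" using x by (intro ln_le_minus_one) auto
        then have 1: "1 / x + ln x \<ge> 1" using x by (simp add: ln_div)
        have "ln (1 / w) \<le> 1 / w - 1" using w by (intro ln_le_minus_one) auto
        then have "w * - ln w \<le> w * (1 / w - 1)" using w by (intro mult_left_mono) (auto simp: ln_div)
        then have 2: "w * ln w \<ge> w - 1" using w by (simp add: algebra_simps)
        have 3: "(1 + w) * ln lam \<le> (1 + w) * (4 / 5)" using lnlam w by (intro mult_left_mono) auto
        have "H' x = 1 + (1 / x + ln x) + w * ln w - (1 + w) * ln lam"
          using x by (simp add: H'_def L_def field_simps)
        then show ?thesis using 1 2 3 w by (simp add: algebra_simps)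
      qed
      then show "\<exists>y. (H has_real_derivative y) (at x) \<and> 0 \<le> y" using dH[of x] x by auto
    qed
    then show ?thesis using H1 by simp
  qed
  moreover have "ln (s / w) = ln s - ln w" using w s by (simp add: ln_div)
  ultimately show ?thesis by (simp add: H_def L)
qed

text \<open>The iterates of \<open>h a = (1 + w) (1 - w / (1 + w a^k))\<close>, which has the fixed point \<open>1\<close>. The start \<open>1 + w\<close> is the
normalised expectation of a message that reveals the state of its site.\<close>

primrec info_bound :: "nat \<Rightarrow> real \<Rightarrow> nat \<Rightarrow> real" where
  "info_bound k w 0 = 1 + w"
| "info_bound k w (Suc n) = (1 + w) * (1 - w / (1 + w * info_bound k w n ^ k))"

text \<open>With \<open>s = w a^k\<close> the claim is \<open>w (s - w) < (a - 1) (1 + s)\<close>. Replacing \<open>a - 1\<close> by \<open>ln a = ln (s / w) / k\<close> and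
\<open>w\<close> by \<open>(1 + w) ln (1 + w) = (1 + w) ln (lam / w) / k\<close> makes it harder and removes \<open>k\<close>: what remains is
\<open>log_inequality\<close>.\<close>

lemma info_bound_decreases:
  fixes a w lam :: real
  assumes k: "k \<ge> 1" and w: "0 < w" "w * (1 + w) ^ k = lam" and lam: "lam \<le> exp 1 - 1"
    and a: "1 < a" "a \<le> 1 + w"
  shows "(1 + w) * (1 - w / (1 + w * a ^ k)) < a"
proof -
  define s where "s = w * a ^ k"
  have "w < 1"
  proof (rule ccontr)
    assume "\<not> w < 1"
    then have "1 * (2::real) \<le> w * (1 + w) ^ k"
      using power_increasing[OF k, of "1 + w"] by (intro mult_mono) auto
    then show False using w lam e_less_272 by linarith
  qed
  have ak: "1 < a ^ k" using a k by (simp add: one_less_power)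
  have s: "w < s" "s \<le> lam"
  proof -
    show "w < s" using w ak by (simp add: s_def)
    have "a ^ k \<le> (1 + w) ^ k" using a by (intro power_mono) auto
    then show "s \<le> lam" using w by (simp add: s_def w(2)[symmetric])
  qed
  have 1: "ln (s / w) = k * ln a" using w a by (simp add: s_def ln_realpow)
  have 2: "ln (lam / w) = k * ln (1 + w)" using w by (simp add: w(2)[symmetric] ln_realpow)
  have 3: "w \<le> (1 + w) * ln (1 + w)"
  proof -
    have "ln (1 / (1 + w)) \<le> 1 / (1 + w) - 1" using w by (intro ln_le_minus_one) auto
    then have "1 - 1 / (1 + w) \<le> ln (1 + w)" using w by (simp add: ln_div)
    then have "(1 + w) * (1 - 1 / (1 + w)) \<le> (1 + w) * ln (1 + w)" using w by (intro mult_left_mono) auto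
    moreover have "(1 + w) * (1 - 1 / (1 + w)) = w" using w by (simp add: field_simps)
    ultimately show ?thesis by simp
  qed
  have "k * (w * (s - w)) \<le> k * ((1 + w) * ln (1 + w) * (s - w))"
    using 3 s by (intro mult_left_mono mult_right_mono) auto
  also have "\<dots> = (1 + w) * ln (lam / w) * (s - w)" by (simp add: 2)
  also have "\<dots> \<le> ln (s / w) * (1 + s)" using log_inequality[OF w(1) \<open>w < 1\<close> _ s(2) lam] s by simp
  also have "\<dots> = k * (ln a * (1 + s))" by (simp add: 1)
  finally have "w * (s - w) \<le> ln a * (1 + s)" using k by simp
  also have "\<dots> < (a - 1) * (1 + s)"
    using a s w ln_le_minus_one[of a] ln_eq_minus_one[of a] by (intro mult_strict_right_mono) force+
  finally have main: "w * (s - w) < (a - 1) * (1 + s)" .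
  have "(1 + w) * (1 - w / (1 + s)) = 1 + w * (s - w) / (1 + s)" using s w by (simp add: field_simps)
  also have "\<dots> < a" using main s w by (simp add: field_simps)
  finally show ?thesis by (simp add: s_def)
qed

lemma info_bound_ge_1: assumes "w > 0" shows "info_bound k w n \<ge> 1"
proof (induction n)
  case (Suc n)
  have "w * 1 \<le> w * info_bound k w n ^ k" using Suc assms by (intro mult_left_mono one_le_power) auto
  then have "w / (1 + w * info_bound k w n ^ k) \<le> w / (1 + w)"
    using assms by (intro divide_left_mono mult_pos_pos) linarith+
  then have "(1 + w) * (1 - w / (1 + w)) \<le> info_bound k w (Suc n)"
    using assms unfolding info_bound.simps by (intro mult_left_mono) auto
  moreover have "(1 + w) * (1 - w / (1 + w)) = 1" using assms by (simp add: field_simps)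
  ultimately show ?case by simp
qed (use assms in simp)

lemma info_bound_tendsto:
  assumes k: "k \<ge> 1" and w: "0 < w" "w * (1 + w) ^ k = lam" and lam: "lam \<le> exp 1 - 1"
  shows "info_bound k w \<longlonglongrightarrow> 1"
proof -
  let ?b = "info_bound k w"
  define h where "h a = (1 + w) * (1 - w / (1 + w * a ^ k))" for a
  have Suc: "?b (Suc n) = h (?b n)" for n by (simp add: h_def)
  have h1: "h 1 = 1" using w by (simp add: h_def field_simps)
  have step: "?b n \<le> 1 + w \<and> ?b (Suc n) \<le> ?b n" for n
  proof (induction n)
    case 0
    have "h (1 + w) \<le> 1 + w" using info_bound_decreases[OF k w lam, of "1 + w"] w unfolding h_def by simp
    then show ?case unfolding Suc by simp
  next
    case (Suc n)
    then have le: "?b (Suc n) \<le> 1 + w" by simp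
    have "h (?b (Suc n)) \<le> ?b (Suc n)"
    proof (cases "?b (Suc n) = 1")
      case False
      then have "1 < ?b (Suc n)" using info_bound_ge_1[OF w(1), of k "Suc n"] by linarith
      then show ?thesis using info_bound_decreases[OF k w lam _ le] unfolding h_def by (intro less_imp_le)
    qed (simp only: h1 order_refl)
    then show ?case using le by (simp add: h_def)
  qed
  have "decseq ?b" using step by (intro decseq_SucI) blast
  then obtain l where l: "?b \<longlonglongrightarrow> l" "\<And>n. l \<le> ?b n"
    using decseq_convergent[of ?b 1] info_bound_ge_1[OF w(1)] by metis
  have l1: "1 \<le> l" using LIMSEQ_le_const[OF l(1)] info_bound_ge_1[OF w(1)] by blast
  have lw: "l \<le> 1 + w" using l(2)[of 0] by simp
  have "0 < w * l ^ k" using w l1 by (intro mult_pos_pos zero_less_power) auto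
  then have "(\<lambda>n. h (?b n)) \<longlonglongrightarrow> h l" unfolding h_def by (intro tendsto_intros l(1)) simp
  then have "(\<lambda>n. ?b (Suc n)) \<longlonglongrightarrow> h l" by (simp only: Suc)
  then have "h l = l" using LIMSEQ_unique LIMSEQ_Suc[OF l(1)] by blast
  then have "l = 1" using info_bound_decreases[OF k w lam _ lw] l1 unfolding h_def by force
  then show ?thesis using l(1) by simp
qed

section \<open>Messages and their concentration\<close>

context reg_tree begin

text \<open>The probability that \<open>x\<close> is vacant, given that \<open>t\<close> is vacant and given the sites of the branch of \<open>x\<close> at
distance \<open>n\<close> from \<open>x\<close>. The product over \<open>y\<close> is the
probability that all children of \<open>x\<close> are vacant if \<open>x\<close> is.\<close>

primrec message :: "real \<Rightarrow> nat \<Rightarrow> 'v \<Rightarrow> 'v \<Rightarrow> ('v \<Rightarrow> bool) \<Rightarrow> real" where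
  "message lam 0 t x \<phi> = of_bool (\<not> \<phi> x)"
| "message lam (Suc n) t x \<phi> = 1 / (1 + lam * (\<Prod>y\<in>nb x - {t}. message lam n x y \<phi>))"

text \<open>The sites of the branch at distance less than \<open>n\<close> from \<open>x\<close>: those whose state the message does not use.\<close>

primrec branch_ball :: "nat \<Rightarrow> 'v \<Rightarrow> 'v \<Rightarrow> 'v set" where
  "branch_ball 0 t x = {}"
| "branch_ball (Suc n) t x = insert x (\<Union>y\<in>nb x - {t}. branch_ball n x y)"

abbreviation vac :: "'v \<Rightarrow> ('v \<Rightarrow> bool) \<Rightarrow> real" where
  "vac v \<phi> \<equiv> of_bool (\<not> \<phi> v)"

lemma message_bounds: assumes "lam > 0" shows "0 \<le> message lam n t x \<phi> \<and> message lam n t x \<phi> \<le> 1"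
proof (induction n arbitrary: t x)
  case (Suc n)
  have "0 \<le> lam * (\<Prod>y\<in>nb x - {t}. message lam n x y \<phi>)"
    using Suc assms by (intro mult_nonneg_nonneg prod_nonneg) auto
  then show ?case by (simp add: divide_simps)
qed simp

lemma message_measurable: "message lam n t x \<in> borel_measurable (conf_space UNIV)"
proof (induction n arbitrary: t x)
  case 0
  show ?case unfolding message.simps by measurable
next
  case (Suc n)
  note [measurable] = Suc
  show ?case unfolding message.simps by measurable
qed

lemma branch_ball_subset: "adj t x \<Longrightarrow> branch_ball n t x \<subseteq> br t x"
proof (induction n arbitrary: t x)
  case (Suc n)
  have "branch_ball n x y \<subseteq> br t x" if "y \<in> nb x - {t}" for y
    using Suc.IH[of x y] br_mono[OF Suc.prems, of y] that by auto
  then show ?case using br_self[of x t] by fastforce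
qed simp

lemma message_depends: "adj t x \<Longrightarrow> depends_on (br t x - branch_ball n t x) (message lam n t x)"
proof (induction n arbitrary: t x)
  case 0
  show ?case using br_self by (auto simp: depends_on_def)
next
  case (Suc n)
  have "depends_on (br t x - branch_ball (Suc n) t x) (message lam n x y)" if y: "y \<in> nb x - {t}" for y
  proof (rule depends_on_mono)
    have axy: "adj x y" using y by simp
    show "depends_on (br x y - branch_ball n x y) (message lam n x y)" using Suc.IH axy .
    show "br x y - branch_ball n x y \<subseteq> br t x - branch_ball (Suc n) t x"
    proof
      fix z assume z: "z \<in> br x y - branch_ball n x y"
      have "z \<in> br t x" using br_mono[OF Suc.prems axy] y z by auto
      moreover have "z \<noteq> x" using z br_not_self adj_neq[OF axy] by blast
      moreover have "z \<notin> branch_ball n x y'" if "y' \<in> nb x - {t}" for y'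
        using z that branch_ball_subset[of x y' n] br_disjoint[OF axy, of y'] by (cases "y' = y") auto
      ultimately show "z \<in> br t x - branch_ball (Suc n) t x" by auto
    qed
  qed
  then have "(\<Prod>y\<in>nb x - {t}. message lam n x y \<phi>) = (\<Prod>y\<in>nb x - {t}. message lam n x y \<psi>)"
    if "\<forall>v\<in>br t x - branch_ball (Suc n) t x. \<phi> v = \<psi> v" for \<phi> \<psi>
    using that unfolding depends_on_def by (intro prod.cong refl) blast
  then show ?case unfolding depends_on_def message.simps by simp
qed

lemma vac_measurable: "vac v \<in> borel_measurable (conf_space UNIV)"
  by measurable

lemma depends_vac: "v \<in> C \<Longrightarrow> depends_on C (vac v)"
  by (auto simp: depends_on_def)

lemma message_abs: "lam > 0 \<Longrightarrow> \<bar>message lam n t x \<phi>\<bar> \<le> 1"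
  using message_bounds[of lam n t x \<phi>] by auto

text \<open>By induction on the depth, from the single-site property alone. Given that \<open>x\<close> is vacant, the children can be
replaced one at a time by their messages; the single-site property at \<open>x\<close> then says that the weights of vacant and
occupied are in the ratio \<open>1\<close> to \<open>lam P\<close>, where \<open>P\<close> is the product of the messages of the children. The message is
the vacant share.\<close>

lemma message_gibbs:
  assumes g: "gibbs adj lam \<nu>" and lam: "lam > 0"
    and a: "adj t x" and f: "f \<in> borel_measurable (conf_space UNIV)" "\<And>\<phi>. \<bar>f \<phi>\<bar> \<le> B" "depends_on (- branch_ball n t x) f"
  shows "(\<integral>\<phi>. f \<phi> * vac t \<phi> * vac x \<phi> \<partial>\<nu>) = (\<integral>\<phi>. f \<phi> * vac t \<phi> * message lam n t x \<phi> \<partial>\<nu>)"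
  using a f
proof (induction n arbitrary: t x f B)
  case 0
  show ?case by simp
next
  case (Suc n)
  note a = Suc.prems(1) and f = Suc.prems(2-4)
  have cp: "conf_prob \<nu>" using g by (simp add: gibbs_def)
  let ?Y = "nb x - {t}"
  let ?M = "message lam n x"
  have fin: "finite ?Y" using finite_nb by simp
  have t: "t \<noteq> x" "t \<notin> br t x" using adj_neq[OF a] br_not_self by auto
  note [measurable] = message_measurable vac_measurable
  have swap: "(\<integral>\<phi>. h \<phi> * vac t \<phi> * vac x \<phi> * (\<Prod>y\<in>?Y. if y \<in> W then vac y \<phi> else ?M y \<phi>) \<partial>\<nu>) =
      (\<integral>\<phi>. h \<phi> * vac t \<phi> * vac x \<phi> * (\<Prod>y\<in>?Y. ?M y \<phi>) \<partial>\<nu>)"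
    if h: "h \<in> borel_measurable (conf_space UNIV)" "\<And>\<phi>. \<bar>h \<phi>\<bar> \<le> B" "depends_on (- branch_ball (Suc n) t x) h"
      and W: "W \<subseteq> ?Y" for h W
  proof -
    have "finite W" using W fin finite_subset by blast
    then show ?thesis using W
    proof (induction W rule: finite_induct)
      case (insert y W)
      have y: "adj x y" "y \<noteq> t" "y \<in> ?Y" using insert.prems by auto
      let ?F = "\<lambda>W y \<phi>. if y \<in> W then vac y \<phi> else ?M y \<phi>"
      let ?g = "\<lambda>\<phi>. h \<phi> * vac t \<phi> * (\<Prod>z\<in>?Y - {y}. ?F W z \<phi>)"
      have mg: "?g \<in> borel_measurable (conf_space UNIV)"
        using h(1) by (intro borel_measurable_times borel_measurable_prod) (auto intro: vac_measurable message_measurable)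
      have bg: "\<bar>?g \<phi>\<bar> \<le> B" for \<phi>
        by (intro abs_mult_le h prod_le_1_abs) (auto simp: message_abs[OF lam])
      have hy: "branch_ball n x y \<subseteq> br x y" by (rule branch_ball_subset[OF y(1)])
      have dg: "depends_on (- branch_ball n x y) ?g"
      proof (intro depends_mult depends_prod)
        show "depends_on (- branch_ball n x y) h" using h(3) by (rule depends_on_mono) (use y in auto)
        show "depends_on (- branch_ball n x y) (vac t)"
          using hy br_mono[OF a y(1,2)] t by (intro depends_vac) blast
        fix z assume z: "z \<in> ?Y - {y}"
        have dis: "br x y \<inter> br x z = {}" using br_disjoint[OF y(1), of z] z by auto
        show "depends_on (- branch_ball n x y) (?F W z)"
        proof (cases "z \<in> W")
          case True
          then show ?thesis using dis hy br_self[of z x] by (simp, intro depends_vac) blast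
        next
          case False
          have "depends_on (br x z - branch_ball n x z) (?M z)" using z by (intro message_depends) simp
          then have "depends_on (- branch_ball n x y) (?M z)" by (rule depends_on_mono) (use dis hy in blast)
          then show ?thesis using False by simp
        qed
      qed
      have "(\<integral>\<phi>. h \<phi> * vac t \<phi> * vac x \<phi> * (\<Prod>z\<in>?Y. ?F (insert y W) z \<phi>) \<partial>\<nu>) = (\<integral>\<phi>. ?g \<phi> * vac x \<phi> * vac y \<phi> \<partial>\<nu>)"
      proof (intro Bochner_Integration.integral_cong refl)
        fix \<phi>
        have "(\<Prod>z\<in>?Y. ?F (insert y W) z \<phi>) = vac y \<phi> * (\<Prod>z\<in>?Y - {y}. ?F (insert y W) z \<phi>)"
          using prod.remove[OF fin y(3), of "\<lambda>z. ?F (insert y W) z \<phi>"] by simp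
        also have "(\<Prod>z\<in>?Y - {y}. ?F (insert y W) z \<phi>) = (\<Prod>z\<in>?Y - {y}. ?F W z \<phi>)"
          by (rule prod.cong) auto
        finally show "h \<phi> * vac t \<phi> * vac x \<phi> * (\<Prod>z\<in>?Y. ?F (insert y W) z \<phi>) = ?g \<phi> * vac x \<phi> * vac y \<phi>"
          by (simp only: mult_ac)
      qed
      also have "\<dots> = (\<integral>\<phi>. ?g \<phi> * vac x \<phi> * ?M y \<phi> \<partial>\<nu>)"
        by (rule Suc.IH[OF y(1) mg bg dg])
      also have "\<dots> = (\<integral>\<phi>. h \<phi> * vac t \<phi> * vac x \<phi> * (\<Prod>z\<in>?Y. ?F W z \<phi>) \<partial>\<nu>)"
      proof (intro Bochner_Integration.integral_cong refl)
        fix \<phi>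
        have "(\<Prod>z\<in>?Y. ?F W z \<phi>) = ?M y \<phi> * (\<Prod>z\<in>?Y - {y}. ?F W z \<phi>)"
          using prod.remove[OF fin y(3), of "\<lambda>z. ?F W z \<phi>"] insert.hyps by simp
        then show "?g \<phi> * vac x \<phi> * ?M y \<phi> = h \<phi> * vac t \<phi> * vac x \<phi> * (\<Prod>z\<in>?Y. ?F W z \<phi>)"
          by (simp only: mult_ac)
      qed
      also have "\<dots> = (\<integral>\<phi>. h \<phi> * vac t \<phi> * vac x \<phi> * (\<Prod>y\<in>?Y. ?M y \<phi>) \<partial>\<nu>)"
        using insert by simp
      finally show ?case .
    qed simp
  qed
  let ?Q = "message lam (Suc n) t x"
  let ?P = "\<lambda>\<phi>. \<Prod>y\<in>?Y. ?M y \<phi>"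
  \<comment> \<open>\<open>?Q\<close> is itself a function of sites off the ball, so it may be absorbed into the test function\<close>
  define h where "h \<phi> = f \<phi> * ?Q \<phi>" for \<phi>
  have dQ: "depends_on (- branch_ball (Suc n) t x) ?Q"
    by (rule depends_on_mono[OF message_depends[OF a]]) auto
  have h: "h \<in> borel_measurable (conf_space UNIV)" "\<bar>h \<phi>\<bar> \<le> B" "depends_on (- branch_ball (Suc n) t x) h" for \<phi>
  proof -
    show "h \<in> borel_measurable (conf_space UNIV)"
      unfolding h_def using f(1) message_measurable by (rule borel_measurable_times)
    show "\<bar>h \<phi>\<bar> \<le> B" unfolding h_def by (intro abs_mult_le f message_abs lam)
    show "depends_on (- branch_ball (Suc n) t x) h" unfolding h_def by (intro depends_mult f dQ)
  qed
  have "(\<integral>\<phi>. h \<phi> * vac t \<phi> * of_bool (\<phi> x) \<partial>\<nu>) =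
      lam * (\<integral>\<phi>. h \<phi> * vac t \<phi> * of_bool (\<not> \<phi> x \<and> (\<forall>v\<in>nb x. \<not> \<phi> v)) \<partial>\<nu>)"
  proof (rule gibbs_site[OF g lam])
    show "(\<lambda>\<phi>. h \<phi> * vac t \<phi>) \<in> borel_measurable (conf_space UNIV)"
      using h(1) vac_measurable by (rule borel_measurable_times)
    show "\<bar>h \<phi> * vac t \<phi>\<bar> \<le> B" for \<phi> by (intro abs_mult_le h) simp
    have "depends_on (- {x}) h" using h(3) by (rule depends_on_mono) auto
    then show "depends_on (- {x}) (\<lambda>\<phi>. h \<phi> * vac t \<phi>)" using t by (intro depends_mult depends_vac) auto
  qed
  also have "(\<integral>\<phi>. h \<phi> * vac t \<phi> * of_bool (\<not> \<phi> x \<and> (\<forall>v\<in>nb x. \<not> \<phi> v)) \<partial>\<nu>) =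
      (\<integral>\<phi>. h \<phi> * vac t \<phi> * vac x \<phi> * (\<Prod>y\<in>?Y. if y \<in> ?Y then vac y \<phi> else ?M y \<phi>) \<partial>\<nu>)"
  proof (intro Bochner_Integration.integral_cong refl)
    fix \<phi>
    have "(\<Prod>y\<in>?Y. if y \<in> ?Y then vac y \<phi> else ?M y \<phi>) = (\<Prod>y\<in>?Y. vac y \<phi>)"
      by (rule prod.cong) auto
    also have "\<dots> = of_bool (\<forall>y\<in>?Y. \<not> \<phi> y)" by (rule prod_of_bool[OF fin])
    finally show "h \<phi> * vac t \<phi> * of_bool (\<not> \<phi> x \<and> (\<forall>v\<in>nb x. \<not> \<phi> v)) =
        h \<phi> * vac t \<phi> * vac x \<phi> * (\<Prod>y\<in>?Y. if y \<in> ?Y then vac y \<phi> else ?M y \<phi>)"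
      using adj_sym[OF a] by (cases "\<phi> t") auto
  qed
  also have "\<dots> = (\<integral>\<phi>. h \<phi> * vac t \<phi> * vac x \<phi> * ?P \<phi> \<partial>\<nu>)" by (rule swap[OF h order_refl])
  finally have occ: "(\<integral>\<phi>. h \<phi> * vac t \<phi> * of_bool (\<phi> x) \<partial>\<nu>) = lam * (\<integral>\<phi>. h \<phi> * vac t \<phi> * vac x \<phi> * ?P \<phi> \<partial>\<nu>)" .
  have int: "integrable \<nu> (\<lambda>\<phi>. h \<phi> * vac t \<phi> * u \<phi>)"
    if "u \<in> borel_measurable (conf_space UNIV)" "\<And>\<phi>. \<bar>u \<phi>\<bar> \<le> 1" for u
  proof (rule bounded_integrable[OF cp, of _ B])
    show "(\<lambda>\<phi>. h \<phi> * vac t \<phi> * u \<phi>) \<in> borel_measurable (conf_space UNIV)"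
      by (intro borel_measurable_times h(1) vac_measurable that)
    show "\<bar>h \<phi> * vac t \<phi> * u \<phi>\<bar> \<le> B" for \<phi>
      by (intro abs_mult_le h(2) that) simp
  qed
  have Px: "(\<lambda>\<phi>. vac x \<phi> * ?P \<phi>) \<in> borel_measurable (conf_space UNIV)" "\<bar>vac x \<phi> * ?P \<phi>\<bar> \<le> 1" for \<phi>
    by (auto intro!: borel_measurable_times vac_measurable borel_measurable_prod message_measurable
        abs_mult_le prod_le_1_abs message_abs lam)
  have "(\<integral>\<phi>. f \<phi> * vac t \<phi> * ?Q \<phi> \<partial>\<nu>) = (\<integral>\<phi>. h \<phi> * vac t \<phi> * of_bool (\<phi> x) + h \<phi> * vac t \<phi> * vac x \<phi> \<partial>\<nu>)"
    by (intro Bochner_Integration.integral_cong refl) (auto simp: h_def)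
  also have "\<dots> = (\<integral>\<phi>. h \<phi> * vac t \<phi> * of_bool (\<phi> x) \<partial>\<nu>) + (\<integral>\<phi>. h \<phi> * vac t \<phi> * vac x \<phi> \<partial>\<nu>)"
    by (intro Bochner_Integration.integral_add int) auto
  also have "\<dots> = lam * (\<integral>\<phi>. h \<phi> * vac t \<phi> * (vac x \<phi> * ?P \<phi>) \<partial>\<nu>) + (\<integral>\<phi>. h \<phi> * vac t \<phi> * vac x \<phi> \<partial>\<nu>)"
    unfolding occ by (simp only: mult.assoc)
  also have "\<dots> = (\<integral>\<phi>. lam * (h \<phi> * vac t \<phi> * (vac x \<phi> * ?P \<phi>)) + h \<phi> * vac t \<phi> * vac x \<phi> \<partial>\<nu>)"
    using int[OF Px] int[of "vac x"] by (subst Bochner_Integration.integral_add) auto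
  also have "\<dots> = (\<integral>\<phi>. f \<phi> * vac t \<phi> * vac x \<phi> \<partial>\<nu>)"
  proof (intro Bochner_Integration.integral_cong refl)
    fix \<phi>
    have "0 \<le> ?P \<phi>" using message_bounds[OF lam] by (intro prod_nonneg) auto
    then have "1 + lam * ?P \<phi> > 0" using lam by (simp add: add_pos_nonneg)
    then have "?Q \<phi> * (1 + lam * ?P \<phi>) = 1" by simp
    moreover have "lam * (h \<phi> * vac t \<phi> * (vac x \<phi> * ?P \<phi>)) + h \<phi> * vac t \<phi> * vac x \<phi> =
        f \<phi> * vac t \<phi> * vac x \<phi> * (?Q \<phi> * (1 + lam * ?P \<phi>))"
      unfolding h_def by (simp only: algebra_simps)
    ultimately show "lam * (h \<phi> * vac t \<phi> * (vac x \<phi> * ?P \<phi>)) + h \<phi> * vac t \<phi> * vac x \<phi> = f \<phi> * vac t \<phi> * vac x \<phi>"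
      by simp
  qed
  finally show ?case by simp
qed

text \<open>A quadratic upper bound for \<open>1 / (1 + r)\<close> that is exact at \<open>r = 0\<close> and tangent at \<open>r = b\<close>.\<close>

lemma message_Suc_le:
  fixes b :: real and t x :: 'v and n :: nat
  assumes lam: "lam > 0" and b: "b \<ge> 0"
  defines "P \<equiv> \<lambda>\<phi>. \<Prod>y\<in>nb x - {t}. message lam n x y \<phi>"
  shows "message lam (Suc n) t x \<phi> \<le>
    1 - (1 + 2 * b) / (1 + b)\<^sup>2 * (lam * P \<phi>) + 1 / (1 + b)\<^sup>2 * (lam * P \<phi>)\<^sup>2"
proof -
  define r where "r = lam * P \<phi>"
  have r: "r \<ge> 0" unfolding r_def P_def using lam message_bounds[OF lam] by (intro mult_nonneg_nonneg prod_nonneg) auto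
  have "0 \<le> r * (r - b)\<^sup>2" using r by simp
  also have "r * (r - b)\<^sup>2 = (1 + r) * ((1 + b)\<^sup>2 - (1 + 2 * b) * r + r\<^sup>2) - (1 + b)\<^sup>2"
    by (simp add: power2_eq_square algebra_simps)
  finally have "(1 + b)\<^sup>2 / (1 + r) \<le> (1 + b)\<^sup>2 - (1 + 2 * b) * r + r\<^sup>2"
    using r by (simp add: divide_le_eq mult.commute)
  then have step: "((1 + b)\<^sup>2 / (1 + r)) / (1 + b)\<^sup>2 \<le> ((1 + b)\<^sup>2 - (1 + 2 * b) * r + r\<^sup>2) / (1 + b)\<^sup>2"
    by (rule divide_right_mono) simp
  have "1 / (1 + r) \<le> 1 - (1 + 2 * b) / (1 + b)\<^sup>2 * r + 1 / (1 + b)\<^sup>2 * r\<^sup>2"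
  proof -
    have "(X - Y * r + Z) / X = 1 - Y / X * r + 1 / X * Z" "(X / (1 + r)) / X = 1 / (1 + r)" if "X > 0" for X Y Z :: real
      using that by (simp add: field_simps) (use that in simp)
    moreover have "(1 + b)\<^sup>2 > 0" using b by simp
    ultimately show ?thesis using step by simp
  qed
  then show ?thesis by (simp only: r_def P_def message.simps)
qed

text \<open>Conditionally on a vacant \<open>x\<close>, simplicity makes the messages of the children independent of each other and of
the state of \<open>t\<close>. Their first moment is \<open>c\<close>, and their second moment is the expectation of the message on the event that
the child is vacant (both by \<open>message_gibbs\<close>), so it is bounded by induction. The quadratic bound is used at
\<open>b = w (info_bound n)^k\<close>, an upper bound for the ratio of the second to the first moment of \<open>lam P\<close>, which is the
optimal point of contact.\<close>

lemma simple_info_bound: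
  assumes g: "gibbs adj lam \<mu>" and s: "simple_measure adj \<mu>"
    and p: "\<And>x. measure \<mu> {\<phi>. \<phi> x} = w / (1 + 2 * w)"
    and w: "w > 0" "w * (1 + w) ^ k = lam" and a: "adj t x"
  shows "(\<integral>\<phi>. message lam n t x \<phi> * vac t \<phi> * vac x \<phi> \<partial>\<mu>) \<le> info_bound k w n / ((1 + w) * (1 + 2 * w))"
  using a
proof (induction n arbitrary: t x)
  have cp: "conf_prob \<mu>" using g by (simp add: gibbs_def)
  have lam: "lam > 0" using w by (metis add_pos_pos mult_pos_pos zero_less_one zero_less_power)
  have p1: "w / (1 + 2 * w) < 1" using w by simp
  have e: "\<And>x y. adj x y \<Longrightarrow> AE \<phi> in \<mu>. \<not> (\<phi> x \<and> \<phi> y)" using gibbs_edge[OF g] .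
  have vp: "(\<integral>\<phi>. vac x \<phi> * vac y \<phi> \<partial>\<mu>) = 1 / (1 + 2 * w)" if "adj x y" for x y
  proof -
    have "(\<integral>\<phi>. vac x \<phi> * vac y \<phi> \<partial>\<mu>) = measure \<mu> {\<phi>. \<not> \<phi> x \<and> \<not> \<phi> y}"
      using integral_event[OF cp, of "\<lambda>\<phi>. \<not> \<phi> x \<and> \<not> \<phi> y"] by (simp add: of_bool_conj)
    also have "\<dots> = 1 - 2 * (w / (1 + 2 * w))" by (rule simple_hc_chain(2)[OF cp s e p p1 that])
    also have "\<dots> = 1 / (1 + 2 * w)" using w by (simp add: field_simps)
    finally show ?thesis .
  qed
  {
    case 0
    have "(\<integral>\<phi>. message lam 0 t x \<phi> * vac t \<phi> * vac x \<phi> \<partial>\<mu>) = (\<integral>\<phi>. vac t \<phi> * vac x \<phi> \<partial>\<mu>)"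
      by (intro Bochner_Integration.integral_cong) auto
    then show ?case using vp[OF 0] w by simp
  next
    case (Suc n)
    let ?Y = "nb x - {t}"
    let ?M = "message lam n x"
    let ?P = "\<lambda>\<phi>. \<Prod>y\<in>?Y. ?M y \<phi>"
    let ?b = "info_bound k w n"
    define c where "c = 1 / (1 + w)"
    define m where "m = (1 + w) / (1 + 2 * w)"
    define d where "d = 1 / (1 + 2 * w)"
    define b where "b = w * ?b ^ k"
    have b1: "?b \<ge> 1" by (rule info_bound_ge_1[OF w(1)])
    have b0: "b > 0" using w b1 by (simp add: b_def)
    have m0: "m > 0" "d > 0" "c > 0" using w by (simp_all add: m_def d_def c_def)
    have dm: "d / m = c" using w by (simp add: d_def m_def c_def)
    have d': "d = m * c" using w by (simp add: d_def m_def c_def)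
    have lamc: "lam * c ^ k = w" using w by (simp add: c_def w(2)[symmetric] power_divide)
    have fin: "finite ?Y" and tx: "t \<in> nb x" using finite_nb adj_sym[OF Suc.prems] by auto
    have cardY: "card ?Y = k" using card_nb[of x] finite_nb[of x] tx by simp
    have vacm: "measure \<mu> {\<phi>. \<phi> x = False} = m"
      using conf_prob_compl[OF cp, of "\<lambda>\<phi>. \<phi> x"] p w by (simp add: m_def field_simps)
    have prodj: "(\<integral>\<phi>. ?P \<phi> ^ j * vac t \<phi> * vac x \<phi> \<partial>\<mu>) =
        d * (\<Prod>y\<in>?Y. (\<integral>\<phi>. ?M y \<phi> ^ j * vac x \<phi> \<partial>\<mu>) / m)" for j :: nat
    proof -
      let ?f = "\<lambda>y \<phi>. if y = t then vac t \<phi> else ?M y \<phi> ^ j"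
      have split: "(\<Prod>y\<in>nb x. ?f y \<phi>) = ?P \<phi> ^ j * vac t \<phi>" for \<phi>
      proof -
        have "(\<Prod>y\<in>nb x. ?f y \<phi>) = ?f t \<phi> * (\<Prod>y\<in>?Y. ?f y \<phi>)" by (rule prod.remove[OF finite_nb tx])
        also have "(\<Prod>y\<in>?Y. ?f y \<phi>) = (\<Prod>y\<in>?Y. ?M y \<phi> ^ j)" by (rule prod.cong) auto
        finally show ?thesis by (simp add: prod_power_distrib mult.commute)
      qed
      have "(\<integral>\<phi>. (\<Prod>y\<in>nb x. ?f y \<phi>) * of_bool (\<phi> x = False) \<partial>\<mu>) / measure \<mu> {\<phi>. \<phi> x = False} =
          (\<Prod>y\<in>nb x. (\<integral>\<phi>. ?f y \<phi> * of_bool (\<phi> x = False) \<partial>\<mu>) / measure \<mu> {\<phi>. \<phi> x = False})"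
      proof (rule simple_product[OF cp s])
        show "measure \<mu> {\<phi>. \<phi> x = False} > 0" using vacm m0 by simp
        fix y assume y: "adj x y"
        show "?f y \<in> borel_measurable (conf_space UNIV)"
          using message_measurable[of lam n x y] vac_measurable[of t] by (cases "y = t") auto
        show "\<bar>?f y \<phi>\<bar> \<le> 1" for \<phi>
          using message_abs[OF lam, of n x y \<phi>] by (auto simp: power_abs power_le_one)
        have "depends_on (br x y) (?M y)" using message_depends[OF y] by (rule depends_on_mono) auto
        then have "depends_on (br x y) (\<lambda>\<phi>. ?M y \<phi> ^ j)" unfolding depends_on_def by metis
        moreover have "depends_on (br x y) (vac y)" by (rule depends_vac[OF br_self])
        ultimately show "depends_on (br x y) (?f y)" by (cases "y = t") simp_all
      qed
      also have "\<dots> = ((\<integral>\<phi>. ?f t \<phi> * of_bool (\<phi> x = False) \<partial>\<mu>) / measure \<mu> {\<phi>. \<phi> x = False}) *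
          (\<Prod>y\<in>?Y. (\<integral>\<phi>. ?f y \<phi> * of_bool (\<phi> x = False) \<partial>\<mu>) / measure \<mu> {\<phi>. \<phi> x = False})"
        by (rule prod.remove[OF finite_nb tx])
      also have "(\<Prod>y\<in>?Y. (\<integral>\<phi>. ?f y \<phi> * of_bool (\<phi> x = False) \<partial>\<mu>) / measure \<mu> {\<phi>. \<phi> x = False}) =
          (\<Prod>y\<in>?Y. (\<integral>\<phi>. ?M y \<phi> ^ j * vac x \<phi> \<partial>\<mu>) / m)"
        by (rule prod.cong) (auto simp: vacm[simplified])
      also have "(\<integral>\<phi>. ?f t \<phi> * of_bool (\<phi> x = False) \<partial>\<mu>) = d" using vp[OF Suc.prems] by (simp add: d_def)
      finally show ?thesis unfolding split vacm using m0 by simp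
    qed
    have M1: "(\<integral>\<phi>. ?M y \<phi> ^ 1 * vac x \<phi> \<partial>\<mu>) / m = c" if "y \<in> ?Y" for y
    proof -
      have "(\<integral>\<phi>. 1 * vac x \<phi> * vac y \<phi> \<partial>\<mu>) = (\<integral>\<phi>. 1 * vac x \<phi> * ?M y \<phi> \<partial>\<mu>)"
        using that by (intro message_gibbs[OF g lam, of x y _ 1]) (auto simp: depends_on_def)
      then show ?thesis using vp[of x y] that dm by (simp add: d_def mult.commute)
    qed
    have M2: "(\<integral>\<phi>. ?M y \<phi> ^ 2 * vac x \<phi> \<partial>\<mu>) / m \<le> ?b * c\<^sup>2" if y: "y \<in> ?Y" for y
    proof -
      have "(\<integral>\<phi>. ?M y \<phi> * vac x \<phi> * vac y \<phi> \<partial>\<mu>) = (\<integral>\<phi>. ?M y \<phi> * vac x \<phi> * ?M y \<phi> \<partial>\<mu>)"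
        using y depends_on_mono[OF message_depends[of x y n lam]]
        by (intro message_gibbs[OF g lam, of x y _ 1] message_measurable message_abs lam) auto
      then have "(\<integral>\<phi>. ?M y \<phi> ^ 2 * vac x \<phi> \<partial>\<mu>) = (\<integral>\<phi>. ?M y \<phi> * vac x \<phi> * vac y \<phi> \<partial>\<mu>)"
        by (simp add: power2_eq_square mult_ac)
      also have "\<dots> \<le> ?b / ((1 + w) * (1 + 2 * w))" using Suc.IH[of x y] y by simp
      also have "\<dots> = ?b * c\<^sup>2 * m" using w by (simp add: c_def m_def power2_eq_square)
      finally show ?thesis using m0 by (simp add: divide_le_eq)
    qed
    have I1: "(\<integral>\<phi>. lam * ?P \<phi> * vac t \<phi> * vac x \<phi> \<partial>\<mu>) = w * d"
    proof -
      have "(\<integral>\<phi>. lam * ?P \<phi> * vac t \<phi> * vac x \<phi> \<partial>\<mu>) = lam * (\<integral>\<phi>. ?P \<phi> ^ 1 * vac t \<phi> * vac x \<phi> \<partial>\<mu>)"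
        by (simp add: mult.assoc)
      also have "\<dots> = lam * (d * (\<Prod>y\<in>?Y. c))" unfolding prodj
        using M1 by (intro arg_cong[where f = "\<lambda>z. lam * (d * z)"] prod.cong refl)
      also have "\<dots> = d * (lam * c ^ k)" by (simp add: cardY)
      finally show ?thesis by (simp add: lamc)
    qed
    have I2: "(\<integral>\<phi>. (lam * ?P \<phi>)\<^sup>2 * vac t \<phi> * vac x \<phi> \<partial>\<mu>) \<le> w * b * d"
    proof -
      have "(\<integral>\<phi>. (lam * ?P \<phi>)\<^sup>2 * vac t \<phi> * vac x \<phi> \<partial>\<mu>) = lam\<^sup>2 * (\<integral>\<phi>. ?P \<phi> ^ 2 * vac t \<phi> * vac x \<phi> \<partial>\<mu>)"
        by (simp add: mult.assoc power_mult_distrib)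
      also have "\<dots> = lam\<^sup>2 * (d * (\<Prod>y\<in>?Y. (\<integral>\<phi>. ?M y \<phi> ^ 2 * vac x \<phi> \<partial>\<mu>) / m))" unfolding prodj ..
      also have "\<dots> \<le> lam\<^sup>2 * (d * (\<Prod>y\<in>?Y. ?b * c\<^sup>2))"
        using M2 m0 by (intro mult_left_mono prod_mono conjI divide_nonneg_pos integral_nonneg) auto
      also have "\<dots> = d * ?b ^ k * (lam * c ^ k)\<^sup>2"
        by (simp add: cardY power_mult_distrib power_mult[symmetric] mult.commute)
      also have "\<dots> = w * b * d" by (simp add: lamc b_def power2_eq_square)
      finally show ?thesis .
    qed
    let ?vv = "\<lambda>\<phi>. vac t \<phi> * vac x \<phi>"
    have Pb: "\<bar>?P \<phi>\<bar> \<le> 1" for \<phi> by (intro prod_le_1_abs message_abs lam)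
    have mP: "?P \<in> borel_measurable (conf_space UNIV)" by (intro borel_measurable_prod message_measurable)
    note [measurable] = mP message_measurable vac_measurable
    have int0: "integrable \<mu> (\<lambda>\<phi>. vac t \<phi> * vac x \<phi>)"
      by (rule bounded_integrable[OF cp, of _ 1]) auto
    have int1: "integrable \<mu> (\<lambda>\<phi>. lam * ?P \<phi> * vac t \<phi> * vac x \<phi>)"
      by (rule bounded_integrable[OF cp, of _ lam]; (measurable)?; intro abs_mult_le)
        (use Pb lam in \<open>auto simp: abs_mult\<close>)
    have int2: "integrable \<mu> (\<lambda>\<phi>. (lam * ?P \<phi>)\<^sup>2 * vac t \<phi> * vac x \<phi>)"
      by (rule bounded_integrable[OF cp, of _ "lam\<^sup>2"]; (measurable)?; intro abs_mult_le)
        (use Pb lam in \<open>auto simp: power_mult_distrib abs_mult abs_square_le_1\<close>)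
    let ?c1 = "(1 + 2 * b) / (1 + b)\<^sup>2" and ?c2 = "1 / (1 + b)\<^sup>2"
    let ?rhs = "\<lambda>\<phi>. ?vv \<phi> - ?c1 * (lam * ?P \<phi> * vac t \<phi> * vac x \<phi>) + ?c2 * ((lam * ?P \<phi>)\<^sup>2 * vac t \<phi> * vac x \<phi>)"
    have "(\<integral>\<phi>. message lam (Suc n) t x \<phi> * vac t \<phi> * vac x \<phi> \<partial>\<mu>) \<le> (\<integral>\<phi>. ?rhs \<phi> \<partial>\<mu>)"
    proof (rule integral_mono)
      show "integrable \<mu> (\<lambda>\<phi>. message lam (Suc n) t x \<phi> * vac t \<phi> * vac x \<phi>)"
        by (rule bounded_integrable[OF cp, of _ 1]; (measurable)?; intro abs_mult_le message_abs lam) auto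
      show "integrable \<mu> ?rhs"
        by (intro Bochner_Integration.integrable_add Bochner_Integration.integrable_diff integrable_mult_right int0 int1 int2)
      fix \<phi>
      have "message lam (Suc n) t x \<phi> * ?vv \<phi> \<le> (1 - ?c1 * (lam * ?P \<phi>) + ?c2 * (lam * ?P \<phi>)\<^sup>2) * ?vv \<phi>"
        using message_Suc_le[OF lam, of b] b0 by (intro mult_right_mono) auto
      then show "message lam (Suc n) t x \<phi> * vac t \<phi> * vac x \<phi> \<le> ?rhs \<phi>"
        by (simp only: algebra_simps)
    qed
    also have "\<dots> = (\<integral>\<phi>. ?vv \<phi> \<partial>\<mu>) - ?c1 * (\<integral>\<phi>. lam * ?P \<phi> * vac t \<phi> * vac x \<phi> \<partial>\<mu>) +
        ?c2 * (\<integral>\<phi>. (lam * ?P \<phi>)\<^sup>2 * vac t \<phi> * vac x \<phi> \<partial>\<mu>)"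
      using int0 int1 int2
      by (simp only: Bochner_Integration.integral_add Bochner_Integration.integral_diff integral_mult_right_zero
          Bochner_Integration.integrable_diff integrable_mult_right)
    also have "\<dots> \<le> d - ?c1 * (w * d) + ?c2 * (w * b * d)"
      unfolding I1 using I2 vp[OF Suc.prems] by (intro add_mono mult_left_mono) (auto simp: d_def)
    also have "\<dots> = d * (1 - w / (1 + b))"
    proof -
      have "w / (1 + b) = w * (1 + b) / (1 + b)\<^sup>2" using b0 by (simp add: power2_eq_square)
      also have "\<dots> = ?c1 * w - ?c2 * (w * b)" by (simp add: diff_divide_distrib[symmetric] algebra_simps)
      finally have e: "w / (1 + b) = ?c1 * w - ?c2 * (w * b)" .
      have "d - x * (w * d) + y * (w * b * d) = d * (1 - (x * w - y * (w * b)))" for x y :: real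
        by (simp add: algebra_simps)
      then show ?thesis unfolding e .
    qed
    also have "\<dots> = info_bound k w (Suc n) / ((1 + w) * (1 + 2 * w))" using w by (simp add: d_def b_def)
    finally show ?case .
  }
qed

text \<open>Expand the square: on the event that \<open>x\<close> is vacant, \<open>message_gibbs\<close> turns the integral of the message into a
probability of vacancy and that of its square into the quantity bounded in \<open>simple_info_bound\<close>.\<close>

lemma simple_concentration:
  assumes g: "gibbs adj lam \<mu>" and s: "simple_measure adj \<mu>"
    and p: "\<And>x. measure \<mu> {\<phi>. \<phi> x} = w / (1 + 2 * w)"
    and w: "w > 0" "w * (1 + w) ^ k = lam" and a: "adj x y"
  shows "(\<integral>\<phi>. (message lam n x y \<phi> - 1 / (1 + w))\<^sup>2 * vac x \<phi> \<partial>\<mu>) \<le> info_bound k w n - 1"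
proof -
  have cp: "conf_prob \<mu>" using g by (simp add: gibbs_def)
  have lam: "lam > 0" using w by (metis add_pos_pos mult_pos_pos zero_less_one zero_less_power)
  have p1: "w / (1 + 2 * w) < 1" using w by simp
  have e: "\<And>x y. adj x y \<Longrightarrow> AE \<phi> in \<mu>. \<not> (\<phi> x \<and> \<phi> y)" using gibbs_edge[OF g] .
  let ?M = "message lam n x y"
  define c where "c = 1 / (1 + w)"
  define d where "d = 1 / (1 + 2 * w)"
  note [measurable] = message_measurable vac_measurable
  have i0: "(\<integral>\<phi>. vac x \<phi> \<partial>\<mu>) * c = d"
  proof -
    have "(\<integral>\<phi>. vac x \<phi> \<partial>\<mu>) = 1 - w / (1 + 2 * w)"
      using integral_event[OF cp, of "\<lambda>\<phi>. \<not> \<phi> x"] conf_prob_compl[OF cp, of "\<lambda>\<phi>. \<phi> x"] p by simp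
    also have "\<dots> = (1 + w) / (1 + 2 * w)" using w by (simp add: field_simps)
    finally show ?thesis using w by (simp add: c_def d_def)
  qed
  have vp: "(\<integral>\<phi>. vac x \<phi> * vac y \<phi> \<partial>\<mu>) = d"
  proof -
    have "(\<integral>\<phi>. vac x \<phi> * vac y \<phi> \<partial>\<mu>) = measure \<mu> {\<phi>. \<not> \<phi> x \<and> \<not> \<phi> y}"
      using integral_event[OF cp, of "\<lambda>\<phi>. \<not> \<phi> x \<and> \<not> \<phi> y"] by (simp add: of_bool_conj)
    also have "\<dots> = 1 - 2 * (w / (1 + 2 * w))" by (rule simple_hc_chain(2)[OF cp s e p p1 a])
    also have "\<dots> = d" using w by (simp add: d_def field_simps)
    finally show ?thesis .
  qed
  have i1: "(\<integral>\<phi>. vac x \<phi> * ?M \<phi> \<partial>\<mu>) = d"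
    using message_gibbs[OF g lam a, of "\<lambda>_. 1" 1 n] vp by (simp add: depends_on_def)
  have i2: "(\<integral>\<phi>. ?M \<phi> * vac x \<phi> * ?M \<phi> \<partial>\<mu>) \<le> info_bound k w n * c * d"
  proof -
    have "(\<integral>\<phi>. ?M \<phi> * vac x \<phi> * ?M \<phi> \<partial>\<mu>) = (\<integral>\<phi>. ?M \<phi> * vac x \<phi> * vac y \<phi> \<partial>\<mu>)"
      using depends_on_mono[OF message_depends[OF a, of n lam]]
      by (intro message_gibbs[OF g lam a, of _ 1, symmetric] message_measurable message_abs lam) auto
    also have "\<dots> \<le> info_bound k w n / ((1 + w) * (1 + 2 * w))" by (rule simple_info_bound[OF g s p w a])
    finally show ?thesis by (simp add: c_def d_def)
  qed
  have int: "integrable \<mu> (\<lambda>\<phi>. ?M \<phi> * vac x \<phi> * ?M \<phi>)" "integrable \<mu> (\<lambda>\<phi>. vac x \<phi> * ?M \<phi>)" "integrable \<mu> (vac x)"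
    by (rule bounded_integrable[OF cp, of _ 1]; (measurable)?; (intro abs_mult_le message_abs lam)?; (simp add: message_abs lam)?)+
  have "(\<integral>\<phi>. (?M \<phi> - c)\<^sup>2 * vac x \<phi> \<partial>\<mu>) =
      (\<integral>\<phi>. ?M \<phi> * vac x \<phi> * ?M \<phi> - 2 * c * (vac x \<phi> * ?M \<phi>) + c\<^sup>2 * vac x \<phi> \<partial>\<mu>)"
    by (intro Bochner_Integration.integral_cong refl) (simp add: power2_eq_square algebra_simps)
  also have "\<dots> = (\<integral>\<phi>. ?M \<phi> * vac x \<phi> * ?M \<phi> \<partial>\<mu>) - 2 * c * (\<integral>\<phi>. vac x \<phi> * ?M \<phi> \<partial>\<mu>) + c\<^sup>2 * (\<integral>\<phi>. vac x \<phi> \<partial>\<mu>)"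
    using int by (simp only: Bochner_Integration.integral_add Bochner_Integration.integral_diff integral_mult_right_zero
          Bochner_Integration.integrable_diff integrable_mult_right)
  also have "\<dots> \<le> info_bound k w n * c * d - 2 * c * d + c * d"
  proof -
    have "c\<^sup>2 * (\<integral>\<phi>. vac x \<phi> \<partial>\<mu>) = c * d" using i0 by (simp add: power2_eq_square mult_ac)
    then show ?thesis using i1 i2 by (intro add_mono diff_mono) auto
  qed
  also have "\<dots> = (info_bound k w n - 1) * (c * d)" by (simp add: algebra_simps)
  also have "\<dots> \<le> (info_bound k w n - 1) * 1"
    using info_bound_ge_1[OF w(1), of k n] w by (intro mult_left_mono mult_le_one) (auto simp: c_def d_def)
  finally show ?thesis by (simp add: c_def)
qed

end

section \<open>Extremality\<close>

context reg_tree begin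

text \<open>Under \<open>\<nu>\<close> the state of \<open>y\<close> may be replaced by its message of any depth. The message is close to
\<open>1 / (1 + w)\<close> with high probability under \<open>\<mu>\<close>, by Chebyshev's inequality, and therefore also under \<open>\<nu>\<close>.\<close>

lemma dominated_independence:
  assumes k: "k \<ge> 1" and lam: "lam \<le> exp 1 - 1" and w: "w > 0" "w * (1 + w) ^ k = lam"
    and g: "gibbs adj lam \<mu>" and s: "simple_measure adj \<mu>" and p: "\<And>x. measure \<mu> {\<phi>. \<phi> x} = w / (1 + 2 * w)"
    and g': "gibbs adj lam \<nu>" and q: "q > 0" and dom: "\<forall>A\<in>sets (conf_space UNIV). q * measure \<nu> A \<le> measure \<mu> A"
    and a: "adj x y" and f: "f \<in> borel_measurable (conf_space UNIV)" "\<And>\<phi>. \<bar>f \<phi>\<bar> \<le> 1" "depends_on (- br x y) f"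
  shows "(\<integral>\<phi>. f \<phi> * vac x \<phi> * vac y \<phi> \<partial>\<nu>) = 1 / (1 + w) * (\<integral>\<phi>. f \<phi> * vac x \<phi> \<partial>\<nu>)"
proof -
  have cp: "conf_prob \<mu>" "conf_prob \<nu>" using g g' by (simp_all add: gibbs_def)
  interpret N: prob_space \<nu> using cp(2) by (rule conf_prob_prob_space)
  have lam0: "lam > 0" using w by (metis add_pos_pos mult_pos_pos zero_less_one zero_less_power)
  define c where "c = 1 / (1 + w)"
  have c: "0 < c" "c < 1" using w by (auto simp: c_def)
  define L where "L = (\<integral>\<phi>. f \<phi> * vac x \<phi> * vac y \<phi> \<partial>\<nu>) - c * (\<integral>\<phi>. f \<phi> * vac x \<phi> \<partial>\<nu>)"
  note [measurable] = f(1) message_measurable vac_measurable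
  have int: "integrable \<rho> h" if "conf_prob \<rho>" "h \<in> borel_measurable (conf_space UNIV)" "\<And>\<phi>. \<bar>h \<phi>\<bar> \<le> 1"
    for \<rho> and h :: "('v \<Rightarrow> bool) \<Rightarrow> real"
    using that by (rule bounded_integrable)
  have bound: "\<bar>L\<bar> \<le> \<delta> + (info_bound k w n - 1) / (q * \<delta>\<^sup>2)" if \<delta>: "\<delta> > 0" for n \<delta>
  proof -
    let ?M = "message lam n x y"
    have Mc: "\<bar>?M \<phi> - c\<bar> \<le> 1" for \<phi> using message_bounds[OF lam0, of n x y \<phi>] c by auto
    let ?E = "\<lambda>\<phi>. \<not> \<phi> x \<and> \<delta> \<le> \<bar>?M \<phi> - c\<bar>"
    have mE: "Measurable.pred (conf_space UNIV) ?E" by measurable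
    have "(\<integral>\<phi>. f \<phi> * vac x \<phi> * vac y \<phi> \<partial>\<nu>) = (\<integral>\<phi>. f \<phi> * vac x \<phi> * ?M \<phi> \<partial>\<nu>)"
    proof (rule message_gibbs[OF g' lam0 a f(1,2)])
      show "depends_on (- branch_ball n x y) f" by (rule depends_on_mono[OF f(3)]) (use branch_ball_subset[OF a, of n] in auto)
    qed
    also have "\<dots> - c * (\<integral>\<phi>. f \<phi> * vac x \<phi> \<partial>\<nu>) = (\<integral>\<phi>. f \<phi> * vac x \<phi> * ?M \<phi> - c * (f \<phi> * vac x \<phi>) \<partial>\<nu>)"
    proof -
      have "integrable \<nu> (\<lambda>\<phi>. f \<phi> * vac x \<phi> * ?M \<phi>)" "integrable \<nu> (\<lambda>\<phi>. f \<phi> * vac x \<phi>)"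
        by (rule int[OF cp(2)]; (measurable)?; intro abs_mult_le f message_abs lam0; simp)+
      then show ?thesis by (subst Bochner_Integration.integral_diff) auto
    qed
    finally have L: "L = (\<integral>\<phi>. f \<phi> * vac x \<phi> * (?M \<phi> - c) \<partial>\<nu>)" by (simp add: L_def algebra_simps)
    have "\<bar>L\<bar> \<le> (\<integral>\<phi>. \<bar>f \<phi> * vac x \<phi> * (?M \<phi> - c)\<bar> \<partial>\<nu>)" unfolding L by (rule integral_abs_bound)
    also have "\<dots> \<le> (\<integral>\<phi>. \<delta> + of_bool (?E \<phi>) \<partial>\<nu>)"
    proof (rule integral_mono)
      have b: "\<bar>f \<phi> * vac x \<phi> * (?M \<phi> - c)\<bar> \<le> 1" for \<phi> by (intro abs_mult_le f Mc) simp
      then show "integrable \<nu> (\<lambda>\<phi>. \<bar>f \<phi> * vac x \<phi> * (?M \<phi> - c)\<bar>)"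
        by (intro int[OF cp(2)]) auto
      have "integrable \<nu> (\<lambda>\<phi>. of_bool (?E \<phi>) :: real)" using mE by (intro int[OF cp(2)] measurable_of_bool) auto
      then show "integrable \<nu> (\<lambda>\<phi>. \<delta> + of_bool (?E \<phi>))" by simp
      fix \<phi>
      have "\<bar>f \<phi> * (?M \<phi> - c)\<bar> \<le> \<bar>?M \<phi> - c\<bar>" unfolding abs_mult using f(2)[of \<phi>] by (intro mult_left_le_one_le) auto
      then show "\<bar>f \<phi> * vac x \<phi> * (?M \<phi> - c)\<bar> \<le> \<delta> + of_bool (?E \<phi>)"
        using b[of \<phi>] \<delta> by (cases "\<phi> x"; cases "\<delta> \<le> \<bar>?M \<phi> - c\<bar>") auto
    qed
    also have "\<dots> = \<delta> + measure \<nu> {\<phi>. ?E \<phi>}"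
    proof -
      have "integrable \<nu> (\<lambda>\<phi>. of_bool (?E \<phi>) :: real)" using mE by (intro int[OF cp(2)] measurable_of_bool) auto
      then show ?thesis using integral_event[OF cp(2) mE]
        by (subst Bochner_Integration.integral_add) (auto simp: N.prob_space)
    qed
    also have "measure \<nu> {\<phi>. ?E \<phi>} \<le> (info_bound k w n - 1) / (q * \<delta>\<^sup>2)"
    proof -
      have "q * measure \<nu> {\<phi>. ?E \<phi>} \<le> measure \<mu> {\<phi>. ?E \<phi>}"
        using mE by (intro dom[rule_format]) (simp add: pred_def)
      also have "\<dots> = (\<integral>\<phi>. of_bool (?E \<phi>) \<partial>\<mu>)" using integral_event[OF cp(1) mE] by simp
      also have "\<dots> \<le> (\<integral>\<phi>. 1 / \<delta>\<^sup>2 * ((?M \<phi> - c)\<^sup>2 * vac x \<phi>) \<partial>\<mu>)"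
      proof (rule integral_mono)
        show "integrable \<mu> (\<lambda>\<phi>. of_bool (?E \<phi>) :: real)" using mE by (intro int[OF cp(1)] measurable_of_bool) auto
        have "\<bar>(?M \<phi> - c)\<^sup>2 * vac x \<phi>\<bar> \<le> 1" for \<phi>
          using Mc[of \<phi>] by (intro abs_mult_le) (auto simp: abs_square_le_1)
        then have "integrable \<mu> (\<lambda>\<phi>. (?M \<phi> - c)\<^sup>2 * vac x \<phi>)" by (intro int[OF cp(1)]) auto
        then show "integrable \<mu> (\<lambda>\<phi>. 1 / \<delta>\<^sup>2 * ((?M \<phi> - c)\<^sup>2 * vac x \<phi>))" by (intro integrable_mult_right)
        fix \<phi>
        show "of_bool (?E \<phi>) \<le> 1 / \<delta>\<^sup>2 * ((?M \<phi> - c)\<^sup>2 * vac x \<phi>)"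
        proof (cases "?E \<phi>")
          case True
          then have "\<delta>\<^sup>2 \<le> (?M \<phi> - c)\<^sup>2" using \<delta> by (simp add: abs_le_square_iff[symmetric])
          then show ?thesis using True \<delta> by simp
        next
          case False
          then have "of_bool (?E \<phi>) = (0 :: real)" by simp
          also have "0 \<le> 1 / \<delta>\<^sup>2 * ((?M \<phi> - c)\<^sup>2 * vac x \<phi>)" by simp
          finally show ?thesis .
        qed
      qed
      also have "\<dots> = 1 / \<delta>\<^sup>2 * (\<integral>\<phi>. (?M \<phi> - c)\<^sup>2 * vac x \<phi> \<partial>\<mu>)" by (rule integral_mult_right_zero)
      also have "\<dots> \<le> 1 / \<delta>\<^sup>2 * (info_bound k w n - 1)"
        unfolding c_def by (intro mult_left_mono simple_concentration[OF g s p w a]) simp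
      finally have "(q * measure \<nu> {\<phi>. ?E \<phi>}) / q \<le> (1 / \<delta>\<^sup>2 * (info_bound k w n - 1)) / q"
        using q by (intro divide_right_mono) auto
      then show ?thesis using q by (simp add: mult.commute)
    qed
    finally show ?thesis by simp
  qed
  have "\<bar>L\<bar> \<le> \<delta>" if \<delta>: "\<delta> > 0" for \<delta>
  proof (rule LIMSEQ_le_const)
    have "(\<lambda>n. \<delta> + (info_bound k w n - 1) / (q * \<delta>\<^sup>2)) \<longlonglongrightarrow> \<delta> + (1 - 1) / (q * \<delta>\<^sup>2)"
      using q \<delta> by (intro tendsto_intros info_bound_tendsto[OF k w lam]) auto
    then show "(\<lambda>n. \<delta> + (info_bound k w n - 1) / (q * \<delta>\<^sup>2)) \<longlonglongrightarrow> \<delta>" by simp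
    show "\<exists>N. \<forall>n\<ge>N. \<bar>L\<bar> \<le> \<delta> + (info_bound k w n - 1) / (q * \<delta>\<^sup>2)" using bound[OF \<delta>] by blast
  qed
  then have "\<bar>L\<bar> \<le> 0" by (rule field_le_epsilon) auto
  then show ?thesis by (simp add: L_def c_def)
qed

text \<open>The density comes out right as well: replacing all neighbours of a vacant site by \<open>1 / (1 + w)\<close> in the single-site
property at \<open>x\<close> gives a linear equation for it.\<close>

lemma dominated_hc_chain:
  assumes k: "k \<ge> 1" and lam: "lam \<le> exp 1 - 1" and w: "w > 0" "w * (1 + w) ^ k = lam"
    and g: "gibbs adj lam \<mu>" and s: "simple_measure adj \<mu>" and p: "\<And>x. measure \<mu> {\<phi>. \<phi> x} = w / (1 + 2 * w)"
    and g': "gibbs adj lam \<nu>" and q: "q > 0" and dom: "\<forall>A\<in>sets (conf_space UNIV). q * measure \<nu> A \<le> measure \<mu> A"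
  shows "hc_chain adj (1 / (1 + w)) (w / (1 + 2 * w)) \<nu>"
proof -
  have cp: "conf_prob \<nu>" using g' by (simp add: gibbs_def)
  have lam0: "lam > 0" using w by (metis add_pos_pos mult_pos_pos zero_less_one zero_less_power)
  define c where "c = 1 / (1 + w)"
  note indep = dominated_independence[OF k lam w g s p g' q dom, folded c_def]
  have chain: "measure \<nu> (atom T \<sigma> \<inter> {\<phi>. \<not> \<phi> y}) = c * measure \<nu> (atom T \<sigma>)"
    if a: "adj x y" and T: "finite T" "x \<in> T" "T \<inter> br x y = {}" and \<sigma>: "\<not> \<sigma> x" for x y T \<sigma>
  proof -
    have m: "Measurable.pred (conf_space UNIV) (\<lambda>\<phi>. \<phi> \<in> atom T \<sigma>)" by (rule pred_atom[OF T(1)])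
    have at: "\<phi> \<in> atom T \<sigma> \<Longrightarrow> \<not> \<phi> x" for \<phi> using T(2) \<sigma> by (auto simp: atom_def)
    have "(\<integral>\<phi>. of_bool (\<phi> \<in> atom T \<sigma>) * vac x \<phi> * vac y \<phi> \<partial>\<nu>) = c * (\<integral>\<phi>. of_bool (\<phi> \<in> atom T \<sigma>) * vac x \<phi> \<partial>\<nu>)"
    proof (rule indep[OF a])
      show "(\<lambda>\<phi>. of_bool (\<phi> \<in> atom T \<sigma>) :: real) \<in> borel_measurable (conf_space UNIV)"
        by (rule measurable_of_bool[OF m])
      have "\<phi> \<in> atom T \<sigma> \<longleftrightarrow> \<psi> \<in> atom T \<sigma>" if "\<forall>v\<in>- br x y. \<phi> v = \<psi> v" for \<phi> \<psi>
        using that T(3) by (auto simp: atom_def)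
      then show "depends_on (- br x y) (\<lambda>\<phi>. of_bool (\<phi> \<in> atom T \<sigma>) :: real)"
        unfolding depends_on_def by (intro allI impI arg_cong[where f = of_bool]) blast
    qed simp
    moreover have "(\<lambda>\<phi>. of_bool (\<phi> \<in> atom T \<sigma>) * vac x \<phi> * vac y \<phi>) = (\<lambda>\<phi>. of_bool (\<phi> \<in> atom T \<sigma> \<and> \<not> \<phi> y) :: real)"
      "(\<lambda>\<phi>. of_bool (\<phi> \<in> atom T \<sigma>) * vac x \<phi>) = (\<lambda>\<phi>. of_bool (\<phi> \<in> atom T \<sigma>) :: real)"
      using at by (auto simp: fun_eq_iff)
    moreover have "(\<integral>\<phi>. of_bool (\<phi> \<in> atom T \<sigma> \<and> \<not> \<phi> y) \<partial>\<nu> :: real) = measure \<nu> {\<phi>. \<phi> \<in> atom T \<sigma> \<and> \<not> \<phi> y}"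
      by (rule integral_event[OF cp pred_intros_logic(3)[OF m]]) measurable
    moreover have "(\<integral>\<phi>. of_bool (\<phi> \<in> atom T \<sigma>) \<partial>\<nu> :: real) = measure \<nu> {\<phi>. \<phi> \<in> atom T \<sigma>}"
      by (rule integral_event[OF cp m])
    ultimately show ?thesis by (simp add: Int_def)
  qed
  have marg: "measure \<nu> {\<phi>. \<phi> x} = w / (1 + 2 * w)" for x
  proof -
    let ?v = "\<integral>\<phi>. vac x \<phi> \<partial>\<nu>"
    have prods: "(\<integral>\<phi>. (\<Prod>y\<in>W. vac y \<phi>) * vac x \<phi> \<partial>\<nu>) = c ^ card W * ?v" if "finite W" "W \<subseteq> nb x" for W
      using that
    proof (induction W rule: finite_induct)
      case (insert y W)
      have a: "adj x y" using insert.prems by simp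
      have "(\<integral>\<phi>. (\<Prod>y\<in>W. vac y \<phi>) * vac x \<phi> * vac y \<phi> \<partial>\<nu>) = c * (\<integral>\<phi>. (\<Prod>y\<in>W. vac y \<phi>) * vac x \<phi> \<partial>\<nu>)"
      proof (rule indep[OF a])
        show "(\<lambda>\<phi>. \<Prod>y\<in>W. vac y \<phi>) \<in> borel_measurable (conf_space UNIV)"
          by (intro borel_measurable_prod vac_measurable)
        show "\<bar>\<Prod>y\<in>W. vac y \<phi>\<bar> \<le> 1" for \<phi> by (rule prod_le_1_abs) simp
        have "z \<notin> br x y" if z: "z \<in> W" for z
          using br_inj[OF a, of z z] br_self[of z x] z insert by auto
        then show "depends_on (- br x y) (\<lambda>\<phi>. \<Prod>y\<in>W. vac y \<phi>)" by (intro depends_prod depends_vac) simp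
      qed
      then show ?case using insert by (simp add: mult_ac)
    qed simp
    have "(\<integral>\<phi>. 1 * of_bool (\<phi> x) \<partial>\<nu>) = lam * (\<integral>\<phi>. 1 * of_bool (\<not> \<phi> x \<and> (\<forall>v\<in>nb x. \<not> \<phi> v)) \<partial>\<nu> :: real)"
      by (rule gibbs_site[OF g' lam0, of _ 1]) (auto simp: depends_on_def)
    also have "(\<integral>\<phi>. 1 * of_bool (\<not> \<phi> x \<and> (\<forall>v\<in>nb x. \<not> \<phi> v)) \<partial>\<nu> :: real) = (\<integral>\<phi>. (\<Prod>y\<in>nb x. vac y \<phi>) * vac x \<phi> \<partial>\<nu>)"
      by (intro Bochner_Integration.integral_cong refl) (simp add: prod_of_bool[OF finite_nb] del: in_nb)
    also have "\<dots> = c ^ (k + 1) * ?v" using prods[OF finite_nb order_refl] card_nb by simp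
    finally have "measure \<nu> {\<phi>. \<phi> x} = lam * c ^ k * c * ?v"
      using integral_event[OF cp, of "\<lambda>\<phi>. \<phi> x"] by simp
    moreover have "?v = 1 - measure \<nu> {\<phi>. \<phi> x}"
      using integral_event[OF cp, of "\<lambda>\<phi>. \<not> \<phi> x"] conf_prob_compl[OF cp, of "\<lambda>\<phi>. \<phi> x"] by simp
    moreover have "lam * c ^ k = w" using w by (simp add: c_def w(2)[symmetric] power_divide)
    ultimately have "measure \<nu> {\<phi>. \<phi> x} = w * c * (1 - measure \<nu> {\<phi>. \<phi> x})" by simp
    then show ?thesis using w by (simp add: c_def field_simps)
  qed
  show ?thesis
    unfolding hc_chain_def c_def[symmetric] using cp marg gibbs_edge[OF g'] chain by blast
qed

lemma simple_invariant_gibbs_unique: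
  assumes lam: "0 < lam"
  shows "\<exists>!\<mu>. simple_invariant_gibbs adj lam \<mu>"
proof -
  obtain w where w: "0 < w" "w * (1 + w) ^ k = lam" using activity_exists[OF lam] by blast
  fix r :: 'v
  have ex: "simple_invariant_gibbs adj lam (hc_measure w r)"
    by (rule hc_measure_simple_invariant_gibbs[OF w])
  have "\<mu> = hc_measure w r" if "simple_invariant_gibbs adj lam \<mu>" for \<mu>
    using simple_gibbs_hc_chain[OF lam _ _ _ w] that ex hc_chain_unique
    unfolding simple_invariant_gibbs_def by blast
  then show ?thesis using ex by blast
qed

lemma simple_invariant_gibbs_extremal:
  assumes k: "k \<ge> 1" and lam: "0 < lam" "lam \<le> exp 1 - 1" and m: "simple_invariant_gibbs adj lam \<mu>"
  shows "extremal_gibbs adj lam \<mu>"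
proof -
  obtain w where w: "0 < w" "w * (1 + w) ^ k = lam" using activity_exists[OF lam(1)] by blast
  have g: "gibbs adj lam \<mu>" and s: "simple_measure adj \<mu>" and i: "invariant_measure adj \<mu>"
    using m by (auto simp: simple_invariant_gibbs_def)
  have p: "measure \<mu> {\<phi>. \<phi> x} = w / (1 + 2 * w)" for x
    using simple_gibbs_hc_chain[OF lam(1) g s i w] by (simp add: hc_chain_def)
  have chain: "hc_chain adj (1 / (1 + w)) (w / (1 + 2 * w)) \<nu>"
    if "gibbs adj lam \<nu>" "q > 0" "\<forall>A\<in>sets (conf_space UNIV). q * measure \<nu> A \<le> measure \<mu> A" for \<nu> q
    using dominated_hc_chain[OF k lam(2) w g s p that] .
  have False
    if n: "gibbs adj lam \<nu>\<^sub>1" "gibbs adj lam \<nu>\<^sub>2" "\<nu>\<^sub>1 \<noteq> \<nu>\<^sub>2" and t: "0 < t" "t < 1"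
      and mix: "\<forall>A\<in>sets (conf_space UNIV). measure \<mu> A = t * measure \<nu>\<^sub>1 A + (1 - t) * measure \<nu>\<^sub>2 A" for \<nu>\<^sub>1 \<nu>\<^sub>2 t
  proof -
    have "hc_chain adj (1 / (1 + w)) (w / (1 + 2 * w)) \<nu>\<^sub>1"
      by (rule chain[OF n(1) t(1)]) (use mix t in auto)
    moreover have "hc_chain adj (1 / (1 + w)) (w / (1 + 2 * w)) \<nu>\<^sub>2"
      by (rule chain[OF n(2), of "1 - t"]) (use mix t in auto)
    ultimately show False using hc_chain_unique n(3) by blast
  qed
  then show ?thesis unfolding extremal_gibbs_def using g by blast
qed

end

theorem mainTheorem3:
  fixes k :: nat and adj :: "'v \<Rightarrow> 'v \<Rightarrow> bool"
  assumes "k \<ge> 1" and "regular_tree k adj"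
  shows "(\<forall>lam::real. 0 < lam \<and> lam \<le> exp 1 - 1 \<longrightarrow>
            (\<exists>!\<mu>. simple_invariant_gibbs adj lam \<mu>) \<and>
            extremal_gibbs adj lam (THE \<mu>. simple_invariant_gibbs adj lam \<mu>))
       \<and> extremal_gibbs adj 1 (THE \<mu>. simple_invariant_gibbs adj 1 \<mu>)"
proof -
  interpret reg_tree k adj by unfold_locales (rule assms(2))
  have main: "(\<exists>!\<mu>. simple_invariant_gibbs adj lam \<mu>) \<and>
      extremal_gibbs adj lam (THE \<mu>. simple_invariant_gibbs adj lam \<mu>)"
    if lam: "0 < lam" "lam \<le> exp 1 - 1" for lam :: real
  proof -
    have u: "\<exists>!\<mu>. simple_invariant_gibbs adj lam \<mu>" by (rule simple_invariant_gibbs_unique[OF lam(1)])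
    show ?thesis using u simple_invariant_gibbs_extremal[OF assms(1) lam theI'[OF u]] by blast
  qed
  have "(1::real) \<le> exp 1 - 1" using exp_ge_add_one_self[of "1::real"] by simp
  then show ?thesis using main by auto
qed

end
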